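(* Let $\{\eta_t,\ t\ge0\}$ be the boundary driven diffusion gas in a regular domain $\mathfrak D\subset\mathbb{R}^d$ with reservoir intensity $\lambda:\partial\mathfrak D\to\mathbb{R}_+$ (bounded, measurable) and a priori finite measure $\mu$ on $\mathfrak D$. (i) Let $\rho$ be a finite measure on $\mathfrak D$. If $\eta_0$ is distributed according to $\mathcal P_\rho$, the law of the Poisson point process with intensity measure $\rho$, then $\eta_t$ is distributed as the restriction to $\mathfrak D$ of the Poisson process on $\bar{\mathfrak D}$ with intensity measure $$\rho_t=S_t^*\rho+\lambda_t.$$ (ii) Assume further that there is a finite measure $m$ on $\mathfrak D$ such that the transition probability $p_t$ of the absorbed diffusion $\{X_t\}$ satisfies $p_t(x,\mathrm{d}y)m(\mathrm{d}x)=p_t(y,\mathrm{d}x)m(\mathrm{d}y)$ on $\mathfrak D\times\mathfrak D$, and take $\mu=m$. Then the unique stationary measure for the boundary driven diffusion gas is the distribution of a Poisson point process on $\mathfrak D$ with intensity $\lambda_\infty(\mathrm{d}x)=h(x)\,m(\mathrm{d}x)$, where $$h(x)=\int_{\partial\mathfrak D}\lambda(u)\,\mathbb{P}^{\mathrm{abs}}_x(X_{\tau_{\partial\mathfrak D}}\in\mathrm{d}u).$$ Moreover, for any initial (finite) configuration $\eta$, the distribution of $\eta_t$ converges weakly as $t\to\infty$ to the distribution of the Poisson point process with intensity $\lambda_\infty(\mathrm{d}x)=h(x)\,m(\mathrm{d}x)$.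
   Context: **Domain and diffusion.** A regular domain $\mathfrak D\subset\mathbb{R}^d$ is an open, simply connected, bounded set with Lipschitz boundary $\partial\mathfrak D$; $\bar{\mathfrak D}=\mathfrak D\cup\partial\mathfrak D$. $\{Y_t\}$ is the diffusion on $\mathbb{R}^d$ with generator $\mathcal L=\sum_{i,j}\partial_{x_i}(a_{i,j}(x)\partial_{x_j})+\sum_i b_i(x)\partial_{x_i}$, where $a=(a_{i,j})$ is symmetric, non-degenerate and positive definite, and $\partial^2a_{i,j}/\partial x_i\partial x_\ell$ and $\partial b_i/\partial x_j$ are locally uniformly Hölder continuous on $\bar{\mathfrak D}$. $\{X_t\}$ is the Markov process on $\bar{\mathfrak D}$ evolving as $Y$ in $\mathfrak D$ and absorbed upon hitting $\partial\mathfrak D$. Its semigroup is $S_t$, its transition probability $p_t$, and its law from $x$ is $\mathbb{P}^{\mathrm{abs}}_x$. With $\tau_{\partial\mathfrak D}$ the hitting time of $\partial\mathfrak D$, it is assumed that $\mathbb{P}^{\mathrm{abs}}_x(\tau_{\partial\mathfrak D}<\infty)=1$ for all $x\in\mathfrak D$. $S_t^*$ acts on measures by $\int f\,\mathrm{d}S_t^*\nu=\int S_tf\,\mathrm{d}\nu$. **Boundary driven diffusion gas.** All initial configurations are finite (they may be random). Started from $\eta=\sum_{i=1}^{\mathbf N}\delta_{x_i}$, $x_i\in\mathfrak D$, it is $\eta_t=\xi_t|_{\mathfrak D}+\Theta_t$, viewed as a point configuration on $\mathfrak D$. Here $\xi_t=\sum_{i=1}^{\mathbf N}\delta_{X_t(i)}$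 with $X(i)$ independent copies of $X$, $X_0(i)=x_i$, $\xi_t|_{\mathfrak D}$ is the restriction to $\mathfrak D$, and $\Theta_t$, independent of the initial configuration and of $\xi_t$, is a Poisson point process on $\mathfrak D$ with intensity measure $$\lambda_t(\mathrm{d}x)=\left(\int_{\partial\mathfrak D}\lambda(y)\,\mathbb{P}^{\mathrm{abs}}_x(\tau_{\partial\mathfrak D}\le t,\ X_{\tau_{\partial\mathfrak D}}\in\mathrm{d}y)\right)\mu(\mathrm{d}x)$$ (regarded as a measure on $\bar{\mathfrak D}$ giving zero mass to $\partial\mathfrak D$ where needed). Under the condition in (ii) with $\mu=m$, $\{\eta_t\}$ is a Markov process whose transition function is the law of $\eta_t$ started from $\eta$. **Stationarity.** A stationary measure is a probability law $\nu$ on finite point configurations on $\mathfrak D$ such that $\eta_0\sim\nu$ implies $\eta_t\sim\nu$ for all $t\ge0$. Weak convergence is convergence in distribution of point processes on $\mathfrak D$. *)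

theory Defs
  imports "HOL-Probability.Probability" "HOL-Library.Multiset"
begin

section \<open>Regular domains\<close>

text \<open>Lipschitz boundary: near each boundary point, and after choosing a direction \<^term>\<open>e\<close>,
  \<^term>\<open>D\<close> is the part strictly above the graph of a Lipschitz function of the component
  orthogonal to \<^term>\<open>e\<close>.\<close>

definition lipschitz_boundary :: "'a::euclidean_space set \<Rightarrow> bool" where
  "lipschitz_boundary D \<longleftrightarrow>
    (\<forall>z\<in>frontier D. \<exists>r>0. \<exists>e \<gamma>. \<exists>L. norm e = 1 \<and> L-lipschitz_on {y. y \<bullet> e = 0} (\<gamma> :: 'a \<Rightarrow> real) \<and>
       D \<inter> ball z r = {x \<in> ball z r. \<gamma> (x - (x \<bullet> e) *\<^sub>R e) < x \<bullet> e})"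

definition regular_domain :: "'a::euclidean_space set \<Rightarrow> bool" where
  "regular_domain D \<longleftrightarrow>
    D \<noteq> {} \<and> open D \<and> simply_connected D \<and> bounded D \<and> lipschitz_boundary D"

section \<open>The generator\<close>

definition partial :: "'d::finite \<Rightarrow> (real^'d \<Rightarrow> real) \<Rightarrow> real^'d \<Rightarrow> real" where
  "partial i f x = deriv (\<lambda>s. f (x + s *\<^sub>R axis i 1)) 0"

definition has_partial :: "'d::finite \<Rightarrow> (real^'d \<Rightarrow> real) \<Rightarrow> real^'d \<Rightarrow> bool" where
  "has_partial i f x \<longleftrightarrow> (\<lambda>s. f (x + s *\<^sub>R axis i 1)) differentiable (at (0::real))"

definition locally_holder_on :: "'a::metric_space set \<Rightarrow> ('a \<Rightarrow> real) \<Rightarrow> bool" where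
  "locally_holder_on S f \<longleftrightarrow>
    (\<forall>K. compact K \<and> K \<subseteq> S \<longrightarrow>
       (\<exists>\<alpha> C. 0 < \<alpha> \<and> \<alpha> \<le> 1 \<and> (\<forall>x\<in>K. \<forall>y\<in>K. \<bar>f x - f y\<bar> \<le> C * dist x y powr \<alpha>)))"

text \<open>The third conjunct only says that the generator below is meaningful on all of space;
  the regularity of the coefficients is required on \<^term>\<open>closure D\<close>.\<close>

definition diffusion_coefficients ::
  "(real^'d::finite) set \<Rightarrow> (real^'d \<Rightarrow> real^'d^'d) \<Rightarrow> (real^'d \<Rightarrow> real^'d) \<Rightarrow> bool" where
  "diffusion_coefficients D a b \<longleftrightarrow>
    (\<forall>x. transpose (a x) = a x) \<and>
    (\<forall>x v. v \<noteq> 0 \<longrightarrow> v \<bullet> (a x *v v) > 0) \<and>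
    (\<forall>i j k x. has_partial k (\<lambda>y. a y $ i $ j) x) \<and>
    (\<forall>i j l. (\<forall>x\<in>closure D. has_partial i (partial l (\<lambda>y. a y $ i $ j)) x) \<and>
       locally_holder_on (closure D) (partial i (partial l (\<lambda>y. a y $ i $ j)))) \<and>
    (\<forall>i j. (\<forall>x\<in>closure D. has_partial j (\<lambda>y. b y $ i) x) \<and>
       locally_holder_on (closure D) (partial j (\<lambda>y. b y $ i)))"

definition generator ::
  "(real^'d::finite \<Rightarrow> real^'d^'d) \<Rightarrow> (real^'d \<Rightarrow> real^'d) \<Rightarrow> (real^'d \<Rightarrow> real) \<Rightarrow> real^'d \<Rightarrow> real" where
  "generator a b f x =
    (\<Sum>i\<in>UNIV. \<Sum>j\<in>UNIV. partial i (\<lambda>y. a y $ i $ j * partial j f y) x) +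
    (\<Sum>i\<in>UNIV. b x $ i * partial i f x)"

definition C2_compact_support :: "(real^'d::finite \<Rightarrow> real) \<Rightarrow> bool" where
  "C2_compact_support f \<longleftrightarrow>
    (\<exists>K. compact K \<and> (\<forall>x. x \<notin> K \<longrightarrow> f x = 0)) \<and> continuous_on UNIV f \<and>
    (\<forall>i. (\<forall>x. has_partial i f x) \<and> continuous_on UNIV (partial i f)) \<and>
    (\<forall>i j. (\<forall>x. has_partial j (partial i f) x) \<and> continuous_on UNIV (partial j (partial i f)))"

section \<open>The diffusion\<close>

text \<open>A Markov process is given by a family \<^term>\<open>P x\<close> of laws (\<^term>\<open>x\<close> the starting point) on one
  measurable space \<^term>\<open>M\<close> carrying the process \<^term>\<open>Y\<close>; only times \<open>t \<ge> 0\<close> matter.\<close>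

definition natural_filtration :: "'w measure \<Rightarrow> (real \<Rightarrow> 'w \<Rightarrow> 'a::topological_space) \<Rightarrow> real \<Rightarrow> 'w measure" where
  "natural_filtration M Y s =
    sigma (space M) {Y u -` A \<inter> space M | u A. 0 \<le> u \<and> u \<le> s \<and> A \<in> sets borel}"

definition markov_property :: "'w measure \<Rightarrow> (real \<Rightarrow> 'w \<Rightarrow> 'a::topological_space) \<Rightarrow> ('a \<Rightarrow> 'w measure) \<Rightarrow> bool" where
  "markov_property M Y P \<longleftrightarrow>
    (\<forall>x. \<forall>s\<ge>0. \<forall>t\<ge>0. \<forall>A\<in>sets borel. \<forall>B\<in>sets (natural_filtration M Y s).
       emeasure (P x) {\<omega>\<in>B. Y (s + t) \<omega> \<in> A} =
       (\<integral>\<^sup>+\<omega>\<in>B. emeasure (P (Y s \<omega>)) {\<omega>'\<in>space M. Y t \<omega>' \<in> A} \<partial>P x))"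

text \<open>\<open>L\<close> is the generator in the sense \<open>T\<^sub>t f - f = \<integral>\<^sub>0\<^sup>t T\<^sub>s (L f) ds\<close> for \<open>f\<close> of class \<open>C\<^sup>2\<close> with
  compact support, \<open>T\<close> being the semigroup of \<^term>\<open>Y\<close>. Given the Markov property this says that
  each \<^term>\<open>P x\<close> solves the martingale problem for \<open>L\<close>.\<close>

definition has_generator ::
  "(real \<Rightarrow> 'w \<Rightarrow> real^'d::finite) \<Rightarrow> (real^'d \<Rightarrow> 'w measure) \<Rightarrow>
   ((real^'d \<Rightarrow> real) \<Rightarrow> real^'d \<Rightarrow> real) \<Rightarrow> bool" where
  "has_generator Y P L \<longleftrightarrow>
    (\<forall>f x. \<forall>t\<ge>0. C2_compact_support f \<longrightarrow>
       integrable (restrict_space lborel {0..t} \<Otimes>\<^sub>M P x) (\<lambda>(s, \<omega>). L f (Y s \<omega>)) \<and>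
       (\<integral>\<omega>. f (Y t \<omega>) \<partial>P x) = f x + (LINT s:{0..t}|lborel. (\<integral>\<omega>. L f (Y s \<omega>) \<partial>P x)))"

definition diffusion ::
  "(real^'d::finite \<Rightarrow> real^'d^'d) \<Rightarrow> (real^'d \<Rightarrow> real^'d) \<Rightarrow> 'w measure \<Rightarrow>
   (real \<Rightarrow> 'w \<Rightarrow> real^'d) \<Rightarrow> (real^'d \<Rightarrow> 'w measure) \<Rightarrow> bool" where
  "diffusion a b M Y P \<longleftrightarrow>
    P \<in> borel \<rightarrow>\<^sub>M prob_algebra M \<and>
    (\<forall>t\<ge>0. Y t \<in> M \<rightarrow>\<^sub>M borel) \<and>
    (\<forall>\<omega>\<in>space M. continuous_on {0..} (\<lambda>t. Y t \<omega>)) \<and>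
    (\<forall>x. AE \<omega> in P x. Y 0 \<omega> = x) \<and>
    markov_property M Y P \<and>
    has_generator Y P (generator a b)"

section \<open>The absorbed diffusion\<close>

definition hitting_time :: "'a set \<Rightarrow> (real \<Rightarrow> 'a) \<Rightarrow> ereal" where
  "hitting_time S w = Inf {ereal t | t. 0 \<le> t \<and> w t \<in> S}"

definition absorbed ::
  "'a::topological_space set \<Rightarrow> (real \<Rightarrow> 'w \<Rightarrow> 'a) \<Rightarrow> real \<Rightarrow> 'w \<Rightarrow> 'a" where
  "absorbed D Y t \<omega> =
    (let \<tau> = hitting_time (frontier D) (\<lambda>s. Y s \<omega>)
     in if ereal t < \<tau> then Y t \<omega> else Y (real_of_ereal \<tau>) \<omega>)"

definition absorption_time ::
  "'a::topological_space set \<Rightarrow> (real \<Rightarrow> 'w \<Rightarrow> 'a) \<Rightarrow> 'w \<Rightarrow> ereal" where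
  "absorption_time D Y \<omega> = hitting_time (frontier D) (\<lambda>s. absorbed D Y s \<omega>)"

text \<open>\<open>p\<^sub>t(x, dy)\<close>, a measure on \<^term>\<open>closure D\<close>. The restriction discards no mass for
  \<open>x \<in> closure D\<close>: it is there since \<open>Y\<^sub>0 = x\<close> holds only almost surely.\<close>

definition transition ::
  "'a::topological_space set \<Rightarrow> (real \<Rightarrow> 'w \<Rightarrow> 'a) \<Rightarrow> ('a \<Rightarrow> 'w measure) \<Rightarrow> real \<Rightarrow> 'a \<Rightarrow> 'a measure" where
  "transition D Y P t x = restrict_space (distr (P x) borel (absorbed D Y t)) (closure D)"

text \<open>The integral of \<open>f\<close> against \<open>S\<^sub>t\<^sup>* \<nu>\<close> is that of \<open>S\<^sub>t f = (\<lambda>x. \<integral> f(y) p\<^sub>t(x, dy))\<close> against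
  \<open>\<nu>\<close>; see \<open>nn_integral_bind\<close>.\<close>

definition dual_semigroup ::
  "'a::topological_space set \<Rightarrow> (real \<Rightarrow> 'w \<Rightarrow> 'a) \<Rightarrow> ('a \<Rightarrow> 'w measure) \<Rightarrow> real \<Rightarrow> 'a measure \<Rightarrow> 'a measure" where
  "dual_semigroup D Y P t \<nu> = \<nu> \<bind> transition D Y P t"

text \<open>The measure \<open>P\<^sub>x(\<tau> \<le> T, X\<^sub>\<tau> \<in> dy)\<close> on \<^term>\<open>frontier D\<close>; for \<open>T = \<infinity>\<close> it is
  \<open>P\<^sub>x(\<tau> < \<infinity>, X\<^sub>\<tau> \<in> dy)\<close>.\<close>

definition exit_law ::
  "'a::topological_space set \<Rightarrow> (real \<Rightarrow> 'w \<Rightarrow> 'a) \<Rightarrow> ('a \<Rightarrow> 'w measure) \<Rightarrow> ereal \<Rightarrow> 'a \<Rightarrow> 'a measure" where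
  "exit_law D Y P T x =
    distr
      (restrict_space (P x) {\<omega>\<in>space (P x). absorption_time D Y \<omega> \<le> T \<and> absorption_time D Y \<omega> < \<infinity>})
      (restrict_space borel (frontier D))
      (\<lambda>\<omega>. absorbed D Y (real_of_ereal (absorption_time D Y \<omega>)) \<omega>)"

text \<open>\<open>\<lambda>\<^sub>t\<close> with reservoir intensity \<^term>\<open>lam\<close> and a priori measure \<^term>\<open>\<mu>\<close>.\<close>

definition reservoir_intensity ::
  "'a::topological_space set \<Rightarrow> (real \<Rightarrow> 'w \<Rightarrow> 'a) \<Rightarrow> ('a \<Rightarrow> 'w measure) \<Rightarrow> ('a \<Rightarrow> real) \<Rightarrow>
   'a measure \<Rightarrow> real \<Rightarrow> 'a measure" where
  "reservoir_intensity D Y P lam \<mu> t =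
    density \<mu> (\<lambda>x. \<integral>\<^sup>+y. ennreal (lam y) \<partial>exit_law D Y P (ereal t) x)"

definition add_measure :: "'a measure \<Rightarrow> 'a measure \<Rightarrow> 'a measure" where
  "add_measure M N = measure_of (space M) (sets M) (\<lambda>A. emeasure M A + emeasure N A)"

section \<open>Point processes\<close>

text \<open>A finite point configuration \<open>\<Sum> \<delta>\<^bsub>x\<^sub>i\<^esub>\<close> is the multiset of its points.\<close>

definition number :: "'a set \<Rightarrow> 'a multiset \<Rightarrow> nat" where
  "number A \<eta> = size (filter_mset (\<lambda>x. x \<in> A) \<eta>)"

definition conf_space :: "'a measure \<Rightarrow> 'a multiset measure" where
  "conf_space M =
    sigma {\<eta>. set_mset \<eta> \<subseteq> space M}
      {{\<eta>. set_mset \<eta> \<subseteq> space M \<and> number A \<eta> = k} | A k. A \<in> sets M}"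

abbreviation conf_on :: "'a::topological_space set \<Rightarrow> 'a multiset measure" where
  "conf_on D \<equiv> conf_space (restrict_space borel D)"

text \<open>\<^term>\<open>Q\<close> is the law of a Poisson point process with finite intensity measure \<^term>\<open>\<rho>\<close>.\<close>

definition poisson_process :: "'a measure \<Rightarrow> 'a multiset measure \<Rightarrow> bool" where
  "poisson_process \<rho> Q \<longleftrightarrow>
    finite_measure \<rho> \<and> prob_space Q \<and> sets Q = sets (conf_space \<rho>) \<and>
    (\<forall>A\<in>sets \<rho>. \<forall>k. measure Q {\<eta>\<in>space Q. number A \<eta> = k} =
       measure \<rho> A ^ k / fact k * exp (- measure \<rho> A)) \<and>
    (\<forall>(A :: nat \<Rightarrow> 'a set) n. disjoint_family_on A {..<n} \<and> A ` {..<n} \<subseteq> sets \<rho> \<longrightarrow>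
       prob_space.indep_vars Q (\<lambda>_. count_space UNIV) (\<lambda>i. number (A i)) {..<n})"

definition poisson_law :: "'a measure \<Rightarrow> 'a multiset measure" where
  "poisson_law \<rho> = (THE Q. poisson_process \<rho> Q)"

text \<open>Vague topology on finite configurations in \<^term>\<open>D\<close>: the coarsest one making
  \<open>\<eta> \<mapsto> \<integral> f d\<eta>\<close> continuous for each continuous \<open>f\<close> with compact support in \<^term>\<open>D\<close>.\<close>

definition vague_topology :: "'a::topological_space set \<Rightarrow> 'a multiset topology" where
  "vague_topology D =
    topology_generated_by
      {{\<eta>. set_mset \<eta> \<subseteq> D \<and> (\<Sum>x\<in>#\<eta>. f x) \<in> U} | (f :: 'a \<Rightarrow> real) U.
        open U \<and> continuous_on UNIV f \<and> (\<exists>K. compact K \<and> K \<subseteq> D \<and> (\<forall>x. x \<notin> K \<longrightarrow> f x = 0))}"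

text \<open>Convergence in distribution of point processes. The Borel sets of the vague topology are
  those of \<^term>\<open>conf_on D\<close>, so the measurability of \<open>F\<close> is no restriction on the continuous \<open>F\<close>.\<close>

definition weakly_converges ::
  "'a::topological_space set \<Rightarrow> (real \<Rightarrow> 'a multiset measure) \<Rightarrow> 'a multiset measure \<Rightarrow> bool" where
  "weakly_converges D Q Q' \<longleftrightarrow>
    (\<forall>F :: 'a multiset \<Rightarrow> real.
       continuous_map (vague_topology D) euclideanreal F \<and> F \<in> borel_measurable (conf_on D) \<and>
       bounded (F ` {\<eta>. set_mset \<eta> \<subseteq> D}) \<longrightarrow>
       ((\<lambda>t. \<integral>\<eta>. F \<eta> \<partial>Q t) \<longlongrightarrow> (\<integral>\<eta>. F \<eta> \<partial>Q')) at_top)"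

section \<open>The boundary driven diffusion gas\<close>

text \<open>Law of \<open>\<eta>\<^sub>t\<close> started from \<open>\<eta>\<close>. The product space carries independent copies \<open>X(i)\<close> of the
  absorbed diffusion started from the points \<open>x\<^sub>i\<close> of \<open>\<eta>\<close>, and an independent Poisson process
  \<open>\<theta>\<close>. The law does not depend on the enumeration chosen.\<close>

definition gas_kernel ::
  "'a::topological_space set \<Rightarrow> (real \<Rightarrow> 'w \<Rightarrow> 'a) \<Rightarrow> ('a \<Rightarrow> 'w measure) \<Rightarrow> ('a \<Rightarrow> real) \<Rightarrow>
   'a measure \<Rightarrow> real \<Rightarrow> 'a multiset \<Rightarrow> 'a multiset measure" where
  "gas_kernel D Y P lam \<mu> t \<eta> =
    (let xs = (SOME xs. mset xs = \<eta>); N = length xs in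
     distr ((\<Pi>\<^sub>M i\<in>{..<N}. P (xs ! i)) \<Otimes>\<^sub>M poisson_law (reservoir_intensity D Y P lam \<mu> t))
       (conf_on D)
       (\<lambda>(\<omega>, \<theta>).
          filter_mset (\<lambda>x. x \<in> D) (image_mset (\<lambda>i. absorbed D Y t (\<omega> i)) (mset_set {..<N})) + \<theta>))"

definition configuration_law :: "'a::topological_space set \<Rightarrow> 'a multiset measure \<Rightarrow> bool" where
  "configuration_law D \<nu> \<longleftrightarrow> prob_space \<nu> \<and> sets \<nu> = sets (conf_on D)"

definition gas_law ::
  "'a::topological_space set \<Rightarrow> (real \<Rightarrow> 'w \<Rightarrow> 'a) \<Rightarrow> ('a \<Rightarrow> 'w measure) \<Rightarrow> ('a \<Rightarrow> real) \<Rightarrow>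
   'a measure \<Rightarrow> 'a multiset measure \<Rightarrow> real \<Rightarrow> 'a multiset measure" where
  "gas_law D Y P lam \<mu> \<nu> t = \<nu> \<bind> gas_kernel D Y P lam \<mu> t"

definition stationary ::
  "'a::topological_space set \<Rightarrow> (real \<Rightarrow> 'w \<Rightarrow> 'a) \<Rightarrow> ('a \<Rightarrow> 'w measure) \<Rightarrow> ('a \<Rightarrow> real) \<Rightarrow>
   'a measure \<Rightarrow> 'a multiset measure \<Rightarrow> bool" where
  "stationary D Y P lam \<mu> \<nu> \<longleftrightarrow>
    configuration_law D \<nu> \<and> (\<forall>t\<ge>0. gas_law D Y P lam \<mu> \<nu> t = \<nu>)"

text \<open>\<open>p\<^sub>t(x, dy) m(dx) = p\<^sub>t(y, dx) m(dy)\<close> on \<open>D \<times> D\<close>, evaluated on measurable rectangles.\<close>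

definition reversible ::
  "'a::topological_space set \<Rightarrow> (real \<Rightarrow> 'w \<Rightarrow> 'a) \<Rightarrow> ('a \<Rightarrow> 'w measure) \<Rightarrow> 'a measure \<Rightarrow> bool" where
  "reversible D Y P m \<longleftrightarrow>
    (\<forall>t\<ge>0. \<forall>A\<in>sets (restrict_space borel D). \<forall>B\<in>sets (restrict_space borel D).
       (\<integral>\<^sup>+x\<in>A. emeasure (transition D Y P t x) B \<partial>m) =
       (\<integral>\<^sup>+y\<in>B. emeasure (transition D Y P t y) A \<partial>m))"

end

theory Submission
  imports Defs
begin

text \<open>A law on finite configurations is determined by its generating functional
  \<open>g \<mapsto> E \<Prod>\<^bsub>x \<in> \<eta>\<^esub> g(x)\<close>, which is \<open>exp (- \<integral> (1 - g) d\<rho>)\<close> for the Poisson process of intensity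
  \<open>\<rho>\<close>. Independent absorbed motion replaces \<open>g\<close> (extended by \<open>1\<close> outside \<open>D\<close>) by \<open>S\<^sub>t g\<close>, and adding
  the reservoir particles multiplies by \<open>exp (- \<integral> (1 - g) d\<lambda>\<^sub>t)\<close>; this gives (i). With \<open>\<mu> = m\<close>
  reversible and \<open>h\<close> the mean exit value, reversibility moves \<open>S\<^sub>t\<close> from \<open>1 - g\<close> to \<open>h\<close>, and the Markov
  property splits \<open>h\<close> into the parts exiting before and after \<open>t\<close>, so \<open>h m\<close> is preserved.
  Finally, for every initial law, the law at time \<open>t\<close> dominates that of the reservoir particles times
  the probability that all initial particles are absorbed. This probability tends to \<open>1\<close>, so any
  two initial laws, in particular an arbitrary one and the invariant one, merge in total variation.\<close>

section \<open>Configurations and their generating functionals\<close>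

text \<open>Three definitions shape the work. \<open>poisson_law\<close> is a definite description
  through counts on disjoint sets and their independence, so existence, uniqueness and the passage
  between counts and generating functionals all have to be established. Test functions are kept in
  [0,1], a range that is preserved by products, by the semigroup and by multiplication with z \<in>
  (0,1), and in which every statistic is integrable. \<open>gas_kernel\<close> picks an enumeration
  of the configuration, and \<open>gas_law\<close> mixes it over the initial law, which is
  meaningful only for a measurable kernel; the generating functional does not see the enumeration
  and settles this. \<open>markov_property\<close> speaks of a single future time, whereas the exit
  point depends on the whole future path, so the property is carried to cylinders and then to
  functionals of continuous paths. Merging in total variation, rather than weak convergence alone,
  is aimed at because it also gives uniqueness: it compares a stationary law with the limit on every
  measurable set.\<close>

lemma space_conf_space [simp]: "space (conf_space M) = {\<eta>. set_mset \<eta> \<subseteq> space M}"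
  by (simp add: conf_space_def space_measure_of_conv)

lemma sets_conf_space:
  "sets (conf_space M) = sigma_sets {\<eta>. set_mset \<eta> \<subseteq> space M}
      {{\<eta>. set_mset \<eta> \<subseteq> space M \<and> number A \<eta> = k} | A k. A \<in> sets M}"
  unfolding conf_space_def by (rule sets_measure_of) auto

lemma conf_space_cong: "sets M = sets N \<Longrightarrow> conf_space M = conf_space N"
  unfolding conf_space_def using sets_eq_imp_space_eq[of M N] by simp

lemma number_empty [simp]: "number A {#} = 0"
  and number_add_mset: "number A (add_mset x \<eta>) = (if x \<in> A then 1 else 0) + number A \<eta>"
  and number_plus: "number A (\<eta> + \<theta>) = number A \<eta> + number A \<theta>"
  by (simp_all add: number_def)

lemma number_filter: "number A (filter_mset (\<lambda>x. x \<in> B) \<eta>) = number (A \<inter> B) \<eta>"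
  by (simp add: number_def filter_filter_mset conj_commute)

lemma number_image_mset_set:
  "finite I \<Longrightarrow> number A (image_mset f (mset_set I)) = (\<Sum>i\<in>I. if f i \<in> A then 1 else 0)"
  by (induction I rule: finite_induct) (auto simp: number_add_mset)

lemma measurable_number [measurable (raw)]:
  assumes "A \<in> sets M"
  shows "number A \<in> conf_space M \<rightarrow>\<^sub>M count_space UNIV"
proof (rule measurable_count_space_eq2_countable[THEN iffD2], safe)
  fix k
  have "number A -` {k} \<inter> space (conf_space M) = {\<eta>. set_mset \<eta> \<subseteq> space M \<and> number A \<eta> = k}"
    by auto
  then show "number A -` {k} \<inter> space (conf_space M) \<in> sets (conf_space M)"
    using assms unfolding sets_conf_space by (intro sigma_sets.Basic) auto
qed auto

lemma measurable_conf_spaceI: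
  assumes "\<And>\<omega>. \<omega> \<in> space N \<Longrightarrow> set_mset (f \<omega>) \<subseteq> space M"
    and number: "\<And>A. A \<in> sets M \<Longrightarrow> (\<lambda>\<omega>. number A (f \<omega>)) \<in> N \<rightarrow>\<^sub>M count_space UNIV"
  shows "f \<in> N \<rightarrow>\<^sub>M conf_space M"
  unfolding conf_space_def
proof (rule measurable_measure_of)
  fix E assume "E \<in> {{\<eta>. set_mset \<eta> \<subseteq> space M \<and> number A \<eta> = k} | A k. A \<in> sets M}"
  then obtain A k where A: "A \<in> sets M"
    and E: "E = {\<eta>. set_mset \<eta> \<subseteq> space M \<and> number A \<eta> = k}" by auto
  have "f -` E \<inter> space N = (\<lambda>\<omega>. number A (f \<omega>)) -` {k} \<inter> space N"
    using assms(1) unfolding E by auto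
  also have "\<dots> \<in> sets N"
    using number[OF A] by (rule measurable_sets) simp
  finally show "f -` E \<inter> space N \<in> sets N" .
qed (use assms(1) in auto)

section \<open>Multiplicative statistics of configurations\<close>

definition point_prod :: "('a \<Rightarrow> real) \<Rightarrow> 'a multiset \<Rightarrow> real" where
  "point_prod g \<eta> = (\<Prod>x\<in>#\<eta>. g x)"

lemma point_prod_simps [simp]:
  "point_prod g {#} = 1"
  "point_prod g (add_mset x \<eta>) = g x * point_prod g \<eta>"
  "point_prod g (\<eta> + \<theta>) = point_prod g \<eta> * point_prod g \<theta>"
  by (simp_all add: point_prod_def)

lemma point_prod_bounds:
  assumes "\<And>x. x \<in># \<eta> \<Longrightarrow> g x \<in> {0..1}"
  shows "point_prod g \<eta> \<in> {0..1}"
  using assms by (induction \<eta>) (auto simp: mult_le_one)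

lemma point_prod_cong: "(\<And>x. x \<in># \<eta> \<Longrightarrow> f x = g x) \<Longrightarrow> point_prod f \<eta> = point_prod g \<eta>"
  unfolding point_prod_def by (intro arg_cong[where f=prod_mset] image_mset_cong)

lemma point_prod_filter:
  "point_prod g (filter_mset (\<lambda>x. x \<in> A) \<eta>) = point_prod (\<lambda>x. if x \<in> A then g x else 1) \<eta>"
  by (induction \<eta>) auto

lemma point_prod_image_mset_set:
  "finite I \<Longrightarrow> point_prod g (image_mset f (mset_set I)) = (\<Prod>i\<in>I. g (f i))"
  by (induction I rule: finite_induct) auto

lemma point_prod_mset_nth: "(\<Prod>i<length xs. f (xs ! i)) = point_prod f (mset xs)"
proof -
  have "image_mset (\<lambda>i. xs ! i) (mset_set {..<length xs}) = mset xs"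
    by (metis atLeast0LessThan map_nth mset_map mset_upt)
  then show ?thesis
    using point_prod_image_mset_set[of "{..<length xs}" f "\<lambda>i. xs ! i"] by simp
qed

text \<open>The factor \<open>z\<close> attached to the points in \<open>A\<close> is a marker
  variable for the count in \<open>A\<close>. Counts are recovered from multiplicative statistics
  through it: by a limit at 0 in the monotone class argument, by comparing coefficients for Poisson
  laws.\<close>

lemma point_prod_mult_power:
  "point_prod (\<lambda>x. g x * (if x \<in> A then z else 1)) \<eta> = z ^ number A \<eta> * point_prod g \<eta>"
  by (induction \<eta>) (auto simp: number_add_mset)

text \<open>Grouping the points by the value of \<open>g\<close> leaves finitely many counts on
  disjoint level sets. This yields measurability here and brings in independence in the Poisson
  case.\<close>

lemma point_prod_simple_function:
  assumes g: "simple_function M g" and \<eta>: "set_mset \<eta> \<subseteq> space M"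
  shows "point_prod g \<eta> = (\<Prod>v\<in>g ` space M. v ^ number (g -` {v} \<inter> space M) \<eta>)"
  using \<eta>
proof (induction \<eta>)
  case (add x \<eta>)
  have fin: "finite (g ` space M)" using g by (simp add: simple_function_def)
  have "(\<Prod>v\<in>g ` space M. v ^ number (g -` {v} \<inter> space M) (add_mset x \<eta>)) =
      (\<Prod>v\<in>g ` space M. (if v = g x then v else 1) * v ^ number (g -` {v} \<inter> space M) \<eta>)"
    using add.prems by (intro prod.cong) (auto simp: number_add_mset)
  also have "\<dots> = g x * (\<Prod>v\<in>g ` space M. v ^ number (g -` {v} \<inter> space M) \<eta>)"
    using fin add.prems by (auto simp: prod.distrib prod.delta)
  finally show ?case using add by simp
qed (simp add: prod.neutral)

lemma tendsto_point_prod: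
  "(\<And>x. x \<in># \<eta> \<Longrightarrow> ((\<lambda>t. g t x) \<longlongrightarrow> f x) F) \<Longrightarrow> ((\<lambda>t. point_prod (g t) \<eta>) \<longlongrightarrow> point_prod f \<eta>) F"
  by (induction \<eta>) (auto intro!: tendsto_mult)

text \<open>Rounding down to the grid of mesh 1 / (n + 1). It serves for values of test functions,
  for rational times before a hitting time and for random times. Rounding down, not up, keeps values
  at most 1 and times at most the given one.\<close>

lemma floor_grid:
  fixes x :: real
  assumes "0 \<le> x"
  shows floor_grid_nonneg: "0 \<le> real_of_int \<lfloor>real (Suc n) * x\<rfloor> / real (Suc n)"
    and floor_grid_le: "real_of_int \<lfloor>real (Suc n) * x\<rfloor> / real (Suc n) \<le> x"
    and floor_grid_tendsto: "(\<lambda>n. real_of_int \<lfloor>real (Suc n) * x\<rfloor> / real (Suc n)) \<longlonglongrightarrow> x"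
proof -
  let ?s = "\<lambda>n. real_of_int \<lfloor>real (Suc n) * x\<rfloor> / real (Suc n)"
  show "0 \<le> ?s n" using assms by simp
  have le: "?s n \<le> x" for n by (simp add: divide_le_eq mult.commute)
  then show "?s n \<le> x" .
  have ge: "x - 1 / real (Suc n) \<le> ?s n" for n
  proof -
    have "(real (Suc n) * x - 1) / real (Suc n) \<le> ?s n"
      by (intro divide_right_mono) linarith+
    then show ?thesis by (simp add: diff_divide_distrib)
  qed
  show "?s \<longlonglongrightarrow> x"
  proof (rule real_tendsto_sandwich)
    show "(\<lambda>n. x - 1 / real (Suc n)) \<longlonglongrightarrow> x"
      using tendsto_diff[OF tendsto_const LIMSEQ_inverse_real_of_nat, of x]
      by (simp add: inverse_eq_divide)
    show "eventually (\<lambda>n. x - 1 / real (Suc n) \<le> ?s n) sequentially" using ge by simp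
    show "eventually (\<lambda>n. ?s n \<le> x) sequentially" using le by simp
  qed simp
qed

lemma unit_simple_approx:
  fixes g :: "'a \<Rightarrow> real"
  assumes "g \<in> borel_measurable M" and g: "\<And>x. g x \<in> {0..1}"
  obtains s where "\<And>n. simple_function M (s n)" "\<And>n x. s n x \<in> {0..1}"
    "\<And>x. (\<lambda>n. s n x) \<longlonglongrightarrow> g x"
proof
  define s where "s n x = real_of_int \<lfloor>real (Suc n) * g x\<rfloor> / real (Suc n)" for n x
  show unit: "s n x \<in> {0..1}" for n x
    using g[of x] floor_grid_nonneg[of "g x" n] order_trans[OF floor_grid_le[of "g x" n]]
    unfolding s_def atLeastAtMost_iff by blast
  show "simple_function M (s n)" for n
  proof (rule simple_function_borel_measurable)
    show "s n \<in> borel_measurable M" using assms(1) unfolding s_def by measurable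
    have "s n ` space M \<subseteq> (\<lambda>i. real_of_int i / real (Suc n)) ` {0..int (Suc n)}"
    proof
      fix y assume "y \<in> s n ` space M"
      then obtain x where y: "y = s n x" by auto
      have "\<lfloor>real (Suc n) * g x\<rfloor> \<in> {0..int (Suc n)}"
        using g[of x] by (auto simp: floor_le_iff intro: mult_left_le order_le_less_trans[where y="real (Suc n)"])
      then show "y \<in> (\<lambda>i. real_of_int i / real (Suc n)) ` {0..int (Suc n)}"
        unfolding y s_def by blast
    qed
    then show "finite (s n ` space M)" by (rule finite_subset) simp
  qed
  show "(\<lambda>n. s n x) \<longlonglongrightarrow> g x" for x
    unfolding s_def using g[of x] by (intro floor_grid_tendsto) simp
qed

lemma measurable_point_prod_simple:
  assumes g: "simple_function M g"
  shows "point_prod g \<in> borel_measurable (conf_space M)"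
proof -
  have [measurable]: "number (g -` {v} \<inter> space M) \<in> conf_space M \<rightarrow>\<^sub>M count_space UNIV" for v
    using g by (intro measurable_number simple_functionD(2))
  have "(\<lambda>\<eta>. \<Prod>v\<in>g ` space M. v ^ number (g -` {v} \<inter> space M) \<eta>) \<in> borel_measurable (conf_space M)"
    by measurable
  then show ?thesis
    by (rule measurable_cong[THEN iffD1, rotated]) (use g in \<open>auto simp: point_prod_simple_function\<close>)
qed

lemma measurable_point_prod:
  assumes "g \<in> borel_measurable M" and "\<And>x. g x \<in> {0..1}"
  shows "point_prod g \<in> borel_measurable (conf_space M)"
proof -
  obtain s where s: "\<And>n. simple_function M (s n)" "\<And>x. (\<lambda>n. s n x) \<longlonglongrightarrow> g x"
    using unit_simple_approx[OF assms] by metis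
  show ?thesis
  proof (rule borel_measurable_LIMSEQ_metric)
    show "point_prod (s n) \<in> borel_measurable (conf_space M)" for n
      by (rule measurable_point_prod_simple[OF s(1)])
    show "(\<lambda>n. point_prod (s n) \<eta>) \<longlonglongrightarrow> point_prod g \<eta>" for \<eta>
      by (intro tendsto_point_prod s)
  qed
qed

section \<open>Monotone class arguments for laws of configurations\<close>

text \<open>A functional form of the monotone class theorem: the multiplicative statistics
  \<^term>\<open>point_prod g\<close> are stable under products, and the indicator of \<open>number A = k\<close> is recovered
  from \<open>z ^ number A\<close> as \<open>z \<rightarrow> 0\<close>, once the terms of order less than \<open>k\<close> are subtracted.\<close>

lemma conf_space_multiplicative_class:
  fixes V :: "('a multiset \<Rightarrow> real) \<Rightarrow> bool"
  assumes prod: "\<And>g. simple_function M g \<Longrightarrow> (\<And>x. g x \<in> {0..1}) \<Longrightarrow> V (point_prod g)"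
    and diff: "\<And>F G. V F \<Longrightarrow> V G \<Longrightarrow> V (\<lambda>\<eta>. F \<eta> - G \<eta>)"
    and scale: "\<And>F c. V F \<Longrightarrow> V (\<lambda>\<eta>. c * F \<eta>)"
    and lim: "\<And>F G. (\<And>n. V (F n)) \<Longrightarrow>
      (\<And>n \<eta>. set_mset \<eta> \<subseteq> space M \<Longrightarrow> F n \<eta> \<in> {0..1}) \<Longrightarrow>
      (\<And>\<eta>. set_mset \<eta> \<subseteq> space M \<Longrightarrow> (\<lambda>n. F n \<eta>) \<longlonglongrightarrow> G \<eta>) \<Longrightarrow> V G"
    and E: "E \<in> sets (conf_space M)"
  shows "V (indicator E)"
proof -
  let ?\<Omega> = "{\<eta>. set_mset \<eta> \<subseteq> space M}"
  have one: "V (\<lambda>_. 1)"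
    using prod[of "\<lambda>_. 1"] by (simp add: point_prod_def[abs_def])
  have zero: "V (\<lambda>_. 0)" using scale[OF one, of 0] by simp
  have add: "V (\<lambda>\<eta>. F \<eta> + G \<eta>)" if "V F" "V G" for F G
    using diff[OF that(1) scale[OF that(2), of "-1"]] by simp
  have sum: "V (\<lambda>\<eta>. \<Sum>j<n. F j \<eta>)" if "\<And>j. j < n \<Longrightarrow> V (F j)" for n :: nat and F
    using that by (induction n) (auto intro: zero add)
  \<comment> \<open>A constant sequence in \<open>lim\<close>: membership in \<open>V\<close>
    depends only on the values on configurations in the space, for functions with values in
    [0,1].\<close>
  have cong: "V G" if "V F" "\<And>\<eta>. set_mset \<eta> \<subseteq> space M \<Longrightarrow> F \<eta> = G \<eta>"
    "\<And>\<eta>. set_mset \<eta> \<subseteq> space M \<Longrightarrow> F \<eta> \<in> {0..1}" for F G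
    by (rule lim[of "\<lambda>_. F" G]) (use that in auto)
  \<comment> \<open>Finitely many count conditions are handled together with a free factor
    \<open>point_prod g\<close>: removing one condition tilts \<open>g\<close>, so the induction
    over the list must hold for every \<open>g\<close>.\<close>
  define H :: "('a set \<times> nat) list \<Rightarrow> 'a multiset \<Rightarrow> real"
    where "H l \<eta> = of_bool (\<forall>(A, k)\<in>set l. number A \<eta> = k)" for l \<eta>
  have cyl: "V (\<lambda>\<eta>. H l \<eta> * point_prod g \<eta>)"
    if "simple_function M g" "\<And>x. g x \<in> {0..1}" "\<forall>(A, k)\<in>set l. A \<in> sets M" for l g
    using that
  proof (induction l arbitrary: g)
    case Nil
    then show ?case using prod[of g] by (simp add: H_def)
  next
    case (Cons p l)
    obtain A k0 where p: "p = (A, k0)" by force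
    have A: "A \<in> sets M" and l: "\<forall>(A, k)\<in>set l. A \<in> sets M" using Cons.prems p by auto
    let ?G = "\<lambda>\<eta>. H l \<eta> * point_prod g \<eta>"
    have G01: "?G \<eta> \<in> {0..1}" for \<eta>
      using point_prod_bounds[of \<eta> g] Cons.prems(2) by (auto simp: H_def)
    have "V (\<lambda>\<eta>. of_bool (number A \<eta> = k) * ?G \<eta>)" for k
    proof (induction k rule: less_induct)
      case (less k)
      define z where "z n = inverse (real (Suc n))" for n
      have z: "0 < z n" "z n \<le> 1" for n by (auto simp: z_def field_simps)
      \<comment> \<open>The statistic tilted by \<open>z n\<close>, less the contributions of counts
        below \<open>k\<close>, rescaled so that the count \<open>k\<close> gets weight 1. The
        subtracted terms belong to \<open>V\<close> by the induction on \<open>k\<close>.\<close>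
      define F where "F n \<eta> = inverse (z n) ^ k * (H l \<eta> * point_prod (\<lambda>x. g x * (if x \<in> A then z n else 1)) \<eta> -
          (\<Sum>j<k. z n ^ j * (of_bool (number A \<eta> = j) * ?G \<eta>)))" for n \<eta>
      \<comment> \<open>In this form \<open>F n\<close> visibly lies in [0,1], as \<open>lim\<close>
        demands. Its limit involves \<open>0 ^ (number A \<eta> - k)\<close>, which is 1 when the
        difference is 0; the truncated subtraction is guarded by the factor for
        \<open>k \<le> number A \<eta>\<close>.\<close>
      have F: "F n \<eta> = of_bool (k \<le> number A \<eta>) * z n ^ (number A \<eta> - k) * ?G \<eta>" for n \<eta>
      proof -
        have "(\<Sum>j<k. z n ^ j * (of_bool (number A \<eta> = j) * ?G \<eta>)) =
            (\<Sum>j<k. if j = number A \<eta> then z n ^ number A \<eta> * ?G \<eta> else 0)"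
          by (intro sum.cong) auto
        also have "\<dots> = of_bool (number A \<eta> < k) * (z n ^ number A \<eta> * ?G \<eta>)"
          by (simp add: sum.delta)
        finally have F_eq: "F n \<eta> = inverse (z n) ^ k *
            (of_bool (k \<le> number A \<eta>) * z n ^ number A \<eta> * ?G \<eta>)"
          by (cases "k \<le> number A \<eta>") (simp_all add: F_def point_prod_mult_power mult.left_commute)
        show ?thesis
        proof (cases "k \<le> number A \<eta>")
          case True
          then have "z n ^ number A \<eta> = z n ^ k * z n ^ (number A \<eta> - k)"
            by (simp flip: power_add)
          moreover have "inverse (z n) ^ k * z n ^ k = 1"
            using z(1)[of n] by (simp flip: power_mult_distrib)
          ultimately have "inverse (z n) ^ k * z n ^ number A \<eta> = z n ^ (number A \<eta> - k)"
            by (metis mult.assoc mult_1_left)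
          moreover have "F n \<eta> = inverse (z n) ^ k * z n ^ number A \<eta> * ?G \<eta>"
            unfolding F_eq using True by (simp only: mult.assoc of_bool_eq(2) mult_1_left)
          ultimately have "F n \<eta> = z n ^ (number A \<eta> - k) * ?G \<eta>" by (simp only:)
          with True show ?thesis by (simp only: of_bool_eq(2) mult_1_left)
        qed (simp add: F_eq)
      qed
      have "V (F n)" for n
        unfolding F_def
      proof (intro scale diff sum)
        have "simple_function M (\<lambda>x. if x \<in> A then z n else 1)"
          using A sets.sets_into_space[OF A] by (intro simple_function_If_set) (auto simp: Int_absorb2)
        then show "V (\<lambda>\<eta>. H l \<eta> * point_prod (\<lambda>x. g x * (if x \<in> A then z n else 1)) \<eta>)"
          using Cons.prems(1,2) z[of n] l
          by (intro Cons.IH simple_function_mult) (auto simp: mult_le_one less_imp_le)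
        show "V (\<lambda>\<eta>. of_bool (number A \<eta> = j) * ?G \<eta>)" if "j < k" for j
          using less.IH[OF that] .
      qed
      moreover have "F n \<eta> \<in> {0..1}" for n \<eta>
        using G01[of \<eta>] z[of n] unfolding F
        by (auto intro!: mult_le_one power_le_one simp: less_imp_le simp del: mult_eq_0_iff)
      moreover have "(\<lambda>n. F n \<eta>) \<longlonglongrightarrow> of_bool (number A \<eta> = k) * ?G \<eta>" for \<eta>
      proof -
        have "z \<longlonglongrightarrow> 0" unfolding z_def by (rule LIMSEQ_inverse_real_of_nat)
        then have "(\<lambda>n. z n ^ (number A \<eta> - k)) \<longlonglongrightarrow> 0 ^ (number A \<eta> - k)" by (rule tendsto_power)
        then have "(\<lambda>n. F n \<eta>) \<longlonglongrightarrow> of_bool (k \<le> number A \<eta>) * 0 ^ (number A \<eta> - k) * ?G \<eta>"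
          unfolding F by (intro tendsto_mult tendsto_const)
        also have "of_bool (k \<le> number A \<eta>) * 0 ^ (number A \<eta> - k) * ?G \<eta> = of_bool (number A \<eta> = k) * ?G \<eta>"
          by (auto simp: power_0_left)
        finally show ?thesis .
      qed
      ultimately show ?case by (rule lim)
    qed
    from this[of k0] show ?case
      by (rule cong) (use G01 in \<open>auto simp: H_def p\<close>)
  qed
  \<comment> \<open>Conditions are collected in lists, so that an intersection is a
    concatenation.\<close>
  define cyls where "cyls = {{\<eta>. set_mset \<eta> \<subseteq> space M \<and> (\<forall>(A, k)\<in>set l. number A \<eta> = k)} | l.
      \<forall>(A, k)\<in>set l. A \<in> sets M}"
  have stable: "Int_stable cyls"
  proof (rule Int_stableI)
    fix a b assume "a \<in> cyls" "b \<in> cyls"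
    then obtain l l' where l: "\<forall>(A, k)\<in>set l. A \<in> sets M" "\<forall>(A, k)\<in>set l'. A \<in> sets M"
      and a: "a = {\<eta>. set_mset \<eta> \<subseteq> space M \<and> (\<forall>(A, k)\<in>set l. number A \<eta> = k)}"
      and b: "b = {\<eta>. set_mset \<eta> \<subseteq> space M \<and> (\<forall>(A, k)\<in>set l'. number A \<eta> = k)}"
      unfolding cyls_def by auto
    have "a \<inter> b = {\<eta>. set_mset \<eta> \<subseteq> space M \<and> (\<forall>(A, k)\<in>set (l @ l'). number A \<eta> = k)}"
      unfolding a b set_append ball_Un by auto
    then show "a \<inter> b \<in> cyls"
      unfolding cyls_def using l by (intro CollectI exI[of _ "l @ l'"]) auto
  qed
  have "{\<eta>. set_mset \<eta> \<subseteq> space M \<and> number A \<eta> = k} \<in> cyls" if "A \<in> sets M" for A k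
    unfolding cyls_def using that by (intro CollectI exI[of _ "[(A, k)]"]) auto
  then have "sets (conf_space M) \<subseteq> sigma_sets ?\<Omega> cyls"
    unfolding sets_conf_space by (intro sigma_sets_mono) (auto intro!: sigma_sets.Basic)
  then have "E \<in> sigma_sets ?\<Omega> cyls" using E by auto
  have "cyls \<subseteq> Pow ?\<Omega>" by (auto simp: cyls_def)
  from stable this \<open>E \<in> sigma_sets ?\<Omega> cyls\<close> show ?thesis
  proof (induction rule: sigma_sets_induct_disjoint)
    fix C assume "C \<in> cyls"
    then obtain l where l: "\<forall>(A, k)\<in>set l. A \<in> sets M"
      and C: "C = {\<eta>. set_mset \<eta> \<subseteq> space M \<and> (\<forall>(A, k)\<in>set l. number A \<eta> = k)}"
      by (auto simp: cyls_def)
    from cyl[of "\<lambda>_. 1", OF _ _ l] show "V (indicator C)"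
      by (rule cong) (auto simp: H_def C point_prod_def indicator_def)
  next
    show "V (indicator {})" using zero by (simp add: indicator_def[abs_def])
  next
    fix C assume "V (indicator C)"
    from diff[OF one this] show "V (indicator (?\<Omega> - C))"
      by (rule cong) (auto simp: indicator_def)
  next
    fix C :: "nat \<Rightarrow> 'a multiset set"
    assume disj: "disjoint_family C" and V: "\<And>i. V (indicator (C i))"
    \<comment> \<open>Disjointness makes the partial sums indicators, hence keeps them in the range
      required by \<open>lim\<close>.\<close>
    have eq: "(\<Sum>i<n. indicator (C i) \<eta> :: real) = indicator (\<Union>i<n. C i) \<eta>" for n \<eta>
      using disj by (intro indicator_UN_disjoint[symmetric]) (auto simp: disjoint_family_on_def)
    show "V (indicator (\<Union>i. C i))"
    proof (rule lim[of "\<lambda>n \<eta>. \<Sum>i<n. indicator (C i) \<eta>"])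
      show "V (\<lambda>\<eta>. \<Sum>i<n. indicator (C i) \<eta>)" for n by (intro sum V)
      show "(\<Sum>i<n. indicator (C i) \<eta> :: real) \<in> {0..1}" for n \<eta>
        unfolding eq by (auto simp: indicator_def)
      show "(\<lambda>n. \<Sum>i<n. indicator (C i) \<eta> :: real) \<longlonglongrightarrow> indicator (\<Union>i. C i) \<eta>" for \<eta>
        unfolding eq by (rule LIMSEQ_indicator_UN)
    qed
  qed
qed

text \<open>The monotone class argument for a family of laws at once, \<open>R\<close> being a
  property of functions of the parameter. With two parameter values and \<open>R\<close> equality it
  identifies laws; with \<open>R\<close> measurability it shows that a kernel is measurable.\<close>

lemma conf_space_integral_class:
  fixes K :: "'b \<Rightarrow> 'a multiset measure" and R :: "('b \<Rightarrow> real) \<Rightarrow> bool"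
  assumes K: "\<And>x. x \<in> S \<Longrightarrow> prob_space (K x)" "\<And>x. x \<in> S \<Longrightarrow> sets (K x) = sets (conf_space M)"
    and prod: "\<And>g. simple_function M g \<Longrightarrow> (\<And>x. g x \<in> {0..1}) \<Longrightarrow> R (\<lambda>x. \<integral>\<eta>. point_prod g \<eta> \<partial>K x)"
    and diff: "\<And>f g. R f \<Longrightarrow> R g \<Longrightarrow> R (\<lambda>x. f x - g x)"
    and scale: "\<And>f c. R f \<Longrightarrow> R (\<lambda>x. c * f x)"
    and lim: "\<And>f h. (\<And>n. R (f n)) \<Longrightarrow> (\<And>x. x \<in> S \<Longrightarrow> (\<lambda>n. f n x) \<longlonglongrightarrow> h x) \<Longrightarrow> R h"
    and E: "E \<in> sets (conf_space M)"
  shows "R (\<lambda>x. measure (K x) E)"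
proof -
  \<comment> \<open>Measurability and a bound belong to \<open>V\<close> so that integrals are
    linear on it. The bound depends on the function because differences and multiples leave
    [0,1].\<close>
  define V where "V F \<longleftrightarrow> F \<in> borel_measurable (conf_space M) \<and>
      (\<exists>C. \<forall>\<eta>. set_mset \<eta> \<subseteq> space M \<longrightarrow> \<bar>F \<eta>\<bar> \<le> C) \<and> R (\<lambda>x. \<integral>\<eta>. F \<eta> \<partial>K x)" for F
  have sp: "space (K x) = {\<eta>. set_mset \<eta> \<subseteq> space M}" if "x \<in> S" for x
    using sets_eq_imp_space_eq[OF K(2)[OF that]] by simp
  have meas: "F \<in> borel_measurable (K x)" if "F \<in> borel_measurable (conf_space M)" "x \<in> S" for F :: "_ \<Rightarrow> real" and x
    by (simp add: measurable_cong_sets[OF K(2)[OF that(2)] refl] that(1))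
  have int: "integrable (K x) F"
    if "F \<in> borel_measurable (conf_space M)" "\<And>\<eta>. set_mset \<eta> \<subseteq> space M \<Longrightarrow> \<bar>F \<eta>\<bar> \<le> C" "x \<in> S" for F and C :: real and x
  proof -
    interpret prob_space "K x" by (rule K(1)[OF that(3)])
    show ?thesis
    proof (rule integrable_const_bound[of _ C])
      show "AE \<eta> in K x. norm (F \<eta>) \<le> C" using that(2) by (intro AE_I2) (simp add: sp[OF that(3)])
      show "F \<in> borel_measurable (K x)" by (rule meas[OF that(1,3)])
    qed
  qed
  have eq: "R g" if "R f" "\<And>x. x \<in> S \<Longrightarrow> f x = g x" for f g
    using that by (intro lim[of "\<lambda>_. f" g]) auto
  have "V (indicator E)"
  proof (rule conf_space_multiplicative_class[OF _ _ _ _ E])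
    fix g :: "'a \<Rightarrow> real" assume g: "simple_function M g" "\<And>x. g x \<in> {0..1}"
    show "V (point_prod g)"
      unfolding V_def using point_prod_bounds[of _ g] g(2)
      by (intro conjI measurable_point_prod_simple[OF g(1)] prod[OF g] exI[of _ 1]) auto
  next
    fix F G assume "V F" "V G"
    then obtain B C where FG: "F \<in> borel_measurable (conf_space M)" "G \<in> borel_measurable (conf_space M)"
        "\<And>\<eta>. set_mset \<eta> \<subseteq> space M \<Longrightarrow> \<bar>F \<eta>\<bar> \<le> B" "\<And>\<eta>. set_mset \<eta> \<subseteq> space M \<Longrightarrow> \<bar>G \<eta>\<bar> \<le> C"
        "R (\<lambda>x. \<integral>\<eta>. F \<eta> \<partial>K x)" "R (\<lambda>x. \<integral>\<eta>. G \<eta> \<partial>K x)"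
      unfolding V_def by blast
    have "R (\<lambda>x. \<integral>\<eta>. F \<eta> - G \<eta> \<partial>K x)"
      by (rule eq[OF diff[OF FG(5,6)]])
         (use FG in \<open>auto intro!: Bochner_Integration.integral_diff[symmetric] int\<close>)
    moreover have "\<bar>F \<eta> - G \<eta>\<bar> \<le> B + C" if "set_mset \<eta> \<subseteq> space M" for \<eta>
      using FG(3,4)[OF that] by linarith
    ultimately show "V (\<lambda>\<eta>. F \<eta> - G \<eta>)"
      unfolding V_def using FG by (intro conjI borel_measurable_diff exI[of _ "B + C"]) auto
  next
    fix F :: "'a multiset \<Rightarrow> real" and c assume "V F"
    then obtain B where F: "F \<in> borel_measurable (conf_space M)"
        "\<And>\<eta>. set_mset \<eta> \<subseteq> space M \<Longrightarrow> \<bar>F \<eta>\<bar> \<le> B" "R (\<lambda>x. \<integral>\<eta>. F \<eta> \<partial>K x)"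
      unfolding V_def by blast
    then show "V (\<lambda>\<eta>. c * F \<eta>)"
      unfolding V_def using scale[OF F(3), of c]
      by (intro conjI exI[of _ "\<bar>c\<bar> * B"]) (auto simp: abs_mult mult_left_mono)
  next
    fix F :: "nat \<Rightarrow> 'a multiset \<Rightarrow> real" and G
    assume V: "\<And>n. V (F n)" and F01: "\<And>n \<eta>. set_mset \<eta> \<subseteq> space M \<Longrightarrow> F n \<eta> \<in> {0..1}"
      and lim_F: "\<And>\<eta>. set_mset \<eta> \<subseteq> space M \<Longrightarrow> (\<lambda>n. F n \<eta>) \<longlonglongrightarrow> G \<eta>"
    have F: "F n \<in> borel_measurable (conf_space M)" for n using V by (simp add: V_def)
    have G: "G \<in> borel_measurable (conf_space M)"
      using lim_F by (intro borel_measurable_LIMSEQ_metric[OF F]) auto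
    have "\<bar>G \<eta>\<bar> \<le> 1" if "set_mset \<eta> \<subseteq> space M" for \<eta>
      using F01[OF that] by (intro tendsto_upperbound[OF tendsto_rabs[OF lim_F[OF that]]]) auto
    moreover have "R (\<lambda>x. \<integral>\<eta>. G \<eta> \<partial>K x)"
    proof (rule lim[of "\<lambda>n x. \<integral>\<eta>. F n \<eta> \<partial>K x"])
      fix x assume x: "x \<in> S"
      interpret prob_space "K x" by (rule K(1)[OF x])
      show "(\<lambda>n. \<integral>\<eta>. F n \<eta> \<partial>K x) \<longlonglongrightarrow> (\<integral>\<eta>. G \<eta> \<partial>K x)"
        using F01 lim_F meas[OF F x] meas[OF G x] sp[OF x]
        by (intro integral_dominated_convergence[where w="\<lambda>_. 1"]) auto
    qed (use V in \<open>simp add: V_def\<close>)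
    ultimately show "V G" unfolding V_def using G by blast
  qed
  then have "R (\<lambda>x. \<integral>\<eta>. indicator E \<eta> \<partial>K x)" by (simp add: V_def)
  then show ?thesis
    by (rule eq) (use E sp sets.sets_into_space[OF E] in \<open>auto simp: Int_absorb2\<close>)
qed

lemma conf_law_eqI:
  assumes "prob_space Q" "prob_space Q'"
    and sets: "sets Q = sets (conf_space M)" "sets Q' = sets (conf_space M)"
    and prod: "\<And>g. simple_function M g \<Longrightarrow> (\<And>x. g x \<in> {0..1}) \<Longrightarrow>
      (\<integral>\<eta>. point_prod g \<eta> \<partial>Q) = (\<integral>\<eta>. point_prod g \<eta> \<partial>Q')"
  shows "Q = Q'"
proof (rule measure_eqI)
  interpret Q: prob_space Q by fact
  interpret Q': prob_space Q' by fact
  fix E assume "E \<in> sets Q"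
  then have "E \<in> sets (conf_space M)" using sets by simp
  then have "measure (if True then Q else Q') E = measure (if False then Q else Q') E"
  proof (intro conf_space_integral_class[where K="\<lambda>b. if b then Q else Q'" and S=UNIV and M=M
        and R="\<lambda>f. f True = f False"])
    fix f :: "nat \<Rightarrow> bool \<Rightarrow> real" and h
    assume "\<And>n. f n True = f n False" "\<And>b. b \<in> UNIV \<Longrightarrow> (\<lambda>n. f n b) \<longlonglongrightarrow> h b"
    then have "(\<lambda>n. f n False) \<longlonglongrightarrow> h True" "(\<lambda>n. f n False) \<longlonglongrightarrow> h False"
      by (metis UNIV_I ext)+
    then show "h True = h False" by (rule LIMSEQ_unique)
  qed (use assms in auto)
  then show "emeasure Q E = emeasure Q' E"
    by (simp add: Q.emeasure_eq_measure Q'.emeasure_eq_measure)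
qed (use sets in simp)

text \<open>For \<open>gas_kernel\<close> this circumvents the enumeration chosen in its definition:
  as a function of the starting configuration, only its generating functional has to be
  measurable.\<close>

lemma measurable_conf_kernel:
  assumes K: "\<And>x. x \<in> space N \<Longrightarrow> prob_space (K x)"
      "\<And>x. x \<in> space N \<Longrightarrow> sets (K x) = sets (conf_space M)"
    and prod: "\<And>g. simple_function M g \<Longrightarrow> (\<And>x. g x \<in> {0..1}) \<Longrightarrow>
      (\<lambda>x. \<integral>\<eta>. point_prod g \<eta> \<partial>K x) \<in> borel_measurable N"
  shows "K \<in> N \<rightarrow>\<^sub>M prob_algebra (conf_space M)"
proof (intro measurable_prob_algebraI measurable_subprob_algebra)
  fix E assume E: "E \<in> sets (conf_space M)"
  have "(\<lambda>x. measure (K x) E) \<in> borel_measurable N"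
    by (rule conf_space_integral_class[where S="space N", OF K])
       (use prod E in \<open>auto intro: borel_measurable_LIMSEQ_metric\<close>)
  then have "(\<lambda>x. ennreal (measure (K x) E)) \<in> borel_measurable N" by measurable
  then show "(\<lambda>x. emeasure (K x) E) \<in> borel_measurable N"
    by (rule measurable_cong[THEN iffD1, rotated])
       (use K in \<open>auto simp: finite_measure.emeasure_eq_measure prob_space.finite_measure\<close>)
qed (use K prob_space_imp_subprob_space in auto)


section \<open>Poisson processes\<close>

lemma powser_zero_coeff_0:
  fixes c :: "nat \<Rightarrow> real"
  assumes c: "\<And>z. 0 < z \<Longrightarrow> z < 1 \<Longrightarrow> (\<lambda>k. c k * z ^ k) sums 0"
  shows "c 0 = 0"
proof -
  define f where "f x = (\<Sum>k. c k * x ^ k)" for x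
  have "summable (\<lambda>k. c k * (1/2) ^ k)" using c[of "1/2"] sums_summable by auto
  then have "(\<lambda>k. c k * x ^ k) sums f x" if "norm x < 1/2" for x
    unfolding f_def using that by (intro summable_sums powser_inside[of c "1/2" x]) simp_all
  then have "(f \<longlongrightarrow> c 0) (at 0)" by (intro powser_limit_0[of "1/2"]) auto
  then have "(f \<longlongrightarrow> c 0) (at_right 0)" by (rule tendsto_mono[OF at_le, rotated]) auto
  moreover have "(f \<longlongrightarrow> 0) (at_right 0)"
  proof (rule tendsto_eventually)
    have "f z = 0" if "z \<in> {0<..<1}" for z
      using sums_unique[OF c[of z]] that by (simp add: f_def)
    then show "eventually (\<lambda>z. f z = 0) (at_right 0)"
      using eventually_at_right_real[of 0 1] by (simp add: eventually_mono)
  qed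
  ultimately show ?thesis by (intro tendsto_unique) auto
qed

text \<open>Only arguments in (0,1) are available, since a tilted test function has to stay in
  [0,1]. Continuity of the series at 0, used from the right, removes the constant term; division by
  \<open>z\<close> shifts the coefficients.\<close>

lemma powser_zero_coeffs:
  fixes c :: "nat \<Rightarrow> real"
  assumes "\<And>z. 0 < z \<Longrightarrow> z < 1 \<Longrightarrow> (\<lambda>k. c k * z ^ k) sums 0"
  shows "c n = 0"
  using assms
proof (induction n arbitrary: c)
  case 0
  then show ?case by (rule powser_zero_coeff_0)
next
  case (Suc n)
  have c0: "c 0 = 0" using Suc.prems by (rule powser_zero_coeff_0)
  show ?case
  proof (rule Suc.IH[of "\<lambda>k. c (Suc k)"])
    fix z :: real assume z: "0 < z" "z < 1"
    have "(\<lambda>k. c (Suc k) * z ^ Suc k) sums 0"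
      using Suc.prems[OF z] c0 by (subst sums_Suc_iff) simp
    from sums_mult[OF this, of "1/z"] show "(\<lambda>k. c (Suc k) * z ^ k) sums 0"
      using z by simp
  qed
qed

text \<open>The partial sums are integrals over \<open>N < n\<close>, so dominated convergence
  applies. With \<open>f k = z ^ k\<close> the expectation becomes a power series in
  \<open>z\<close> whose coefficients are the restrictions of \<open>F\<close> to
  \<open>N = k\<close>; the weight \<open>F\<close> carries conditions treated before.\<close>

lemma integral_nat_valued_sums:
  fixes F :: "'a \<Rightarrow> real" and f :: "nat \<Rightarrow> real"
  assumes Q: "prob_space Q" and N [measurable]: "N \<in> Q \<rightarrow>\<^sub>M count_space UNIV"
    and F [measurable]: "F \<in> borel_measurable Q" and F01: "\<And>\<eta>. F \<eta> \<in> {0..1}"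
    and f01: "\<And>k. f k \<in> {0..1}"
  shows "(\<lambda>k. f k * (\<integral>\<eta>. of_bool (N \<eta> = k) * F \<eta> \<partial>Q)) sums (\<integral>\<eta>. f (N \<eta>) * F \<eta> \<partial>Q)"
  unfolding sums_def
proof -
  interpret prob_space Q by fact
  have [measurable]: "(\<lambda>\<eta>. f (N \<eta>)) \<in> borel_measurable Q" by (rule measurable_compose[OF N]) simp
  have [measurable]: "(\<lambda>\<eta>. of_bool (N \<eta> = k) :: real) \<in> borel_measurable Q" for k
    by (rule measurable_compose[OF N]) simp
  have [measurable]: "(\<lambda>\<eta>. of_bool (N \<eta> < k) :: real) \<in> borel_measurable Q" for k
    by (rule measurable_compose[OF N]) simp
  have int: "integrable Q (\<lambda>\<eta>. of_bool (N \<eta> = k) * F \<eta>)" for k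
    by (rule integrable_const_bound[of _ 1]) (use F01 in auto)
  have "(\<Sum>k<n. f k * (\<integral>\<eta>. of_bool (N \<eta> = k) * F \<eta> \<partial>Q)) = (\<integral>\<eta>. of_bool (N \<eta> < n) * (f (N \<eta>) * F \<eta>) \<partial>Q)" for n
  proof -
    have "(\<Sum>k<n. f k * (of_bool (N \<eta> = k) * F \<eta>)) = of_bool (N \<eta> < n) * (f (N \<eta>) * F \<eta>)" for \<eta>
    proof -
      have "(\<Sum>k<n. f k * (of_bool (N \<eta> = k) * F \<eta>)) = (\<Sum>k<n. if k = N \<eta> then f (N \<eta>) * F \<eta> else 0)"
        by (intro sum.cong) auto
      then show ?thesis by (simp add: sum.delta)
    qed
    moreover have "(\<Sum>k<n. f k * (\<integral>\<eta>. of_bool (N \<eta> = k) * F \<eta> \<partial>Q)) =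
        (\<integral>\<eta>. (\<Sum>k<n. f k * (of_bool (N \<eta> = k) * F \<eta>)) \<partial>Q)"
      using int by (subst Bochner_Integration.integral_sum) auto
    ultimately show ?thesis by simp
  qed
  moreover have "(\<lambda>n. \<integral>\<eta>. of_bool (N \<eta> < n) * (f (N \<eta>) * F \<eta>) \<partial>Q) \<longlonglongrightarrow> (\<integral>\<eta>. f (N \<eta>) * F \<eta> \<partial>Q)"
  proof (rule integral_dominated_convergence[where w="\<lambda>_. 1"])
    have "eventually (\<lambda>n. of_bool (N \<eta> < n) * (f (N \<eta>) * F \<eta>) = f (N \<eta>) * F \<eta>) sequentially" for \<eta>
      using eventually_gt_at_top[of "N \<eta>"] by eventually_elim simp
    then show "AE \<eta> in Q. (\<lambda>n. of_bool (N \<eta> < n) * (f (N \<eta>) * F \<eta>)) \<longlonglongrightarrow> f (N \<eta>) * F \<eta>"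
      by (auto intro!: tendsto_eventually)
    show "AE \<eta> in Q. norm (of_bool (N \<eta> < n) * (f (N \<eta>) * F \<eta>)) \<le> 1" for n
      using F01 f01 by (auto simp: abs_mult intro!: mult_le_one)
  qed auto
  ultimately show "(\<lambda>n. \<Sum>k<n. f k * (\<integral>\<eta>. of_bool (N \<eta> = k) * F \<eta> \<partial>Q)) \<longlonglongrightarrow> (\<integral>\<eta>. f (N \<eta>) * F \<eta> \<partial>Q)"
    by simp
qed

lemma poisson_series: "(\<lambda>k. z ^ k * (c ^ k / fact k * exp (- c))) sums exp (- (1 - z) * (c :: real))"
proof -
  have "(\<lambda>k. (z * c) ^ k / fact k * exp (- c)) sums (exp (z * c) * exp (- c))"
    using exp_converges[of "z * c"] by (intro sums_mult2) (simp add: divide_inverse mult.commute)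
  then show ?thesis by (simp add: power_mult_distrib algebra_simps flip: exp_add)
qed

section \<open>Counts, independence and the generating functional\<close>

text \<open>Replacing \<open>g\<close> by \<open>z g\<close> on one of the sets and comparing the coefficients of \<open>z ^ k\<close> passes
  from the generating functional to the joint law of counts on disjoint sets.\<close>

lemma poisson_joint_counts:
  assumes \<rho>: "finite_measure \<rho>" and Q: "prob_space Q" "sets Q = sets (conf_space \<rho>)"
    and pgf: "\<And>g. simple_function \<rho> g \<Longrightarrow> (\<And>x. g x \<in> {0..1}) \<Longrightarrow>
      (\<integral>\<eta>. point_prod g \<eta> \<partial>Q) = exp (- (\<integral>x. 1 - g x \<partial>\<rho>))"
    and J: "finite J" "disjoint_family_on A J" "\<And>i. i \<in> J \<Longrightarrow> A i \<in> sets \<rho>"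
    and g: "simple_function \<rho> g" "\<And>x. g x \<in> {0..1}"
  shows "(\<integral>\<eta>. of_bool (\<forall>i\<in>J. number (A i) \<eta> = k i) * point_prod g \<eta> \<partial>Q) =
    (\<Prod>i\<in>J. (\<integral>x. indicator (A i) x * g x \<partial>\<rho>) ^ k i / fact (k i)) *
    exp (- (\<integral>x. 1 - (if x \<in> (\<Union>i\<in>J. A i) then 0 else g x) \<partial>\<rho>))"
  using J g
proof (induction J arbitrary: g rule: finite_induct)
  case empty
  then show ?case using pgf[of g] by simp
next
  case (insert j J)
  interpret \<rho>: finite_measure \<rho> by fact
  have Aj [measurable]: "A j \<in> sets \<rho>" and AJ: "\<And>i. i \<in> J \<Longrightarrow> A i \<in> sets \<rho>" using insert.prems by auto
  have UJ [measurable]: "(\<Union>i\<in>J. A i) \<in> sets \<rho>" using AJ insert.hyps by auto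
  have disj: "disjoint_family_on A J" and Aj_disj: "\<And>i x. i \<in> J \<Longrightarrow> x \<in> A i \<Longrightarrow> x \<notin> A j"
    using insert.prems(1) insert.hyps(2) by (auto simp: disjoint_family_on_def)
  have g [measurable]: "g \<in> borel_measurable \<rho>" using insert.prems(3) by (rule borel_measurable_simple_function)
  note g01 = insert.prems(4)
  have meas: "number (A i) \<in> Q \<rightarrow>\<^sub>M count_space UNIV" if "i \<in> insert j J" for i
    by (simp add: measurable_cong_sets[OF Q(2) refl] measurable_number insert.prems(2)[OF that])
  define F where "F \<eta> = of_bool (\<forall>i\<in>J. number (A i) \<eta> = k i) * point_prod g \<eta>" for \<eta>
  have [measurable]: "point_prod g \<in> borel_measurable Q"
    by (simp add: measurable_cong_sets[OF Q(2) refl] measurable_point_prod_simple[OF insert.prems(3)])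
  have [measurable]: "number (A j) \<in> Q \<rightarrow>\<^sub>M count_space UNIV" using meas by simp
  have [measurable]: "Measurable.pred Q (\<lambda>\<eta>. \<forall>i\<in>J. number (A i) \<eta> = k i)"
  proof (rule pred_intros_finite(3)[OF insert.hyps(1)])
    fix i assume "i \<in> J"
    then have [measurable]: "number (A i) \<in> Q \<rightarrow>\<^sub>M count_space UNIV" using meas by simp
    show "Measurable.pred Q (\<lambda>\<eta>. number (A i) \<eta> = k i)" by measurable
  qed
  have F [measurable]: "F \<in> borel_measurable Q" unfolding F_def by measurable
  have F01: "F \<eta> \<in> {0..1}" for \<eta> using point_prod_bounds[of \<eta> g] g01 by (auto simp: F_def)
  define a where "a l = (\<integral>\<eta>. of_bool (number (A j) \<eta> = l) * F \<eta> \<partial>Q)" for l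
  define c where "c = (\<integral>x. indicator (A j) x * g x \<partial>\<rho>)"
  define C where "C = (\<Prod>i\<in>J. (\<integral>x. indicator (A i) x * g x \<partial>\<rho>) ^ k i / fact (k i)) *
    exp (- (\<integral>x. 1 - (if x \<in> (\<Union>i\<in>insert j J. A i) then 0 else g x) \<partial>\<rho>))"
  \<comment> \<open>Both coefficient sequences have the generating function
    \<open>C * exp (z * c)\<close>. Tilting \<open>g\<close> by \<open>z\<close> on
    \<open>A j\<close> leaves the factors of the other sets unchanged, by disjointness, and in the
    exponent adds \<open>z * c\<close> to the value that belongs to \<open>g\<close> set to 0 on
    \<open>A j\<close>.\<close>
  have "a l - C * (c ^ l / fact l) = 0" for l
  proof (rule powser_zero_coeffs)
    fix z :: real assume z: "0 < z" "z < 1"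
    let ?g = "\<lambda>x. g x * (if x \<in> A j then z else 1)"
    have "simple_function \<rho> (\<lambda>x. if x \<in> A j then z else 1)"
      using sets.sets_into_space[OF Aj] by (intro simple_function_If_set) (auto simp: Int_absorb2)
    then have g': "simple_function \<rho> ?g" "\<And>x. ?g x \<in> {0..1}"
      using insert.prems(3) g01 z by (auto intro!: simple_function_mult mult_le_one)
    have "(\<lambda>l. a l * z ^ l) sums (\<integral>\<eta>. z ^ number (A j) \<eta> * F \<eta> \<partial>Q)"
      using integral_nat_valued_sums[OF Q(1) _ F F01, of "number (A j)" "\<lambda>l. z ^ l"] z
      by (simp add: a_def mult.commute power_le_one)
    also have "(\<lambda>\<eta>. z ^ number (A j) \<eta> * F \<eta>) =
        (\<lambda>\<eta>. of_bool (\<forall>i\<in>J. number (A i) \<eta> = k i) * point_prod ?g \<eta>)"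
      by (auto simp: F_def point_prod_mult_power)
    also have "(\<integral>\<eta>. of_bool (\<forall>i\<in>J. number (A i) \<eta> = k i) * point_prod ?g \<eta> \<partial>Q) =
        (\<Prod>i\<in>J. (\<integral>x. indicator (A i) x * ?g x \<partial>\<rho>) ^ k i / fact (k i)) *
        exp (- (\<integral>x. 1 - (if x \<in> (\<Union>i\<in>J. A i) then 0 else ?g x) \<partial>\<rho>))"
      using insert.IH[OF disj AJ g'] by simp
    also have "(\<integral>x. 1 - (if x \<in> (\<Union>i\<in>J. A i) then 0 else ?g x) \<partial>\<rho>) =
        (\<integral>x. 1 - (if x \<in> (\<Union>i\<in>insert j J. A i) then 0 else g x) - z * (indicator (A j) x * g x) \<partial>\<rho>)"
      using Aj_disj by (intro Bochner_Integration.integral_cong) (auto simp: indicator_def)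
    also have "\<dots> = (\<integral>x. 1 - (if x \<in> (\<Union>i\<in>insert j J. A i) then 0 else g x) \<partial>\<rho>) - z * c"
    proof -
      have "(\<Union>i\<in>insert j J. A i) \<in> sets \<rho>" using Aj UJ by simp
      then have [measurable]: "Measurable.pred \<rho> (\<lambda>x. x \<in> (\<Union>i\<in>insert j J. A i))" by measurable
      have "integrable \<rho> (\<lambda>x. 1 - (if x \<in> (\<Union>i\<in>insert j J. A i) then 0 else g x))"
      proof (rule \<rho>.integrable_const_bound[of _ 1])
        show "(\<lambda>x. 1 - (if x \<in> (\<Union>i\<in>insert j J. A i) then 0 else g x)) \<in> borel_measurable \<rho>" by measurable
      qed (use g01 in auto)
      moreover have "integrable \<rho> (\<lambda>x. indicator (A j) x * g x)"
        by (rule \<rho>.integrable_const_bound[of _ 1]) (use g01 in \<open>auto simp: indicator_def\<close>)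
      ultimately show ?thesis unfolding c_def by (subst Bochner_Integration.integral_diff) auto
    qed
    also have "(\<Prod>i\<in>J. (\<integral>x. indicator (A i) x * ?g x \<partial>\<rho>) ^ k i / fact (k i)) =
        (\<Prod>i\<in>J. (\<integral>x. indicator (A i) x * g x \<partial>\<rho>) ^ k i / fact (k i))"
    proof (rule prod.cong[OF refl])
      fix i assume "i \<in> J"
      then have "indicator (A i) x * ?g x = indicator (A i) x * g x" for x
        using Aj_disj by (auto simp: indicator_def)
      then show "(\<integral>x. indicator (A i) x * ?g x \<partial>\<rho>) ^ k i / fact (k i) =
          (\<integral>x. indicator (A i) x * g x \<partial>\<rho>) ^ k i / fact (k i)" by (simp only:)
    qed
    finally have "(\<lambda>l. a l * z ^ l) sums (C * exp (z * c))"
      unfolding C_def by (simp add: exp_add[symmetric] mult.assoc)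
    moreover have "(\<lambda>l. C * (c ^ l / fact l) * z ^ l) sums (C * exp (z * c))"
      using sums_mult[OF exp_converges[of "z * c"], of C]
      by (simp add: power_mult_distrib divide_inverse mult_ac)
    ultimately have "(\<lambda>l. a l * z ^ l - C * (c ^ l / fact l) * z ^ l) sums (C * exp (z * c) - C * exp (z * c))"
      by (rule sums_diff)
    then show "(\<lambda>l. (a l - C * (c ^ l / fact l)) * z ^ l) sums 0" by (simp add: left_diff_distrib)
  qed
  from this[of "k j"] have "a (k j) = C * (c ^ k j / fact (k j))" by simp
  moreover have "a (k j) = (\<integral>\<eta>. of_bool (\<forall>i\<in>insert j J. number (A i) \<eta> = k i) * point_prod g \<eta> \<partial>Q)"
    unfolding a_def F_def by (intro Bochner_Integration.integral_cong) auto
  ultimately show ?case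
    using insert.hyps by (simp add: C_def c_def mult_ac)
qed

text \<open>The constant \<open>g = 1\<close> in the joint counts leaves the measure of the union in
  the exponent, which splits into a sum over the disjoint sets; the joint probabilities become
  products of Poisson weights.\<close>

lemma poisson_process_if_pgf:
  assumes \<rho>: "finite_measure \<rho>" and Q: "prob_space Q" "sets Q = sets (conf_space \<rho>)"
    and pgf: "\<And>g. simple_function \<rho> g \<Longrightarrow> (\<And>x. g x \<in> {0..1}) \<Longrightarrow>
      (\<integral>\<eta>. point_prod g \<eta> \<partial>Q) = exp (- (\<integral>x. 1 - g x \<partial>\<rho>))"
  shows "poisson_process \<rho> Q"
proof -
  interpret \<rho>: finite_measure \<rho> by fact
  interpret Q: prob_space Q by fact
  have meas: "number A \<in> Q \<rightarrow>\<^sub>M count_space UNIV" if "A \<in> sets \<rho>" for A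
    by (simp add: measurable_cong_sets[OF Q(2) refl] measurable_number that)
  define w where "w A k = measure \<rho> A ^ k / fact k * exp (- measure \<rho> A)" for A and k :: nat
  have joint: "measure Q {\<eta>\<in>space Q. \<forall>i\<in>J. number (A i) \<eta> = k i} = (\<Prod>i\<in>J. w (A i) (k i))"
    if J: "finite J" "disjoint_family_on A J" "\<And>i. i \<in> J \<Longrightarrow> A i \<in> sets \<rho>"
    for J :: "'b set" and A k
  proof -
    have U: "(\<Union>i\<in>J. A i) \<in> sets \<rho>" using J by auto
    have "measure Q {\<eta>\<in>space Q. \<forall>i\<in>J. number (A i) \<eta> = k i} =
        (\<integral>\<eta>. indicator {\<eta>\<in>space Q. \<forall>i\<in>J. number (A i) \<eta> = k i} \<eta> \<partial>Q)"
      by (simp add: Int_absorb2 subset_eq)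
    also have "\<dots> = (\<integral>\<eta>. of_bool (\<forall>i\<in>J. number (A i) \<eta> = k i) * point_prod (\<lambda>_. 1) \<eta> \<partial>Q)"
      by (intro Bochner_Integration.integral_cong) (auto simp: point_prod_def indicator_def)
    also have "\<dots> = (\<Prod>i\<in>J. (\<integral>x. indicator (A i) x * 1 \<partial>\<rho>) ^ k i / fact (k i)) *
        exp (- (\<integral>x. 1 - (if x \<in> (\<Union>i\<in>J. A i) then 0 else 1) \<partial>\<rho>))"
      by (rule poisson_joint_counts[OF \<rho> Q pgf J]) auto
    also have "(\<integral>x. 1 - (if x \<in> (\<Union>i\<in>J. A i) then 0 else 1) \<partial>\<rho>) = (\<integral>x. indicator (\<Union>i\<in>J. A i) x \<partial>\<rho>)"
      by (intro Bochner_Integration.integral_cong) (auto simp: indicator_def)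
    also have "\<dots> = measure \<rho> (\<Union>i\<in>J. A i)"
      using sets.sets_into_space[OF U] by (simp add: Int_absorb2)
    also have "\<dots> = (\<Sum>i\<in>J. measure \<rho> (A i))"
      using J by (intro \<rho>.finite_measure_finite_Union) auto
    also have "(\<Prod>i\<in>J. (\<integral>x. indicator (A i) x * 1 \<partial>\<rho>) ^ k i / fact (k i)) =
        (\<Prod>i\<in>J. measure \<rho> (A i) ^ k i / fact (k i))"
      using J(3) sets.sets_into_space by (intro prod.cong) (auto simp: Int_absorb2)
    also have "exp (- (\<Sum>i\<in>J. measure \<rho> (A i))) = (\<Prod>i\<in>J. exp (- measure \<rho> (A i)))"
      using J(1) by (simp add: exp_sum flip: sum_negf)
    finally show ?thesis by (simp only: w_def prod.distrib)
  qed
  have single: "measure Q {\<eta>\<in>space Q. number A \<eta> = k} = w A k" if "A \<in> sets \<rho>" for A k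
    using joint[of "{()}" "\<lambda>_. A" "\<lambda>_. k"] that by (simp add: disjoint_family_on_def)
  have indep: "Q.indep_vars (\<lambda>_. count_space UNIV) (\<lambda>i. number (A i)) {..<n}"
    if disj: "disjoint_family_on A {..<n}" and A: "A ` {..<n} \<subseteq> sets \<rho>" for A :: "nat \<Rightarrow> 'a set" and n
  proof (cases "n = 0")
    case True
    then show ?thesis by (simp add: Q.indep_vars_def Q.indep_sets_def)
  next
    case False
    \<comment> \<open>Singletons generate all sets of numbers; \<open>{}\<close> makes the class
      stable under intersection, and \<open>UNIV\<close> is required by the independence criterion
      for generators.\<close>
    define E :: "nat set set" where "E = insert UNIV (insert {} (range (\<lambda>k. {k})))"
    have sets_E: "sets (count_space UNIV) = sigma_sets (space (count_space UNIV)) E"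
    proof -
      have "B \<in> sigma_sets UNIV E" for B :: "nat set"
      proof -
        have "(\<Union>k\<in>B. {k}) \<in> sigma_sets UNIV E"
          by (rule sigma_sets_UNION) (auto simp: E_def intro!: sigma_sets.Basic)
        then show ?thesis by simp
      qed
      then show ?thesis by auto
    qed
    have indep_iff: "Q.indep_vars (\<lambda>_. count_space UNIV) (\<lambda>i. number (A i)) {..<n} \<longleftrightarrow>
        (\<forall>B\<in>{..<n} \<rightarrow> E. measure Q (\<Inter>j\<in>{..<n}. number (A j) -` B j \<inter> space Q) =
          (\<Prod>j<n. measure Q (number (A j) -` B j \<inter> space Q)))"
    proof (rule Q.indep_vars_finite)
      show "number (A i) \<in> Q \<rightarrow>\<^sub>M count_space UNIV" if "i \<in> {..<n}" for i using A that by (intro meas) auto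
      show "Int_stable E" by (auto simp: Int_stable_def E_def)
    qed (use \<open>n \<noteq> 0\<close> sets_E in \<open>auto simp: E_def\<close>)
    show ?thesis
      unfolding indep_iff
    proof
      fix B assume B: "B \<in> {..<n} \<rightarrow> E"
      show "measure Q (\<Inter>j\<in>{..<n}. number (A j) -` B j \<inter> space Q) =
          (\<Prod>j<n. measure Q (number (A j) -` B j \<inter> space Q))"
      proof (cases "\<exists>j<n. B j = {}")
        case True
        then obtain j where j: "j < n" "B j = {}" by auto
        then have "(\<Inter>j\<in>{..<n}. number (A j) -` B j \<inter> space Q) = {}" by force
        moreover have "(\<Prod>j<n. measure Q (number (A j) -` B j \<inter> space Q)) = 0"
          using j by (intro prod_zero bexI[of _ j]) auto
        ultimately show ?thesis by simp
      next
        case False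
        \<comment> \<open>Indices with \<open>B j = UNIV\<close> impose no condition and contribute
          the factor 1; each remaining one prescribes a single count.\<close>
        define J where "J = {j\<in>{..<n}. B j \<noteq> UNIV}"
        have "\<forall>j\<in>J. \<exists>k. B j = {k}" using B False by (force simp: J_def E_def Pi_def)
        then obtain k where k: "\<And>j. j \<in> J \<Longrightarrow> B j = {k j}" by metis
        have J: "finite J" "disjoint_family_on A J" "\<And>i. i \<in> J \<Longrightarrow> A i \<in> sets \<rho>"
          using disj A by (auto simp: J_def disjoint_family_on_def)
        have "(\<forall>j<n. number (A j) \<eta> \<in> B j) \<longleftrightarrow> (\<forall>i\<in>J. number (A i) \<eta> = k i)" for \<eta>
        proof -
          have "(\<forall>j<n. number (A j) \<eta> \<in> B j) \<longleftrightarrow> (\<forall>j\<in>J. number (A j) \<eta> \<in> B j)"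
            unfolding J_def by blast
          then show ?thesis using k by simp
        qed
        moreover have "(\<Inter>j\<in>{..<n}. number (A j) -` B j \<inter> space Q) =
            {\<eta>\<in>space Q. \<forall>j<n. number (A j) \<eta> \<in> B j}"
          using \<open>n \<noteq> 0\<close> by auto
        ultimately have "(\<Inter>j\<in>{..<n}. number (A j) -` B j \<inter> space Q) =
            {\<eta>\<in>space Q. \<forall>i\<in>J. number (A i) \<eta> = k i}" by simp
        then have "measure Q (\<Inter>j\<in>{..<n}. number (A j) -` B j \<inter> space Q) = (\<Prod>i\<in>J. w (A i) (k i))"
          using joint[OF J] by simp
        also have "\<dots> = (\<Prod>j\<in>J. measure Q (number (A j) -` B j \<inter> space Q))"
        proof (rule prod.cong[OF refl])
          fix j assume "j \<in> J"
          moreover have "number (A j) -` {k j} \<inter> space Q = {\<eta>\<in>space Q. number (A j) \<eta> = k j}" by auto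
          ultimately show "w (A j) (k j) = measure Q (number (A j) -` B j \<inter> space Q)"
            using single[OF J(3)] k by simp
        qed
        also have "\<dots> = (\<Prod>j<n. measure Q (number (A j) -` B j \<inter> space Q))"
          by (rule prod.mono_neutral_left) (auto simp: J_def Q.prob_space)
        finally show ?thesis .
      qed
    qed
  qed
  show ?thesis
    unfolding poisson_process_def using \<rho> Q single indep by (simp add: w_def)
qed

text \<open>Mixture construction: with \<open>r\<close> the total mass, throw a
  Poisson(\<open>r\<close>) number of independent points distributed as the normalised measure.
  Given \<open>k\<close> points the functional is \<open>c ^ k\<close>, and the Poisson average is
  \<open>exp (- (1 - c) * r)\<close>. The zero measure cannot be normalised and gets the empty
  configuration.\<close>

lemma poisson_process_exists_pgf:
  assumes \<rho>: "finite_measure \<rho>"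
  obtains Q where "prob_space Q" "sets Q = sets (conf_space \<rho>)"
    "\<And>g. g \<in> borel_measurable \<rho> \<Longrightarrow> (\<And>x. g x \<in> {0..1}) \<Longrightarrow>
      (\<integral>\<eta>. point_prod g \<eta> \<partial>Q) = exp (- (\<integral>x. 1 - g x \<partial>\<rho>))"
proof (cases "measure \<rho> (space \<rho>) = 0")
  case True
  interpret \<rho>: finite_measure \<rho> by fact
  have emp: "{#} \<in> space (conf_space \<rho>)" by simp
  show ?thesis
  proof
    show "prob_space (return (conf_space \<rho>) {#})" using emp by (rule prob_space_return)
    show "sets (return (conf_space \<rho>) {#}) = sets (conf_space \<rho>)" by simp
    fix g :: "'a \<Rightarrow> real" assume g: "g \<in> borel_measurable \<rho>" "\<And>x. g x \<in> {0..1}"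
    have "AE x in \<rho>. False"
      using True by (intro AE_I[of _ _ "space \<rho>"]) (auto simp: \<rho>.emeasure_eq_measure)
    then have "(\<integral>x. 1 - g x \<partial>\<rho>) = 0" by (intro integral_eq_zero_AE) auto
    then show "(\<integral>\<eta>. point_prod g \<eta> \<partial>return (conf_space \<rho>) {#}) = exp (- (\<integral>x. 1 - g x \<partial>\<rho>))"
      using emp g by (simp add: integral_return measurable_point_prod)
  qed
next
  case False
  interpret \<rho>: finite_measure \<rho> by fact
  define r where "r = measure \<rho> (space \<rho>)"
  have r: "0 < r" using False by (simp add: r_def less_le)
  define \<sigma> where "\<sigma> = density \<rho> (\<lambda>_. ennreal (1 / r))"
  have sets_\<sigma> [measurable_cong]: "sets \<sigma> = sets \<rho>" and space_\<sigma>: "space \<sigma> = space \<rho>" by (simp_all add: \<sigma>_def)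
  interpret \<sigma>: prob_space \<sigma>
  proof
    have "emeasure \<sigma> (space \<sigma>) = ennreal (1 / r) * emeasure \<rho> (space \<rho>)"
      by (simp add: \<sigma>_def emeasure_density nn_integral_cmult)
    also have "\<dots> = 1"
      using r by (simp add: \<rho>.emeasure_eq_measure r_def[symmetric] flip: ennreal_mult)
    finally show "emeasure \<sigma> (space \<sigma>) = 1" .
  qed
  define C where "C k \<omega> = image_mset \<omega> (mset_set {..<k})" for k :: nat and \<omega> :: "nat \<Rightarrow> 'a"
  have C: "C k \<in> (\<Pi>\<^sub>M i\<in>{..<k}. \<sigma>) \<rightarrow>\<^sub>M conf_space \<rho>" for k
  proof (rule measurable_conf_spaceI)
    show "set_mset (C k \<omega>) \<subseteq> space \<rho>" if "\<omega> \<in> space (\<Pi>\<^sub>M i\<in>{..<k}. \<sigma>)" for \<omega>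
      using that by (auto simp: C_def space_PiM space_\<sigma> PiE_iff)
    fix A assume A [measurable]: "A \<in> sets \<rho>"
    show "(\<lambda>\<omega>. number A (C k \<omega>)) \<in> (\<Pi>\<^sub>M i\<in>{..<k}. \<sigma>) \<rightarrow>\<^sub>M count_space UNIV"
      unfolding C_def by (simp add: number_image_mset_set)
  qed
  define K where "K k = distr (\<Pi>\<^sub>M i\<in>{..<k}. \<sigma>) (conf_space \<rho>) (C k)" for k
  have prob_K: "prob_space (K k)" for k
    unfolding K_def by (intro prob_space.prob_space_distr C prob_space_PiM \<sigma>.prob_space_axioms)
  have sets_K: "sets (K k) = sets (conf_space \<rho>)" for k by (simp add: K_def)
  define p where "p = measure_pmf (poisson_pmf r)"
  interpret p: prob_space p unfolding p_def by (rule prob_space_measure_pmf)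
  have K: "K \<in> p \<rightarrow>\<^sub>M prob_algebra (conf_space \<rho>)"
    unfolding p_def using prob_K sets_K by (auto simp: space_prob_algebra)
  show ?thesis
  proof
    have "p \<in> space (prob_algebra p)" by (simp add: space_prob_algebra p.prob_space_axioms)
    from sets_bind'[OF this K] prob_space_bind'[OF this K]
    show "sets (p \<bind> K) = sets (conf_space \<rho>)" "prob_space (p \<bind> K)" by simp_all
    fix g :: "'a \<Rightarrow> real" assume g [measurable]: "g \<in> borel_measurable \<rho>" and g01: "\<And>x. g x \<in> {0..1}"
    have pp [measurable]: "point_prod g \<in> borel_measurable (conf_space \<rho>)"
      using g g01 by (rule measurable_point_prod)
    have pp01: "point_prod g \<eta> \<in> {0..1}" for \<eta> using g01 by (intro point_prod_bounds)
    define c where "c = (\<integral>x. g x \<partial>\<sigma>)"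
    have int_g: "integrable \<rho> g" by (rule \<rho>.integrable_const_bound[of _ 1]) (use g01 in auto)
    have int_g\<sigma>: "integrable \<sigma> g" by (rule \<sigma>.integrable_const_bound[of _ 1]) (use g01 in auto)
    have c: "r * c = (\<integral>x. g x \<partial>\<rho>)"
      unfolding c_def \<sigma>_def using r by (subst integral_density) auto
    have c01: "c \<in> {0..1}"
      unfolding c_def using g01 by (auto intro!: integral_nonneg \<sigma>.integral_le_const int_g\<sigma>)
    have "(\<integral>\<eta>. point_prod g \<eta> \<partial>K k) = c ^ k" for k
    proof -
      interpret product_prob_space "\<lambda>_::nat. \<sigma>" "{..<k}" by standard
      have "(\<integral>\<eta>. point_prod g \<eta> \<partial>K k) = (\<integral>\<omega>. (\<Prod>i<k. g (\<omega> i)) \<partial>(\<Pi>\<^sub>M i\<in>{..<k}. \<sigma>))"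
        unfolding K_def by (subst integral_distr[OF C pp]) (simp add: C_def point_prod_image_mset_set)
      also have "\<dots> = (\<Prod>i<k. c)"
        unfolding c_def by (intro product_integral_prod int_g\<sigma>) auto
      finally show ?thesis by simp
    qed
    then have "(\<integral>\<eta>. point_prod g \<eta> \<partial>(p \<bind> K)) = (\<integral>k. c ^ k \<partial>p)"
      using pp01 prob_K
      by (subst integral_bind[where B=1 and B'=1, OF pp _ measurable_prob_algebraD[OF K]])
         (auto simp: prob_space.emeasure_space_1 p.finite_measure_axioms)
    also have "(\<integral>k. c ^ k \<partial>p) = exp (- (1 - c) * r)"
    proof -
      have "(\<lambda>k. c ^ k * (\<integral>l. of_bool (l = k) * 1 \<partial>p)) sums (\<integral>l. c ^ l * 1 \<partial>p)"
        using c01 by (intro integral_nat_valued_sums p.prob_space_axioms) (auto simp: p_def power_le_one)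
      moreover have "(\<integral>l. of_bool (l = k) * (1 :: real) \<partial>p) = r ^ k / fact k * exp (- r)" for k
      proof -
        have "(\<integral>l. of_bool (l = k) * (1 :: real) \<partial>p) = (\<integral>l. indicator {k} l \<partial>p)"
          by (intro Bochner_Integration.integral_cong) (auto simp: indicator_def)
        then show ?thesis using r by (simp add: p_def measure_pmf_single)
      qed
      ultimately show ?thesis using poisson_series[of c r] sums_unique2 by force
    qed
    also have "- (1 - c) * r = - (\<integral>x. 1 - g x \<partial>\<rho>)"
      using c int_g by (simp add: r_def[symmetric] algebra_simps)
    finally show "(\<integral>\<eta>. point_prod g \<eta> \<partial>(p \<bind> K)) = exp (- (\<integral>x. 1 - g x \<partial>\<rho>))" .
  qed
qed

text \<open>The level sets of \<open>g\<close> are disjoint, so the statistic is a product of powers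
  of independent Poisson counts, each with a known generating function.\<close>

lemma poisson_pgf_simple:
  assumes Q: "poisson_process \<rho> Q" and g: "simple_function \<rho> g" "\<And>x. g x \<in> {0..1}"
  shows "(\<integral>\<eta>. point_prod g \<eta> \<partial>Q) = exp (- (\<integral>x. 1 - g x \<partial>\<rho>))"
proof -
  interpret \<rho>: finite_measure \<rho> using Q by (simp add: poisson_process_def)
  interpret Q: prob_space Q using Q by (simp add: poisson_process_def)
  have sets_Q: "sets Q = sets (conf_space \<rho>)" using Q by (simp add: poisson_process_def)
  have space_Q: "space Q = {\<eta>. set_mset \<eta> \<subseteq> space \<rho>}" using sets_eq_imp_space_eq[OF sets_Q] by simp
  have fin: "finite (g ` space \<rho>)" using g(1) by (simp add: simple_function_def)
  define n where "n = card (g ` space \<rho>)"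
  \<comment> \<open>\<open>poisson_process\<close> states independence for sets indexed by
    \<open>{..<n}\<close>, hence this numbering of the values of \<open>g\<close>.\<close>
  obtain h where h: "bij_betw h {..<n} (g ` space \<rho>)"
    using ex_bij_betw_nat_finite[OF fin] by (auto simp: n_def atLeast0LessThan)
  define A where "A i = g -` {h i} \<inter> space \<rho>" for i
  have A: "A i \<in> sets \<rho>" for i unfolding A_def by (rule simple_functionD(2)[OF g(1)])
  have disj: "disjoint_family_on A {..<n}"
    using bij_betw_imp_inj_on[OF h] by (auto simp: disjoint_family_on_def A_def inj_on_def)
  have h01: "h i \<in> {0..1}" if "i < n" for i using bij_betwE[OF h] g(2) that by (metis imageE lessThan_iff)
  have N [measurable]: "number (A i) \<in> Q \<rightarrow>\<^sub>M count_space UNIV" for i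
    by (simp add: measurable_cong_sets[OF sets_Q refl] measurable_number A)
  have indep: "Q.indep_vars (\<lambda>_. count_space UNIV) (\<lambda>i. number (A i)) {..<n}"
  proof -
    have "\<forall>(A :: nat \<Rightarrow> 'a set) n. disjoint_family_on A {..<n} \<and> A ` {..<n} \<subseteq> sets \<rho> \<longrightarrow>
        Q.indep_vars (\<lambda>_. count_space UNIV) (\<lambda>i. number (A i)) {..<n}"
      using Q by (simp add: poisson_process_def)
    then show ?thesis using A disj by blast
  qed
  have single: "(\<integral>\<eta>. h i ^ number (A i) \<eta> \<partial>Q) = exp (- (1 - h i) * measure \<rho> (A i))" if "i < n" for i
  proof -
    have "(\<lambda>k. h i ^ k * (\<integral>\<eta>. of_bool (number (A i) \<eta> = k) * (1 :: real) \<partial>Q)) sums (\<integral>\<eta>. h i ^ number (A i) \<eta> * 1 \<partial>Q)"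
      using h01[OF that] by (intro integral_nat_valued_sums Q.prob_space_axioms) (auto simp: power_le_one)
    moreover have "(\<integral>\<eta>. of_bool (number (A i) \<eta> = k) * (1 :: real) \<partial>Q) =
        measure \<rho> (A i) ^ k / fact k * exp (- measure \<rho> (A i))" for k
    proof -
      have "(\<integral>\<eta>. of_bool (number (A i) \<eta> = k) * (1 :: real) \<partial>Q) =
          (\<integral>\<eta>. indicator {\<eta>\<in>space Q. number (A i) \<eta> = k} \<eta> \<partial>Q)"
        by (intro Bochner_Integration.integral_cong) (auto simp: indicator_def)
      also have "\<dots> = measure Q {\<eta>\<in>space Q. number (A i) \<eta> = k}" by (simp add: Int_absorb2 subset_eq)
      finally show ?thesis using Q A by (simp add: poisson_process_def)
    qed
    ultimately show ?thesis using poisson_series[of "h i" "measure \<rho> (A i)"] sums_unique2 by force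
  qed
  have "(\<integral>\<eta>. point_prod g \<eta> \<partial>Q) = (\<integral>\<eta>. (\<Prod>i<n. h i ^ number (A i) \<eta>) \<partial>Q)"
  proof (rule Bochner_Integration.integral_cong[OF refl])
    fix \<eta> assume "\<eta> \<in> space Q"
    then have "point_prod g \<eta> = (\<Prod>v\<in>g ` space \<rho>. v ^ number (g -` {v} \<inter> space \<rho>) \<eta>)"
      using point_prod_simple_function[OF g(1)] space_Q by auto
    also have "\<dots> = (\<Prod>i<n. h i ^ number (A i) \<eta>)"
      unfolding A_def by (rule prod.reindex_bij_betw[OF h, symmetric])
    finally show "point_prod g \<eta> = (\<Prod>i<n. h i ^ number (A i) \<eta>)" .
  qed
  also have "\<dots> = (\<Prod>i<n. \<integral>\<eta>. h i ^ number (A i) \<eta> \<partial>Q)"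
  proof (rule Q.indep_vars_lebesgue_integral)
    show "Q.indep_vars (\<lambda>_. borel) (\<lambda>i \<eta>. h i ^ number (A i) \<eta>) {..<n}"
      by (rule Q.indep_vars_compose2[OF indep, of "\<lambda>i k. h i ^ k"]) simp
    show "integrable Q (\<lambda>\<eta>. h i ^ number (A i) \<eta>)" if "i \<in> {..<n}" for i
      using h01[of i] that
      by (intro Q.integrable_const_bound[of _ 1] measurable_compose[OF N]) (auto simp: power_le_one)
  qed simp
  also have "\<dots> = exp (\<Sum>i<n. - (1 - h i) * measure \<rho> (A i))"
    by (simp add: single exp_sum)
  also have "(\<Sum>i<n. - (1 - h i) * measure \<rho> (A i)) = - (\<Sum>i<n. (1 - h i) * measure \<rho> (A i))"
    unfolding sum_negf[symmetric] by (intro sum.cong) (simp_all add: algebra_simps)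
  also have "(\<Sum>i<n. (1 - h i) * measure \<rho> (A i)) = (\<integral>x. (\<Sum>i<n. (1 - h i) * indicator (A i) x) \<partial>\<rho>)"
    using A sets.sets_into_space[OF A]
    by (subst Bochner_Integration.integral_sum) (auto simp: Int_absorb2 \<rho>.emeasure_eq_measure intro!: integrable_mult_right)
  also have "\<dots> = (\<integral>x. 1 - g x \<partial>\<rho>)"
  proof (rule Bochner_Integration.integral_cong[OF refl])
    fix x assume x: "x \<in> space \<rho>"
    then obtain i where i: "i < n" "g x = h i" using bij_betw_imp_surj_on[OF h] by auto
    have "(\<Sum>j<n. (1 - h j) * indicator (A j) x) = (\<Sum>j<n. if j = i then 1 - g x else 0)"
    proof (intro sum.cong refl)
      fix j assume "j \<in> {..<n}"
      then have "x \<in> A j \<longleftrightarrow> j = i"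
        using i x bij_betw_imp_inj_on[OF h] by (auto simp: A_def inj_on_def)
      then show "(1 - h j) * indicator (A j) x = (if j = i then 1 - g x else 0)"
        using i by (simp add: indicator_def)
    qed
    then show "(\<Sum>j<n. (1 - h j) * indicator (A j) x) = 1 - g x" using i by simp
  qed
  finally show ?thesis .
qed

lemma poisson_process_unique:
  assumes "poisson_process \<rho> Q" "poisson_process \<rho> Q'"
  shows "Q = Q'"
  by (rule conf_law_eqI[of _ _ \<rho>])
     (use assms in \<open>simp_all add: poisson_process_def poisson_pgf_simple[OF assms(1)] poisson_pgf_simple[OF assms(2)]\<close>)

lemma poisson_process_poisson_law:
  assumes "finite_measure \<rho>"
  shows "poisson_process \<rho> (poisson_law \<rho>)"
proof -
  obtain Q where Q: "prob_space Q" "sets Q = sets (conf_space \<rho>)"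
    "\<And>g. g \<in> borel_measurable \<rho> \<Longrightarrow> (\<And>x. g x \<in> {0..1}) \<Longrightarrow>
      (\<integral>\<eta>. point_prod g \<eta> \<partial>Q) = exp (- (\<integral>x. 1 - g x \<partial>\<rho>))"
    using poisson_process_exists_pgf[OF assms] by metis
  have "poisson_process \<rho> Q"
    by (rule poisson_process_if_pgf[OF assms Q(1,2)]) (rule Q(3)[OF borel_measurable_simple_function])
  then show ?thesis
    unfolding poisson_law_def by (rule theI) (use \<open>poisson_process \<rho> Q\<close> poisson_process_unique in blast)
qed

text \<open>No limit over simple functions is taken: the constructed process satisfies the formula
  for every measurable \<open>g\<close>, and uniqueness identifies it with \<open>Q\<close>.\<close>

lemma poisson_pgf:
  assumes Q: "poisson_process \<rho> Q" and g: "g \<in> borel_measurable \<rho>" "\<And>x. g x \<in> {0..1}"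
  shows "(\<integral>\<eta>. point_prod g \<eta> \<partial>Q) = exp (- (\<integral>x. 1 - g x \<partial>\<rho>))"
proof -
  have \<rho>: "finite_measure \<rho>" using Q by (simp add: poisson_process_def)
  obtain Q' where Q': "prob_space Q'" "sets Q' = sets (conf_space \<rho>)"
    "\<And>g. g \<in> borel_measurable \<rho> \<Longrightarrow> (\<And>x. g x \<in> {0..1}) \<Longrightarrow>
      (\<integral>\<eta>. point_prod g \<eta> \<partial>Q') = exp (- (\<integral>x. 1 - g x \<partial>\<rho>))"
    using poisson_process_exists_pgf[OF \<rho>] by metis
  have "poisson_process \<rho> Q'"
    by (rule poisson_process_if_pgf[OF \<rho> Q'(1,2)]) (rule Q'(3)[OF borel_measurable_simple_function])
  then have "Q = Q'" by (rule poisson_process_unique[OF Q])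
  then show ?thesis using Q'(3)[OF g] by simp
qed

text \<open>The form suited to the gas, where intensities are densities and the killed semigroup
  acts on functions with values in \<open>ennreal\<close>.\<close>

lemma poisson_pgf_nn:
  assumes Q: "poisson_process \<rho> Q" and g [measurable]: "g \<in> borel_measurable \<rho>" and g01: "\<And>x. g x \<in> {0..1}"
  shows "(\<integral>\<eta>. point_prod g \<eta> \<partial>Q) = exp (- enn2real (\<integral>\<^sup>+x. ennreal (1 - g x) \<partial>\<rho>))"
proof -
  have "(\<integral>x. 1 - g x \<partial>\<rho>) = enn2real (\<integral>\<^sup>+x. ennreal (1 - g x) \<partial>\<rho>)"
    by (rule integral_eq_nn_integral) (use g01 in auto)
  then show ?thesis using poisson_pgf[OF Q g g01] by simp
qed

section \<open>Sums of measures\<close>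

lemma add_measure_sets [simp]: "sets (add_measure M N) = sets M" "space (add_measure M N) = space M"
  unfolding add_measure_def by simp_all

lemma emeasure_add_measure:
  assumes N: "sets N = sets M" and A: "A \<in> sets M"
  shows "emeasure (add_measure M N) A = emeasure M A + emeasure N A"
  unfolding add_measure_def
proof (rule emeasure_measure_of_sigma[OF sets.sigma_algebra_axioms _ _ A])
  show "positive (sets M) (\<lambda>A. emeasure M A + emeasure N A)" by (simp add: positive_def)
  show "countably_additive (sets M) (\<lambda>A. emeasure M A + emeasure N A)"
  proof (rule countably_additiveI)
    fix A :: "nat \<Rightarrow> 'a set" assume A: "range A \<subseteq> sets M" "disjoint_family A"
    have "(\<Sum>i. emeasure M (A i) + emeasure N (A i)) = (\<Sum>i. emeasure M (A i)) + (\<Sum>i. emeasure N (A i))"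
      by (intro suminf_add[symmetric]) auto
    then show "(\<Sum>i. emeasure M (A i) + emeasure N (A i)) = emeasure M (\<Union>i. A i) + emeasure N (\<Union>i. A i)"
      using A N by (simp add: suminf_emeasure)
  qed
qed

lemma nn_integral_add_measure:
  assumes N: "sets N = sets M" and f: "f \<in> borel_measurable M"
  shows "(\<integral>\<^sup>+x. f x \<partial>add_measure M N) = (\<integral>\<^sup>+x. f x \<partial>M) + (\<integral>\<^sup>+x. f x \<partial>N)"
  using f
proof (induction rule: borel_measurable_induct)
  case (cong f g)
  have "space N = space M" using sets_eq_imp_space_eq[OF N] .
  then show ?case using cong by (simp cong: nn_integral_cong_simp)
next
  case (set A)
  then show ?case using N by (simp add: emeasure_add_measure)
next
  case (mult f c)
  have "f \<in> borel_measurable N" "f \<in> borel_measurable (add_measure M N)"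
    using mult.hyps by (simp_all cong: measurable_cong_sets add: N)
  then show ?case using mult by (simp add: nn_integral_cmult distrib_left)
next
  case (add f g)
  have "f \<in> borel_measurable N" "f \<in> borel_measurable (add_measure M N)"
    "g \<in> borel_measurable N" "g \<in> borel_measurable (add_measure M N)"
    using add.hyps by (simp_all cong: measurable_cong_sets add: N)
  then show ?case using add by (simp add: nn_integral_add ac_simps)
next
  case (seq f)
  have meas: "f i \<in> borel_measurable N" "f i \<in> borel_measurable (add_measure M N)" for i
    using seq.hyps(1)[of i] by (simp_all cong: measurable_cong_sets add: N)
  have mono: "incseq (\<lambda>i. integral\<^sup>N K (f i))" for K :: "'a measure"
    using seq.hyps by (auto simp: incseq_def le_fun_def intro!: nn_integral_mono)
  have "(\<integral>\<^sup>+x. (SUP i. f i) x \<partial>K) = (SUP i. integral\<^sup>N K (f i))" if "\<And>i. f i \<in> borel_measurable K" for K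
    unfolding SUP_apply using seq.hyps that by (intro nn_integral_monotone_convergence_SUP) auto
  then show ?case
    using seq.IH seq.hyps(1) meas ennreal_SUP_add[OF mono mono, of M N] by simp
qed

section \<open>Hitting times of continuous processes\<close>

lemma hitting_time_nonneg: "0 \<le> hitting_time S w"
  unfolding hitting_time_def by (rule Inf_greatest) auto

lemma hitting_time_le: "0 \<le> t \<Longrightarrow> w t \<in> S \<Longrightarrow> hitting_time S w \<le> ereal t"
  unfolding hitting_time_def by (rule Inf_lower) auto

lemma hitting_time_greatest:
  "(\<And>t. 0 \<le> t \<Longrightarrow> w t \<in> S \<Longrightarrow> c \<le> ereal t) \<Longrightarrow> c \<le> hitting_time S w"
  unfolding hitting_time_def by (rule Inf_greatest) auto

text \<open>By continuity the instants spent in a closed set form a closed set of times, which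
  contains its infimum once it is nonempty.\<close>

lemma hitting_time_attained:
  fixes w :: "real \<Rightarrow> 'a::topological_space"
  assumes S: "closed S" and w: "continuous_on {0..} w" and fin: "hitting_time S w < \<infinity>"
  obtains t where "0 \<le> t" "hitting_time S w = ereal t" "w t \<in> S"
proof -
  define T where "T = {0..} \<inter> w -` S"
  have "T \<noteq> {}"
  proof
    assume "T = {}"
    then have "{ereal t | t. 0 \<le> t \<and> w t \<in> S} = {}" by (auto simp: T_def)
    then have "hitting_time S w = \<infinity>" unfolding hitting_time_def by (simp only: Inf_empty top_ereal_def)
    with fin show False by simp
  qed
  moreover have "closed T" unfolding T_def by (intro continuous_closed_preimage w S closed_atLeast)
  moreover have bdd: "bdd_below T" by (auto simp: T_def intro!: bdd_belowI[of _ 0])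
  ultimately have Inf: "Inf T \<in> T" by (intro closed_contains_Inf)
  show thesis
  proof
    show "0 \<le> Inf T" "w (Inf T) \<in> S" using Inf by (auto simp: T_def)
    show "hitting_time S w = ereal (Inf T)"
    proof (rule antisym)
      show "hitting_time S w \<le> ereal (Inf T)" using Inf by (intro hitting_time_le) (auto simp: T_def)
      show "ereal (Inf T) \<le> hitting_time S w"
        by (intro hitting_time_greatest) (auto simp: T_def intro!: cInf_lower bdd)
    qed
  qed
qed

text \<open>The image of \<open>{0..t}\<close> is connected; meeting both \<open>D\<close> and its
  complement it would meet the frontier.\<close>

lemma before_hitting_frontier:
  fixes w :: "real \<Rightarrow> 'a::topological_space"
  assumes w: "continuous_on {0..} w" "w 0 \<in> D" and t: "0 \<le> t" "ereal t < hitting_time (frontier D) w"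
  shows "w t \<in> D"
proof (rule ccontr)
  assume "w t \<notin> D"
  have "connected (w ` {0..t})"
    using w(1) by (intro connected_continuous_image) (auto elim: continuous_on_subset)
  then have "w ` {0..t} \<inter> frontier D \<noteq> {}"
  proof (rule connected_Int_frontier)
    have "w 0 \<in> w ` {0..t}" "w t \<in> w ` {0..t}" using t(1) by auto
    then show "w ` {0..t} \<inter> D \<noteq> {}" "w ` {0..t} - D \<noteq> {}" using w(2) \<open>w t \<notin> D\<close> by blast+
  qed
  then obtain s where s: "s \<in> {0..t}" "w s \<in> frontier D" by blast
  then have "hitting_time (frontier D) w \<le> ereal s" by (intro hitting_time_le) auto
  also have "\<dots> \<le> ereal t" using s by simp
  finally show False using t by simp
qed

text \<open>A countable description using only times up to \<open>t\<close>. A hit is approached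
  along rationals by continuity; conversely the distance to \<open>S\<close> attains its minimum on
  the compact interval, and that minimum is 0. For empty \<open>S\<close> the equivalence fails, as
  \<open>infdist\<close> to \<open>{}\<close> is 0.\<close>

lemma hitting_time_le_iff:
  fixes w :: "real \<Rightarrow> 'a::metric_space"
  assumes S: "closed S" "S \<noteq> {}" and w: "continuous_on {0..} w" and t: "0 \<le> t"
  shows "hitting_time S w \<le> ereal t \<longleftrightarrow>
    (\<forall>n. \<exists>q\<in>\<rat>. 0 \<le> q \<and> q \<le> t \<and> infdist (w q) S < 1 / real (Suc n))"
proof
  assume le: "hitting_time S w \<le> ereal t"
  then have "hitting_time S w < \<infinity>" by (rule order.strict_trans1) simp
  then obtain t0 where t0: "0 \<le> t0" "hitting_time S w = ereal t0" "w t0 \<in> S"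
    using hitting_time_attained[OF S(1) w] by metis
  \<comment> \<open>Rounding down gives \<open>q n \<le> t0 \<le> t\<close>, so that no position
    after time \<open>t\<close> is consulted.\<close>
  define q where "q n = real_of_int \<lfloor>real (Suc n) * t0\<rfloor> / real (Suc n)" for n
  have q: "q n \<in> \<rat>" "0 \<le> q n" "q n \<le> t0" for n
    unfolding q_def using floor_grid(1,2)[OF t0(1)] by (simp_all del: of_nat_Suc)
  have "q \<longlonglongrightarrow> t0" unfolding q_def using floor_grid_tendsto[OF t0(1)] .
  then have "(\<lambda>n. infdist (w (q n)) S) \<longlonglongrightarrow> infdist (w t0) S"
    using q t0(1) by (intro tendsto_infdist continuous_on_tendsto_compose[OF w]) auto
  then have lim: "(\<lambda>n. infdist (w (q n)) S) \<longlonglongrightarrow> 0" using t0(3) by simp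
  show "\<forall>n. \<exists>q\<in>\<rat>. 0 \<le> q \<and> q \<le> t \<and> infdist (w q) S < 1 / real (Suc n)"
  proof
    fix n
    have "eventually (\<lambda>m. infdist (w (q m)) S < 1 / real (Suc n)) sequentially"
      by (rule order_tendstoD(2)[OF lim]) simp
    then obtain m where "infdist (w (q m)) S < 1 / real (Suc n)" by (auto simp: eventually_sequentially)
    moreover have "q m \<le> t" using q(3)[of m] le t0(2) by simp
    ultimately show "\<exists>q\<in>\<rat>. 0 \<le> q \<and> q \<le> t \<and> infdist (w q) S < 1 / real (Suc n)"
      using q(1,2) by blast
  qed
next
  assume *: "\<forall>n. \<exists>q\<in>\<rat>. 0 \<le> q \<and> q \<le> t \<and> infdist (w q) S < 1 / real (Suc n)"
  have "continuous_on {0..t} (\<lambda>s. infdist (w s) S)"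
    by (intro continuous_on_infdist continuous_on_subset[OF w]) auto
  then obtain s where s: "s \<in> {0..t}" "\<And>q. q \<in> {0..t} \<Longrightarrow> infdist (w s) S \<le> infdist (w q) S"
    using continuous_attains_inf[of "{0..t}" "\<lambda>s. infdist (w s) S"] t by auto
  have "infdist (w s) S \<le> 1 / real (Suc n)" for n
  proof -
    obtain q where "q \<in> {0..t}" "infdist (w q) S < 1 / real (Suc n)"
      using * by (metis atLeastAtMost_iff)
    then show ?thesis using s(2)[of q] by linarith
  qed
  then have "infdist (w s) S \<le> 0"
    using LIMSEQ_inverse_real_of_nat
    by (intro tendsto_lowerbound[of "\<lambda>n. 1 / real (Suc n)" 0 sequentially]) (auto simp: inverse_eq_divide)
  then have "w s \<in> S"
    using in_closed_iff_infdist_zero[OF S] infdist_nonneg[of "w s" S] by simp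
  then have "hitting_time S w \<le> ereal s" using s(1) by (intro hitting_time_le) auto
  also have "\<dots> \<le> ereal t" using s(1) by simp
  finally show "hitting_time S w \<le> ereal t" .
qed

text \<open>\<open>G\<close> only has to see \<open>Y\<close> up to time \<open>t\<close>. The
  statement therefore applies to \<open>M\<close> and also to the natural filtration at
  \<open>t\<close>, where it says that the hitting time is a stopping time.\<close>

lemma hitting_time_le_sets:
  fixes Y :: "real \<Rightarrow> 'w \<Rightarrow> 'a::metric_space"
  assumes S: "closed S" "S \<noteq> {}" and t: "0 \<le> t"
    and Y: "\<And>q. 0 \<le> q \<Longrightarrow> q \<le> t \<Longrightarrow> Y q \<in> G \<rightarrow>\<^sub>M borel"
    and cont: "\<And>\<omega>. \<omega> \<in> space G \<Longrightarrow> continuous_on {0..} (\<lambda>s. Y s \<omega>)"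
  shows "{\<omega>\<in>space G. hitting_time S (\<lambda>s. Y s \<omega>) \<le> ereal t} \<in> sets G"
proof -
  let ?A = "\<lambda>n q. {\<omega>\<in>space G. infdist (Y q \<omega>) S < 1 / real (Suc n)}"
  have "{\<omega>\<in>space G. hitting_time S (\<lambda>s. Y s \<omega>) \<le> ereal t} = (\<Inter>n. \<Union>q\<in>\<rat> \<inter> {0..t}. ?A n q)"
    using hitting_time_le_iff[OF S cont t] by (auto simp: Bex_def)
  also have "\<dots> \<in> sets G"
  proof -
    have "?A n q \<in> sets G" if "q \<in> \<rat> \<inter> {0..t}" for n q
    proof -
      have [measurable]: "Y q \<in> G \<rightarrow>\<^sub>M borel" using Y that by auto
      have [measurable]: "(\<lambda>x. infdist x S) \<in> borel_measurable borel"
        by (intro borel_measurable_continuous_onI continuous_on_infdist continuous_on_id)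
      show ?thesis by measurable
    qed
    moreover have "countable (\<rat> \<inter> {0..t})" using countable_rat by (rule countable_subset[rotated]) auto
    ultimately have "(\<Union>q\<in>\<rat> \<inter> {0..t}. ?A n q) \<in> sets G" for n by (intro sets.countable_UN') auto
    then show ?thesis by (intro sets.countable_INT) auto
  qed
  finally show ?thesis .
qed

section \<open>Measurability of hitting times and absorbed paths\<close>

locale continuous_process =
  fixes M :: "'w measure" and Y :: "real \<Rightarrow> 'w \<Rightarrow> 'a::metric_space"
  assumes Y_measurable: "\<And>t. 0 \<le> t \<Longrightarrow> Y t \<in> M \<rightarrow>\<^sub>M borel"
    and Y_continuous: "\<And>\<omega>. \<omega> \<in> space M \<Longrightarrow> continuous_on {0..} (\<lambda>t. Y t \<omega>)"
begin

text \<open>Measurability is given for each fixed time only. A random time rounded down to a grid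
  takes countably many values, and path continuity passes to the limit.\<close>

lemma measurable_at_random_time:
  assumes \<sigma> [measurable]: "\<sigma> \<in> borel_measurable M" and nn: "\<And>\<omega>. \<omega> \<in> space M \<Longrightarrow> 0 \<le> \<sigma> \<omega>"
  shows "(\<lambda>\<omega>. Y (\<sigma> \<omega>) \<omega>) \<in> M \<rightarrow>\<^sub>M borel"
proof (rule borel_measurable_LIMSEQ_metric)
  fix n :: nat
  have "(\<lambda>\<omega>. Y (real (nat \<lfloor>real (Suc n) * \<sigma> \<omega>\<rfloor>) / real (Suc n)) \<omega>) \<in> M \<rightarrow>\<^sub>M borel"
    by (rule measurable_compose_countable[of "\<lambda>i \<omega>. Y (real i / real (Suc n)) \<omega>"])
       (auto intro!: Y_measurable)
  then show "(\<lambda>\<omega>. Y (real (nat \<lfloor>real (Suc n) * \<sigma> \<omega>\<rfloor>) / real (Suc n)) \<omega>) \<in> M \<rightarrow>\<^sub>M borel" .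
next
  fix \<omega> assume \<omega>: "\<omega> \<in> space M"
  have eq: "real (nat \<lfloor>real (Suc n) * \<sigma> \<omega>\<rfloor>) = real_of_int \<lfloor>real (Suc n) * \<sigma> \<omega>\<rfloor>" for n
    using nn[OF \<omega>] by simp
  show "(\<lambda>n. Y (real (nat \<lfloor>real (Suc n) * \<sigma> \<omega>\<rfloor>) / real (Suc n)) \<omega>) \<longlonglongrightarrow> Y (\<sigma> \<omega>) \<omega>"
    unfolding eq using floor_grid_tendsto[OF nn[OF \<omega>]] nn[OF \<omega>] floor_grid_nonneg[OF nn[OF \<omega>]]
    by (intro continuous_on_tendsto_compose[OF Y_continuous[OF \<omega>]]) (auto simp del: of_nat_Suc)
qed

lemma measurable_hitting_time:
  assumes S: "closed S" "S \<noteq> {}"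
  shows "(\<lambda>\<omega>. hitting_time S (\<lambda>s. Y s \<omega>)) \<in> borel_measurable M"
  unfolding borel_measurable_iff_Iic_ereal
proof
  fix c :: ereal
  have eq: "(\<lambda>\<omega>. hitting_time S (\<lambda>s. Y s \<omega>)) -` {..c} \<inter> space M = {\<omega>\<in>space M. hitting_time S (\<lambda>s. Y s \<omega>) \<le> c}"
    by auto
  show "(\<lambda>\<omega>. hitting_time S (\<lambda>s. Y s \<omega>)) -` {..c} \<inter> space M \<in> sets M"
  proof (cases "0 \<le> c")
    case True
    show ?thesis
    proof (cases c)
      case (real r)
      then show ?thesis
        unfolding eq using True by (simp add: hitting_time_le_sets[OF S _ Y_measurable Y_continuous])
    qed (use True eq in auto)
  next
    case False
    then have "{\<omega>\<in>space M. hitting_time S (\<lambda>s. Y s \<omega>) \<le> c} = {}"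
      using hitting_time_nonneg[of S] by (auto intro: order_trans)
    then show ?thesis unfolding eq by (simp only: sets.empty_sets)
  qed
qed

text \<open>On paths that never hit, \<open>real_of_ereal\<close> turns \<infinity> into 0 and the
  position at time 0 is read. Every use of the value is guarded by finiteness of the hitting
  time.\<close>

lemma measurable_at_hitting_time:
  assumes S: "closed S" "S \<noteq> {}"
  shows "(\<lambda>\<omega>. Y (real_of_ereal (hitting_time S (\<lambda>s. Y s \<omega>))) \<omega>) \<in> M \<rightarrow>\<^sub>M borel"
proof (rule measurable_at_random_time)
  note measurable_hitting_time[OF S, measurable]
  show "(\<lambda>\<omega>. real_of_ereal (hitting_time S (\<lambda>s. Y s \<omega>))) \<in> borel_measurable M" by measurable
qed (simp add: hitting_time_nonneg real_of_ereal_pos)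

lemma measurable_absorbed:
  assumes D: "frontier D \<noteq> {}" and t: "0 \<le> t"
  shows "absorbed D Y t \<in> M \<rightarrow>\<^sub>M borel"
proof -
  note measurable_hitting_time[OF frontier_closed D, measurable] Y_measurable[OF t, measurable]
    measurable_at_hitting_time[OF frontier_closed D, measurable]
  show ?thesis unfolding absorbed_def[abs_def] Let_def by measurable
qed

text \<open>\<open>absorption_time\<close> refers to the stopped path, but stopping changes nothing
  before the hit and leaves the path on the frontier from then on.\<close>

lemma absorption_time_eq:
  assumes \<omega>: "\<omega> \<in> space M"
  shows "absorption_time D Y \<omega> = hitting_time (frontier D) (\<lambda>s. Y s \<omega>)"
proof (cases "hitting_time (frontier D) (\<lambda>s. Y s \<omega>) < \<infinity>")
  case False
  then have "absorbed D Y s \<omega> = Y s \<omega>" for s by (simp add: absorbed_def)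
  then show ?thesis by (simp add: absorption_time_def)
next
  case True
  obtain t where t: "0 \<le> t" "hitting_time (frontier D) (\<lambda>s. Y s \<omega>) = ereal t" "Y t \<omega> \<in> frontier D"
    using hitting_time_attained[OF frontier_closed Y_continuous[OF \<omega>] True] by metis
  have ab: "absorbed D Y s \<omega> = (if s < t then Y s \<omega> else Y t \<omega>)" for s
    using t(2) by (simp add: absorbed_def)
  show ?thesis
    unfolding absorption_time_def t(2)
  proof (rule antisym)
    show "hitting_time (frontier D) (\<lambda>s. absorbed D Y s \<omega>) \<le> ereal t"
      using t by (intro hitting_time_le) (auto simp: ab)
    show "ereal t \<le> hitting_time (frontier D) (\<lambda>s. absorbed D Y s \<omega>)"
    proof (rule hitting_time_greatest)
      fix s :: real assume s: "0 \<le> s" "absorbed D Y s \<omega> \<in> frontier D"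
      show "ereal t \<le> ereal s"
      proof (rule ccontr)
        assume "\<not> ereal t \<le> ereal s"
        then have "s < t" "Y s \<omega> \<in> frontier D" using s(2) by (auto simp: ab)
        then show False using hitting_time_le[of s "\<lambda>s. Y s \<omega>" "frontier D"] s(1) t(2) by simp
      qed
    qed
  qed
qed

lemma absorbed_at_absorption_time:
  assumes "\<omega> \<in> space M"
  shows "absorbed D Y (real_of_ereal (absorption_time D Y \<omega>)) \<omega> =
    Y (real_of_ereal (hitting_time (frontier D) (\<lambda>s. Y s \<omega>))) \<omega>"
  unfolding absorption_time_eq[OF assms] by (simp add: absorbed_def)

text \<open>From the hitting time on, the absorbed path sits in the frontier, which is disjoint from
  the open set \<open>D\<close>.\<close>

lemma absorbed_mem_iff:
  assumes \<omega>: "\<omega> \<in> space M" and D: "open D" and t: "0 \<le> t"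
  shows "absorbed D Y t \<omega> \<in> D \<longleftrightarrow>
    ereal t < hitting_time (frontier D) (\<lambda>s. Y s \<omega>) \<and> Y t \<omega> \<in> D"
proof (cases "ereal t < hitting_time (frontier D) (\<lambda>s. Y s \<omega>)")
  case True
  then show ?thesis by (simp add: absorbed_def)
next
  case False
  then have "hitting_time (frontier D) (\<lambda>s. Y s \<omega>) \<le> ereal t" by simp
  then have "hitting_time (frontier D) (\<lambda>s. Y s \<omega>) < \<infinity>"
    by (rule order.strict_trans1) simp
  then obtain s where "hitting_time (frontier D) (\<lambda>s. Y s \<omega>) = ereal s" "Y s \<omega> \<in> frontier D"
    using hitting_time_attained[OF frontier_closed Y_continuous[OF \<omega>]] by metis
  then show ?thesis
    using False frontier_disjoint_eq[of D] D by (auto simp: absorbed_def)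
qed

end

section \<open>The Markov property for the path after a fixed time\<close>

text \<open>The coordinate sigma-algebra on paths continuous on \<open>{0..}\<close>; values at
  negative times are arbitrary and invisible to it. Keeping only continuous paths is what makes
  hitting times measurable here.\<close>

definition path_space :: "(real \<Rightarrow> 'a::topological_space) measure" where
  "path_space = sigma {w. continuous_on {0..} w}
    {{w. continuous_on {0..} w \<and> w t \<in> A} | t A. 0 \<le> t \<and> A \<in> sets borel}"

lemma space_path_space [simp]: "space path_space = {w. continuous_on {0..} w}"
  by (simp add: path_space_def space_measure_of_conv)

lemma sets_path_space: "sets path_space = sigma_sets {w. continuous_on {0..} w}
    {{w. continuous_on {0..} w \<and> w t \<in> A} | t A. 0 \<le> t \<and> A \<in> sets borel}"
  unfolding path_space_def by (rule sets_measure_of) auto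

lemma measurable_path_coordinate: "0 \<le> t \<Longrightarrow> (\<lambda>w. w t) \<in> path_space \<rightarrow>\<^sub>M borel"
proof (rule measurableI)
  fix A :: "'a set" assume "0 \<le> t" "A \<in> sets borel"
  then have "{w. continuous_on {0..} w \<and> w t \<in> A} \<in> sets path_space"
    unfolding sets_path_space by (intro sigma_sets.Basic) auto
  then show "(\<lambda>w. w t) -` A \<inter> space path_space \<in> sets path_space"
    by (simp add: vimage_def Int_def conj_commute)
qed simp

lemma measurable_path_spaceI:
  assumes "\<And>\<omega>. \<omega> \<in> space N \<Longrightarrow> continuous_on {0..} (f \<omega>)"
    and coord: "\<And>t. 0 \<le> t \<Longrightarrow> (\<lambda>\<omega>. f \<omega> t) \<in> N \<rightarrow>\<^sub>M borel"
  shows "f \<in> N \<rightarrow>\<^sub>M path_space"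
  unfolding path_space_def
proof (rule measurable_measure_of)
  fix E :: "(real \<Rightarrow> 'b) set"
  assume "E \<in> {{w. continuous_on {0..} w \<and> w t \<in> A} | t A. 0 \<le> t \<and> A \<in> sets borel}"
  then obtain t A where tA: "0 \<le> t" "A \<in> sets borel" and E: "E = {w. continuous_on {0..} w \<and> w t \<in> A}"
    by auto
  have "f -` E \<inter> space N = (\<lambda>\<omega>. f \<omega> t) -` A \<inter> space N" using assms(1) unfolding E by auto
  also have "\<dots> \<in> sets N" by (rule measurable_sets[OF coord tA(2)]) fact
  finally show "f -` E \<inter> space N \<in> sets N" .
qed (use assms(1) in auto)

text \<open>Cylinder sets, listing the successive time increments.\<close>

primrec cylinder :: "(real \<times> 'a set) list \<Rightarrow> (real \<Rightarrow> 'a) set" where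
  "cylinder [] = UNIV"
| "cylinder (p # l) = {w. w (fst p) \<in> snd p \<and> (\<lambda>s. w (fst p + s)) \<in> cylinder l}"

definition cylinder_data :: "(real \<times> 'a::topological_space set) list \<Rightarrow> bool" where
  "cylinder_data l \<longleftrightarrow> (\<forall>(u, A)\<in>set l. 0 \<le> u \<and> A \<in> sets borel)"

lemma cylinder_data_simps [simp]:
  "cylinder_data []" "cylinder_data ((u, A) # l) \<longleftrightarrow> 0 \<le> u \<and> A \<in> sets borel \<and> cylinder_data l"
  by (auto simp: cylinder_data_def)

text \<open>Two lists are merged: the condition with the smaller increment comes first, and the
  other list continues from there with its first increment shortened to the difference. One list
  loses an entry while the other keeps its length, hence the induction on the total length.\<close>

lemma cylinder_Int:
  "cylinder_data l \<Longrightarrow> cylinder_data l' \<Longrightarrow> \<exists>l''. cylinder_data l'' \<and> cylinder l \<inter> cylinder l' = cylinder l''"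
proof (induction "length l + length l'" arbitrary: l l' rule: less_induct)
  case less
  have step: "\<exists>l''. cylinder_data l'' \<and> cylinder ((u, A) # k) \<inter> cylinder ((v, B) # k') = cylinder l''"
    if IH: "\<exists>l''. cylinder_data l'' \<and> cylinder k \<inter> cylinder ((v - u, B) # k') = cylinder l''"
      and "0 \<le> u" "A \<in> sets borel" for u v A B k and k' :: "(real \<times> 'a set) list"
  proof -
    obtain l'' where l'': "cylinder_data l''" "cylinder k \<inter> cylinder ((v - u, B) # k') = cylinder l''"
      using IH by auto
    have "cylinder ((u, A) # k) \<inter> cylinder ((v, B) # k') =
        {w. w u \<in> A \<and> (\<lambda>s. w (u + s)) \<in> cylinder k \<inter> cylinder ((v - u, B) # k')}"
      by (auto simp: algebra_simps)
    also have "\<dots> = cylinder ((u, A) # l'')" unfolding l''(2) by simp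
    finally show ?thesis
      using l''(1) that(2,3) by (intro exI[of _ "(u, A) # l''"]) simp
  qed
  show ?case
  proof (cases l)
    case Nil
    then show ?thesis using less.prems by auto
  next
    case (Cons p k)
    obtain u A where p: "p = (u, A)" by force
    show ?thesis
    proof (cases l')
      case Nil
      then show ?thesis using less.prems by auto
    next
      case l': (Cons p' k')
      obtain v B where p': "p' = (v, B)" by force
      show ?thesis
      proof (cases "u \<le> v")
        case True
        have "\<exists>l''. cylinder_data l'' \<and> cylinder k \<inter> cylinder ((v - u, B) # k') = cylinder l''"
          using less.prems True by (intro less.hyps) (auto simp: Cons l' p p')
        then show ?thesis
          unfolding Cons l' p p' using less.prems by (intro step) (auto simp: Cons p)
      next
        case False
        have "\<exists>l''. cylinder_data l'' \<and> cylinder k' \<inter> cylinder ((u - v, A) # k) = cylinder l''"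
          using less.prems False by (intro less.hyps) (auto simp: Cons l' p p')
        then have "\<exists>l''. cylinder_data l'' \<and> cylinder ((v, B) # k') \<inter> cylinder ((u, A) # k) = cylinder l''"
          using less.prems by (intro step) (auto simp: l' p')
        then show ?thesis unfolding Cons l' p p' by (simp add: Int_commute)
      qed
    qed
  qed
qed

lemma cylinder_shift_sets:
  assumes "cylinder_data l" "0 \<le> t"
  shows "{w. continuous_on {0..} w \<and> (\<lambda>s. w (t + s)) \<in> cylinder l} \<in> sets path_space"
  using assms
proof (induction l arbitrary: t)
  case Nil
  have "space (path_space :: (real \<Rightarrow> 'a) measure) \<in> sets path_space" by (rule sets.top)
  then show ?case by simp
next
  case (Cons p l)
  obtain u A where p: "p = (u, A)" by force
  have [measurable]: "(\<lambda>w. w (t + u)) \<in> path_space \<rightarrow>\<^sub>M (borel :: 'a measure)"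
    using Cons.prems p by (intro measurable_path_coordinate) auto
  have [measurable]: "A \<in> sets borel" using Cons.prems p by simp
  have "{w\<in>space path_space. w (t + u) \<in> A} \<in> sets path_space" by measurable
  moreover have "{w. continuous_on {0..} w \<and> (\<lambda>s. w (t + u + s)) \<in> cylinder l} \<in> sets path_space"
    using Cons.prems p by (intro Cons.IH) auto
  ultimately have "{w\<in>space path_space. w (t + u) \<in> A} \<inter>
      {w. continuous_on {0..} w \<and> (\<lambda>s. w (t + u + s)) \<in> cylinder l} \<in> sets path_space"
    by (rule sets.Int)
  also have "{w\<in>space path_space. w (t + u) \<in> A} \<inter>
      {w. continuous_on {0..} w \<and> (\<lambda>s. w (t + u + s)) \<in> cylinder l} =
      {w. continuous_on {0..} w \<and> (\<lambda>s. w (t + s)) \<in> cylinder (p # l)}"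
    by (auto simp: p add.assoc)
  finally show ?case .
qed

lemma sets_path_space_cylinders:
  "sets (path_space :: (real \<Rightarrow> 'a::topological_space) measure) =
    sigma_sets {w. continuous_on {0..} w} {{w. continuous_on {0..} w} \<inter> cylinder l | l. cylinder_data l}"
  (is "_ = sigma_sets ?\<Omega> ?C")
proof
  show "sets path_space \<subseteq> sigma_sets ?\<Omega> ?C"
    unfolding sets_path_space
  proof (rule sigma_sets_mono, safe)
    fix t :: real and A :: "'a set" assume "0 \<le> t" "A \<in> sets borel"
    then have "?\<Omega> \<inter> cylinder [(t, A)] \<in> ?C" by (intro CollectI exI[of _ "[(t, A)]"]) simp
    then have "?\<Omega> \<inter> cylinder [(t, A)] \<in> sigma_sets ?\<Omega> ?C" by (rule sigma_sets.Basic)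
    then show "{w. continuous_on {0..} w \<and> w t \<in> A} \<in> sigma_sets ?\<Omega> ?C" by (simp add: Int_def)
  qed
  show "sigma_sets ?\<Omega> ?C \<subseteq> sets path_space"
  proof -
    have "?C \<subseteq> sets path_space"
    proof safe
      fix l :: "(real \<times> 'a set) list" assume "cylinder_data l"
      then show "?\<Omega> \<inter> cylinder l \<in> sets path_space"
        using cylinder_shift_sets[of l 0] by (simp add: Int_def)
    qed
    then show ?thesis using sets.sigma_sets_subset[of ?C path_space] by simp
  qed
qed

section \<open>From one-time distributions to path functionals\<close>

locale markov_process = continuous_process M Y
  for M :: "'w measure" and Y :: "real \<Rightarrow> 'w \<Rightarrow> 'a::metric_space" +
  fixes P :: "'a \<Rightarrow> 'w measure"
  assumes P_measurable: "P \<in> borel \<rightarrow>\<^sub>M prob_algebra M"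
    and markov: "markov_property M Y P"
begin

lemma prob_P: "prob_space (P x)" and sets_P [measurable_cong]: "sets (P x) = sets M"
  using measurable_space[OF P_measurable, of x] by (simp_all add: space_prob_algebra)

lemma space_P [simp]: "space (P x) = space M"
  using sets_eq_imp_space_eq[OF sets_P] .

lemma P_subprob [measurable]: "P \<in> borel \<rightarrow>\<^sub>M subprob_algebra M"
  using P_measurable by (rule measurable_prob_algebraD)

lemma space_natural_filtration [simp]: "space (natural_filtration M Y s) = space M"
  by (simp add: natural_filtration_def space_measure_of_conv)

lemma sets_natural_filtration: "sets (natural_filtration M Y s) =
    sigma_sets (space M) {Y u -` A \<inter> space M | u A. 0 \<le> u \<and> u \<le> s \<and> A \<in> sets borel}"
  unfolding natural_filtration_def by (rule sets_measure_of) auto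

lemma measurable_natural_filtration:
  "0 \<le> u \<Longrightarrow> u \<le> s \<Longrightarrow> Y u \<in> natural_filtration M Y s \<rightarrow>\<^sub>M borel"
  by (rule measurableI) (auto simp: sets_natural_filtration)

lemma natural_filtration_mono:
  "s \<le> t \<Longrightarrow> sets (natural_filtration M Y s) \<subseteq> sets (natural_filtration M Y t)"
  unfolding sets_natural_filtration by (intro sigma_sets_subseteq) force

lemma natural_filtration_subset: "sets (natural_filtration M Y s) \<subseteq> sets M"
  unfolding sets_natural_filtration
  using measurable_sets[OF Y_measurable] by (intro sets.sigma_sets_subset) auto

lemma nn_integral_P_measurable:
  "f \<in> borel_measurable M \<Longrightarrow> (\<lambda>x. \<integral>\<^sup>+\<omega>. f \<omega> \<partial>P x) \<in> borel_measurable borel"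
  by (rule measurable_compose[OF P_subprob nn_integral_measurable_subprob_algebra])

lemma markov_nn_integral:
  assumes f: "f \<in> borel_measurable borel" and s: "0 \<le> s" and t: "0 \<le> t"
    and B: "B \<in> sets (natural_filtration M Y s)"
  shows "(\<integral>\<^sup>+\<omega>. f (Y (s + t) \<omega>) * indicator B \<omega> \<partial>P x) =
    (\<integral>\<^sup>+\<omega>. (\<integral>\<^sup>+\<omega>'. f (Y t \<omega>') \<partial>P (Y s \<omega>)) * indicator B \<omega> \<partial>P x)"
proof -
  have BM [measurable]: "B \<in> sets M" using B natural_filtration_subset by auto
  have "0 \<le> s + t" using s t by simp
  note [measurable] = Y_measurable[OF s] Y_measurable[OF t] Y_measurable[OF this] nn_integral_P_measurable
  show ?thesis
    using f
  proof (induction rule: borel_measurable_induct)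
    case (cong f g)
    then show ?case by simp
  next
    case (set A)
    then have [measurable]: "A \<in> sets borel" .
    have "(\<integral>\<^sup>+\<omega>. indicator A (Y (s + t) \<omega>) * indicator B \<omega> \<partial>P x) = emeasure (P x) {\<omega>\<in>B. Y (s + t) \<omega> \<in> A}"
    proof -
      have "{\<omega>\<in>B. Y (s + t) \<omega> \<in> A} = B \<inter> {\<omega>\<in>space M. Y (s + t) \<omega> \<in> A}"
        using sets.sets_into_space[OF BM] by auto
      also have "\<dots> \<in> sets M" using BM by (intro sets.Int) measurable
      finally have "{\<omega>\<in>B. Y (s + t) \<omega> \<in> A} \<in> sets (P x)" by (simp add: sets_P)
      from nn_integral_indicator[OF this]
      have "emeasure (P x) {\<omega>\<in>B. Y (s + t) \<omega> \<in> A} = (\<integral>\<^sup>+\<omega>. indicator {\<omega>\<in>B. Y (s + t) \<omega> \<in> A} \<omega> \<partial>P x)" by simp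
      also have "\<dots> = (\<integral>\<^sup>+\<omega>. indicator A (Y (s + t) \<omega>) * indicator B \<omega> \<partial>P x)"
        by (intro nn_integral_cong) (auto simp: indicator_def)
      finally show ?thesis by simp
    qed
    also have "\<dots> = (\<integral>\<^sup>+\<omega>\<in>B. emeasure (P (Y s \<omega>)) {\<omega>'\<in>space M. Y t \<omega>' \<in> A} \<partial>P x)"
      using markov s t B set by (simp add: markov_property_def)
    also have "\<dots> = (\<integral>\<^sup>+\<omega>. (\<integral>\<^sup>+\<omega>'. indicator A (Y t \<omega>') \<partial>P (Y s \<omega>)) * indicator B \<omega> \<partial>P x)"
    proof (intro nn_integral_cong arg_cong2[where f="(*)"] refl)
      fix y
      have "{\<omega>'\<in>space M. Y t \<omega>' \<in> A} \<in> sets (P y)" unfolding sets_P by measurable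
      from nn_integral_indicator[OF this]
      have "emeasure (P y) {\<omega>'\<in>space M. Y t \<omega>' \<in> A} = (\<integral>\<^sup>+\<omega>'. indicator {\<omega>'\<in>space M. Y t \<omega>' \<in> A} \<omega>' \<partial>P y)" by simp
      also have "\<dots> = (\<integral>\<^sup>+\<omega>'. indicator A (Y t \<omega>') \<partial>P y)"
        by (intro nn_integral_cong) (simp add: indicator_def)
      finally show "emeasure (P y) {\<omega>'\<in>space M. Y t \<omega>' \<in> A} = (\<integral>\<^sup>+\<omega>'. indicator A (Y t \<omega>') \<partial>P y)" .
    qed
    finally show ?case .
  next
    case (mult f c)
    then show ?case using s t by (simp add: nn_integral_cmult mult.assoc)
  next
    case (add f g)
    then show ?case using s t by (simp add: nn_integral_add distrib_right)
  next
    case (seq f)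
    have sup: "(SUP i. f i y) * c = (SUP i. f i y * c)" for y and c :: ennreal
      by (simp add: SUP_mult_right_ennreal)
    have mono: "incseq (\<lambda>i. f i y)" for y using seq(3) by (auto simp: incseq_def le_fun_def)
    have "(\<integral>\<^sup>+\<omega>. (SUP i. f i) (Y (s + t) \<omega>) * indicator B \<omega> \<partial>P x) =
        (SUP i. \<integral>\<^sup>+\<omega>. f i (Y (s + t) \<omega>) * indicator B \<omega> \<partial>P x)"
      unfolding SUP_apply sup using s t seq(1,3)
      by (intro nn_integral_monotone_convergence_SUP) (auto simp: incseq_def le_fun_def intro!: mult_right_mono)
    also have "\<dots> = (SUP i. \<integral>\<^sup>+\<omega>. (\<integral>\<^sup>+\<omega>'. f i (Y t \<omega>') \<partial>P (Y s \<omega>)) * indicator B \<omega> \<partial>P x)"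
      using seq.IH by simp
    also have "\<dots> = (\<integral>\<^sup>+\<omega>. (SUP i. (\<integral>\<^sup>+\<omega>'. f i (Y t \<omega>') \<partial>P (Y s \<omega>)) * indicator B \<omega>) \<partial>P x)"
      using s t seq(1,3)
      by (intro nn_integral_monotone_convergence_SUP[symmetric])
         (auto simp: incseq_def le_fun_def intro!: mult_right_mono nn_integral_mono)
    also have "\<dots> = (\<integral>\<^sup>+\<omega>. (\<integral>\<^sup>+\<omega>'. (SUP i. f i) (Y t \<omega>') \<partial>P (Y s \<omega>)) * indicator B \<omega> \<partial>P x)"
    proof (intro nn_integral_cong)
      fix \<omega>
      have "(\<integral>\<^sup>+\<omega>'. (SUP i. f i) (Y t \<omega>') \<partial>P (Y s \<omega>)) = (SUP i. \<integral>\<^sup>+\<omega>'. f i (Y t \<omega>') \<partial>P (Y s \<omega>))"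
        unfolding SUP_apply using s t seq(1,3)
        by (intro nn_integral_monotone_convergence_SUP) (auto simp: incseq_def le_fun_def)
      then show "(SUP i. (\<integral>\<^sup>+\<omega>'. f i (Y t \<omega>') \<partial>P (Y s \<omega>)) * indicator B \<omega>) =
          (\<integral>\<^sup>+\<omega>'. (SUP i. f i) (Y t \<omega>') \<partial>P (Y s \<omega>)) * indicator B \<omega>"
        by (simp add: SUP_mult_right_ennreal)
    qed
    finally show ?case .
  qed
qed

lemma path_measurable: "0 \<le> s \<Longrightarrow> (\<lambda>\<omega> u. Y (s + u) \<omega>) \<in> M \<rightarrow>\<^sub>M path_space"
proof (rule measurable_path_spaceI)
  fix \<omega> assume "\<omega> \<in> space M" "0 \<le> s"
  then show "continuous_on {0..} (\<lambda>u. Y (s + u) \<omega>)"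
    by (intro continuous_on_compose2[OF Y_continuous]) (auto intro!: continuous_intros)
qed (simp add: Y_measurable)

lemma path_measurable_0: "(\<lambda>\<omega> u. Y u \<omega>) \<in> M \<rightarrow>\<^sub>M path_space"
  using path_measurable[of 0] by simp

text \<open>The first condition is moved into the event: it belongs to the filtration at time
  \<open>s + u\<close>, where the induction hypothesis handles the rest. The resulting function of
  \<open>Y (s + u)\<close> is then brought back to time \<open>s\<close> by the one-time Markov
  property. Recording increments in cylinders makes the remaining list again a cylinder for the path
  after \<open>s + u\<close>.\<close>

lemma markov_cylinder:
  assumes "cylinder_data l" "0 \<le> s" "B \<in> sets (natural_filtration M Y s)"
  shows "emeasure (P x) {\<omega>\<in>B. (\<lambda>u. Y (s + u) \<omega>) \<in> cylinder l} =
    (\<integral>\<^sup>+\<omega>. emeasure (P (Y s \<omega>)) {\<omega>'\<in>space M. (\<lambda>u. Y u \<omega>') \<in> cylinder l} * indicator B \<omega> \<partial>P x)"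
  using assms
proof (induction l arbitrary: s B x)
  case Nil
  have [measurable]: "B \<in> sets M" using Nil natural_filtration_subset by auto
  have "emeasure (P y) (space M) = 1" for y
    using prob_space.emeasure_space_1[OF prob_P, of y] by simp
  then show ?case using sets_P by simp
next
  case (Cons p l)
  obtain u A where p: "p = (u, A)" by force
  have u: "0 \<le> u" and A [measurable]: "A \<in> sets borel" and l: "cylinder_data l"
    using Cons.prems p by auto
  define q where "q y = emeasure (P y) {\<omega>\<in>space M. (\<lambda>u. Y u \<omega>) \<in> cylinder l}" for y
  have q [measurable]: "q \<in> borel_measurable borel"
  proof -
    have "(\<lambda>\<omega> u. Y u \<omega>) -` {w. continuous_on {0..} w \<and> (\<lambda>s. w (0 + s)) \<in> cylinder l} \<inter> space M \<in> sets M"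
      by (rule measurable_sets[OF path_measurable_0 cylinder_shift_sets[OF l]]) simp
    also have "(\<lambda>\<omega> u. Y u \<omega>) -` {w. continuous_on {0..} w \<and> (\<lambda>s. w (0 + s)) \<in> cylinder l} \<inter> space M =
        {\<omega>\<in>space M. (\<lambda>u. Y u \<omega>) \<in> cylinder l}"
      using Y_continuous by auto
    finally have [measurable]: "{\<omega>\<in>space M. (\<lambda>u. Y u \<omega>) \<in> cylinder l} \<in> sets M" .
    show ?thesis unfolding q_def by measurable
  qed
  \<comment> \<open>Used twice: for the given \<open>s\<close> and \<open>B\<close>, and at time 0
    with the whole space, which evaluates the inner probability for a fresh start.\<close>
  have step: "emeasure (P x) {\<omega>\<in>B. (\<lambda>v. Y (s + v) \<omega>) \<in> cylinder (p # l)} =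
      (\<integral>\<^sup>+\<omega>. (q (Y (s + u) \<omega>) * indicator A (Y (s + u) \<omega>)) * indicator B \<omega> \<partial>P x)"
    if s: "0 \<le> s" and B: "B \<in> sets (natural_filtration M Y s)" for s B x
  proof -
    define B' where "B' = B \<inter> (Y (s + u) -` A \<inter> space M)"
    have "Y (s + u) -` A \<inter> space M \<in> sets (natural_filtration M Y (s + u))"
      using measurable_sets[OF measurable_natural_filtration A, of "s + u" "s + u"] s u by simp
    then have B': "B' \<in> sets (natural_filtration M Y (s + u))"
      unfolding B'_def using B natural_filtration_mono[of s "s + u"] u by auto
    have "{\<omega>\<in>B. (\<lambda>v. Y (s + v) \<omega>) \<in> cylinder (p # l)} = {\<omega>\<in>B'. (\<lambda>v. Y (s + u + v) \<omega>) \<in> cylinder l}"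
      using sets.sets_into_space[OF B] by (auto simp: B'_def p add.assoc)
    then have "emeasure (P x) {\<omega>\<in>B. (\<lambda>v. Y (s + v) \<omega>) \<in> cylinder (p # l)} =
        (\<integral>\<^sup>+\<omega>. q (Y (s + u) \<omega>) * indicator B' \<omega> \<partial>P x)"
      using Cons.IH[OF l _ B'] s u by (simp add: q_def)
    also have "\<dots> = (\<integral>\<^sup>+\<omega>. (q (Y (s + u) \<omega>) * indicator A (Y (s + u) \<omega>)) * indicator B \<omega> \<partial>P x)"
      by (intro nn_integral_cong) (auto simp: B'_def indicator_def)
    finally show ?thesis .
  qed
  have "emeasure (P x) {\<omega>\<in>B. (\<lambda>v. Y (s + v) \<omega>) \<in> cylinder (p # l)} =
      (\<integral>\<^sup>+\<omega>. (q (Y (s + u) \<omega>) * indicator A (Y (s + u) \<omega>)) * indicator B \<omega> \<partial>P x)"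
    by (rule step[OF Cons.prems(2,3)])
  also have "\<dots> = (\<integral>\<^sup>+\<omega>. (\<integral>\<^sup>+\<omega>'. q (Y u \<omega>') * indicator A (Y u \<omega>') \<partial>P (Y s \<omega>)) * indicator B \<omega> \<partial>P x)"
    by (rule markov_nn_integral[OF _ Cons.prems(2) u Cons.prems(3)]) measurable
  also have "\<dots> = (\<integral>\<^sup>+\<omega>. emeasure (P (Y s \<omega>)) {\<omega>'\<in>space M. (\<lambda>u. Y u \<omega>') \<in> cylinder (p # l)} * indicator B \<omega> \<partial>P x)"
  proof (intro nn_integral_cong arg_cong2[where f="(*)"] refl)
    fix y
    have "space M \<in> sets (natural_filtration M Y 0)"
      using sets.top[of "natural_filtration M Y 0"] by simp
    from step[OF order_refl this, of y]
    have "emeasure (P y) {\<omega>'\<in>space M. (\<lambda>u. Y u \<omega>') \<in> cylinder (p # l)} =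
        (\<integral>\<^sup>+\<omega>'. q (Y u \<omega>') * indicator A (Y u \<omega>') * indicator (space M) \<omega>' \<partial>P y)" by simp
    also have "\<dots> = (\<integral>\<^sup>+\<omega>'. q (Y u \<omega>') * indicator A (Y u \<omega>') \<partial>P y)"
      by (intro nn_integral_cong) simp
    finally show "(\<integral>\<^sup>+\<omega>'. q (Y u \<omega>') * indicator A (Y u \<omega>') \<partial>P y) =
        emeasure (P y) {\<omega>'\<in>space M. (\<lambda>u. Y u \<omega>') \<in> cylinder (p # l)}" by simp
  qed
  finally show ?case .
qed

text \<open>Cylinders are stable under intersection, contain the whole path space and generate its
  sigma-algebra, so two finite measures that agree on them coincide; \<open>G\<close> is then
  integrated against this common measure.\<close>

theorem markov_path:
  fixes G :: "(real \<Rightarrow> 'a) \<Rightarrow> ennreal"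
  assumes G: "G \<in> borel_measurable path_space" and s: "0 \<le> s"
    and B: "B \<in> sets (natural_filtration M Y s)"
  shows "(\<integral>\<^sup>+\<omega>. G (\<lambda>u. Y (s + u) \<omega>) * indicator B \<omega> \<partial>P x) =
    (\<integral>\<^sup>+\<omega>. (\<integral>\<^sup>+\<omega>'. G (\<lambda>u. Y u \<omega>') \<partial>P (Y s \<omega>)) * indicator B \<omega> \<partial>P x)"
proof -
  have BM [measurable]: "B \<in> sets M" using B natural_filtration_subset by auto
  note [measurable] = path_measurable[OF s] path_measurable_0 Y_measurable[OF s] G
  \<comment> \<open>\<open>?B\<close> is \<open>P x\<close> confined to the event. Under it,
    \<open>\<mu>1\<close> is the law of the actual path after \<open>s\<close>, and
    \<open>\<mu>2\<close> that of a fresh path started from \<open>Y s\<close>.\<close>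
  let ?B = "density (P x) (indicator B)"
  let ?\<Omega> = "{w :: real \<Rightarrow> 'a. continuous_on {0..} w}"
  let ?C = "{?\<Omega> \<inter> cylinder l | l. cylinder_data l}"
  define \<mu>1 where "\<mu>1 = distr ?B path_space (\<lambda>\<omega> u. Y (s + u) \<omega>)"
  define K where "K \<omega> = distr (P (Y s \<omega>)) path_space (\<lambda>\<omega>' u. Y u \<omega>')" for \<omega>
  define \<mu>2 where "\<mu>2 = ?B \<bind> K"
  have K [measurable]: "K \<in> ?B \<rightarrow>\<^sub>M subprob_algebra path_space"
  proof -
    have "K \<in> M \<rightarrow>\<^sub>M subprob_algebra path_space"
      unfolding K_def
      by (rule measurable_compose[OF Y_measurable[OF s]
            measurable_compose[OF P_subprob measurable_distr[OF path_measurable_0]]])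
    then show ?thesis by (simp add: measurable_cong_sets[OF sets_P refl])
  qed
  have ne: "space ?B \<noteq> {}" using prob_space.not_empty[OF prob_P, of x] by simp
  have m1: "(\<lambda>\<omega> u. Y (s + u) \<omega>) \<in> ?B \<rightarrow>\<^sub>M path_space" by measurable
  have e1: "emeasure \<mu>1 E = emeasure (P x) {\<omega>\<in>B. (\<lambda>u. Y (s + u) \<omega>) \<in> E}" if "E \<in> sets path_space" for E
  proof -
    have "emeasure \<mu>1 E = emeasure ?B ((\<lambda>\<omega> u. Y (s + u) \<omega>) -` E \<inter> space M)"
      unfolding \<mu>1_def using emeasure_distr[OF m1 that] by simp
    also have "\<dots> = emeasure (P x) (B \<inter> ((\<lambda>\<omega> u. Y (s + u) \<omega>) -` E \<inter> space M))"
      using measurable_sets[OF path_measurable[OF s] that] BM sets_P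
      by (subst emeasure_density) (auto simp: indicator_inter_arith[symmetric])
    also have "B \<inter> ((\<lambda>\<omega> u. Y (s + u) \<omega>) -` E \<inter> space M) = {\<omega>\<in>B. (\<lambda>u. Y (s + u) \<omega>) \<in> E}"
      using sets.sets_into_space[OF BM] by auto
    finally show ?thesis .
  qed
  have eq: "\<mu>1 = \<mu>2"
  proof (rule measure_eqI_generator_eq[where E="?C" and \<Omega>="?\<Omega>" and A="\<lambda>_. ?\<Omega>"])
    show "Int_stable ?C"
    proof (rule Int_stableI)
      fix a b assume "a \<in> ?C" "b \<in> ?C"
      then obtain l l' where "cylinder_data l" "cylinder_data l'" "a = ?\<Omega> \<inter> cylinder l" "b = ?\<Omega> \<inter> cylinder l'"
        by auto
      moreover obtain l'' where "cylinder_data l''" "cylinder l \<inter> cylinder l' = cylinder l''"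
        using cylinder_Int calculation(1,2) by metis
      ultimately have "a \<inter> b = ?\<Omega> \<inter> cylinder l''" "cylinder_data l''" by auto
      then show "a \<inter> b \<in> ?C" by auto
    qed
    show "?C \<subseteq> Pow ?\<Omega>" by auto
    show "sets \<mu>1 = sigma_sets ?\<Omega> ?C" by (simp add: \<mu>1_def sets_path_space_cylinders)
    show "sets \<mu>2 = sigma_sets ?\<Omega> ?C"
      unfolding \<mu>2_def sets_path_space_cylinders[symmetric]
      by (rule sets_bind[OF _ ne]) (simp add: K_def)
    have "?\<Omega> = ?\<Omega> \<inter> cylinder []" by simp
    then show "range (\<lambda>_. ?\<Omega>) \<subseteq> ?C" by (force intro!: exI[of _ "[]"])
    show "emeasure \<mu>1 ?\<Omega> \<noteq> \<infinity>" for i :: nat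
    proof -
      interpret prob_space "P x" by (rule prob_P)
      have "?\<Omega> \<in> sets path_space" using sets.top[of path_space] by simp
      from e1[OF this] show ?thesis by simp
    qed
  next
    fix E assume "E \<in> ?C"
    then obtain l where l: "cylinder_data l" and E: "E = ?\<Omega> \<inter> cylinder l" by auto
    have E_sets [measurable]: "E \<in> sets path_space" using cylinder_shift_sets[OF l, of 0] by (simp add: E Int_def)
    have "emeasure \<mu>1 E = emeasure (P x) {\<omega>\<in>B. (\<lambda>u. Y (s + u) \<omega>) \<in> cylinder l}"
    proof -
      have "continuous_on {0..} (\<lambda>u. Y (s + u) \<omega>)" if "\<omega> \<in> B" for \<omega>
        using measurable_space[OF path_measurable[OF s]] sets.sets_into_space[OF BM] that by auto
      then have "{\<omega>\<in>B. (\<lambda>u. Y (s + u) \<omega>) \<in> E} = {\<omega>\<in>B. (\<lambda>u. Y (s + u) \<omega>) \<in> cylinder l}"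
        by (auto simp: E)
      then show ?thesis using e1[OF E_sets] by simp
    qed
    also have "\<dots> = (\<integral>\<^sup>+\<omega>. emeasure (P (Y s \<omega>)) {\<omega>'\<in>space M. (\<lambda>u. Y u \<omega>') \<in> cylinder l} * indicator B \<omega> \<partial>P x)"
      by (rule markov_cylinder[OF l s B])
    also have "\<dots> = (\<integral>\<^sup>+\<omega>. emeasure (K \<omega>) E * indicator B \<omega> \<partial>P x)"
    proof (intro nn_integral_cong arg_cong2[where f="(*)"] refl)
      fix \<omega>
      have "emeasure (K \<omega>) E = emeasure (P (Y s \<omega>)) ((\<lambda>\<omega>' u. Y u \<omega>') -` E \<inter> space M)"
        unfolding K_def by (subst emeasure_distr) auto
      also have "(\<lambda>\<omega>' u. Y u \<omega>') -` E \<inter> space M = {\<omega>'\<in>space M. (\<lambda>u. Y u \<omega>') \<in> cylinder l}"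
        using Y_continuous by (auto simp: E)
      finally show "emeasure (P (Y s \<omega>)) {\<omega>'\<in>space M. (\<lambda>u. Y u \<omega>') \<in> cylinder l} = emeasure (K \<omega>) E" by simp
    qed
    also have "\<dots> = (\<integral>\<^sup>+\<omega>. emeasure (K \<omega>) E \<partial>?B)"
    proof -
      have "(\<lambda>\<omega>. emeasure (K \<omega>) E) \<in> borel_measurable (P x)"
        using measurable_emeasure_kernel[OF K E_sets] by simp
      then show ?thesis by (subst nn_integral_density) (auto simp: mult.commute)
    qed
    also have "\<dots> = emeasure \<mu>2 E"
      unfolding \<mu>2_def by (rule emeasure_bind[OF ne K E_sets, symmetric])
    finally show "emeasure \<mu>1 E = emeasure \<mu>2 E" .
  qed auto
  have GM: "(\<lambda>\<omega>. G (\<lambda>u. Y (s + u) \<omega>)) \<in> borel_measurable (P x)" by measurable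
  have "(\<integral>\<^sup>+\<omega>. G (\<lambda>u. Y (s + u) \<omega>) * indicator B \<omega> \<partial>P x) = (\<integral>\<^sup>+w. G w \<partial>\<mu>1)"
    unfolding \<mu>1_def using GM G
    by (subst nn_integral_distr[OF m1], simp, subst nn_integral_density) (auto simp: mult.commute)
  also have "\<dots> = (\<integral>\<^sup>+\<omega>. (\<integral>\<^sup>+w. G w \<partial>K \<omega>) \<partial>?B)"
    unfolding eq \<mu>2_def by (rule nn_integral_bind[OF G K])
  also have "\<dots> = (\<integral>\<^sup>+\<omega>. (\<integral>\<^sup>+\<omega>'. G (\<lambda>u. Y u \<omega>') \<partial>P (Y s \<omega>)) \<partial>?B)"
    unfolding K_def by (intro nn_integral_cong nn_integral_distr) measurable
  also have "\<dots> = (\<integral>\<^sup>+\<omega>. (\<integral>\<^sup>+\<omega>'. G (\<lambda>u. Y u \<omega>') \<partial>P (Y s \<omega>)) * indicator B \<omega> \<partial>P x)"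
  proof -
    have "(\<lambda>\<omega>. \<integral>\<^sup>+\<omega>'. G (\<lambda>u. Y u \<omega>') \<partial>P (Y s \<omega>)) \<in> borel_measurable (P x)"
      by (rule measurable_compose[OF _ nn_integral_P_measurable]) measurable
    then show ?thesis by (subst nn_integral_density) (auto simp: mult.commute)
  qed
  finally show ?thesis .
qed

end

section \<open>The absorbed diffusion\<close>

text \<open>A functional of the path alone, so that the path form of the Markov property applies.
  Paths that never exit get 0, in agreement with \<open>exit_law\<close>, which carries only finite
  exits.\<close>

definition exit_value :: "'a set \<Rightarrow> ('a \<Rightarrow> ennreal) \<Rightarrow> (real \<Rightarrow> 'a) \<Rightarrow> ennreal" where
  "exit_value S k w = (if hitting_time S w < \<infinity> then k (w (real_of_ereal (hitting_time S w))) else 0)"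

text \<open>If the path first hits at \<open>r\<close>, the path shifted by \<open>t < r\<close>
  first hits at \<open>r - t\<close>, in the same point; a path that never hits still does not after
  a shift.\<close>

lemma exit_value_shift:
  fixes w :: "real \<Rightarrow> 'a::topological_space"
  assumes S: "closed S" and w: "continuous_on {0..} w" and t: "0 \<le> t" "ereal t < hitting_time S w"
  shows "exit_value S k (\<lambda>u. w (t + u)) = exit_value S k w"
proof (cases "hitting_time S w < \<infinity>")
  case True
  then obtain r where r: "0 \<le> r" "hitting_time S w = ereal r" "w r \<in> S"
    using hitting_time_attained[OF S w] by metis
  have "t < r" using t(2) r(2) by simp
  have "hitting_time S (\<lambda>u. w (t + u)) = ereal (r - t)"
  proof (rule antisym)
    show "hitting_time S (\<lambda>u. w (t + u)) \<le> ereal (r - t)"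
      using r \<open>t < r\<close> by (intro hitting_time_le) auto
    show "ereal (r - t) \<le> hitting_time S (\<lambda>u. w (t + u))"
    proof (rule hitting_time_greatest)
      fix s assume "0 \<le> s" "w (t + s) \<in> S"
      then have "ereal r \<le> ereal (t + s)"
        using hitting_time_le[of "t + s" w S] t(1) r(2) by simp
      then show "ereal (r - t) \<le> ereal s" by simp
    qed
  qed
  then show ?thesis using r by (simp add: exit_value_def)
next
  case False
  have "\<not> hitting_time S (\<lambda>u. w (t + u)) < \<infinity>"
  proof
    assume "hitting_time S (\<lambda>u. w (t + u)) < \<infinity>"
    moreover have "continuous_on {0..} (\<lambda>u. w (t + u))"
      using t(1) by (intro continuous_on_compose2[OF w]) (auto intro!: continuous_intros)
    ultimately obtain s where "0 \<le> s" "w (t + s) \<in> S" using hitting_time_attained[OF S] by metis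
    then have "hitting_time S w \<le> ereal (t + s)" using t(1) by (intro hitting_time_le) auto
    also have "\<dots> < \<infinity>" by simp
    finally show False using False by simp
  qed
  then show ?thesis using False by (simp add: exit_value_def)
qed

lemma (in continuous_process) measurable_exit_value:
  assumes S: "closed S" "S \<noteq> {}" and k: "k \<in> borel_measurable borel"
  shows "(\<lambda>\<omega>. exit_value S k (\<lambda>u. Y u \<omega>)) \<in> borel_measurable M"
proof -
  note [measurable] = measurable_hitting_time[OF S] measurable_at_hitting_time[OF S] k
  show ?thesis unfolding exit_value_def by measurable
qed

text \<open>The coordinates on \<open>path_space\<close> themselves form a continuous process, to
  which the result for processes applies.\<close>

lemma measurable_exit_value_path_space:
  fixes S :: "'a::metric_space set"
  assumes S: "closed S" "S \<noteq> {}" and k: "k \<in> borel_measurable borel"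
  shows "exit_value S k \<in> borel_measurable path_space"
proof -
  interpret continuous_process path_space "\<lambda>t w. w t :: 'a"
    by standard (auto intro: measurable_path_coordinate)
  show ?thesis using measurable_exit_value[OF assms] by simp
qed

section \<open>Mean exit values of the absorbed diffusion\<close>

locale absorbed_diffusion = markov_process M Y P
  for M :: "'w measure" and Y :: "real \<Rightarrow> 'w \<Rightarrow> 'a::metric_space" and P :: "'a \<Rightarrow> 'w measure" +
  fixes D :: "'a set" and lam :: "'a \<Rightarrow> real" and C :: real
  assumes D_open: "open D" and D_nonempty: "D \<noteq> {}" and D_frontier: "frontier D \<noteq> {}"
    and start: "\<And>x. AE \<omega> in P x. Y 0 \<omega> = x"
    and absorption: "\<And>x. x \<in> D \<Longrightarrow> AE \<omega> in P x. absorption_time D Y \<omega> < \<infinity>"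
    and lam_measurable: "lam \<in> borel_measurable (restrict_space borel (frontier D))"
    and lam_bounds: "\<And>y. y \<in> frontier D \<Longrightarrow> 0 \<le> lam y \<and> lam y \<le> C"
begin

abbreviation X :: "real \<Rightarrow> 'w \<Rightarrow> 'a" where
  "X \<equiv> absorbed D Y"

abbreviation \<tau> :: "'w \<Rightarrow> ereal" where
  "\<tau> \<omega> \<equiv> hitting_time (frontier D) (\<lambda>s. Y s \<omega>)"

text \<open>\<open>lam\<close> is controlled on the frontier only; extended by 0 it becomes a
  bounded Borel function on the whole space.\<close>

definition lam0 :: "'a \<Rightarrow> ennreal" where
  "lam0 y = (if y \<in> frontier D then ennreal (lam y) else 0)"

text \<open>For real \<open>T\<close> the density of the reservoir intensity, for
  \<open>T = \<infinity>\<close> the function h. In the latter case the indicator keeps all paths,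
  but \<open>exit_value\<close> vanishes on those that never exit.\<close>

definition exit_mean :: "ereal \<Rightarrow> 'a \<Rightarrow> ennreal" where
  "exit_mean T x = (\<integral>\<^sup>+\<omega>. exit_value (frontier D) lam0 (\<lambda>u. Y u \<omega>) * indicator {\<omega>. \<tau> \<omega> \<le> T} \<omega> \<partial>P x)"

lemma D_borel [measurable]: "D \<in> sets borel"
  using D_open by simp

lemma lam0_measurable [measurable]: "lam0 \<in> borel_measurable borel"
proof -
  have F: "frontier D \<in> sets borel" by (simp add: borel_closed frontier_closed)
  have "(\<lambda>y. ennreal (lam y)) \<in> borel_measurable (restrict_space borel (frontier D))"
    using lam_measurable by measurable
  then show ?thesis
    unfolding lam0_def[abs_def]
    by (subst measurable_If_restrict_space_iff) (use F in \<open>auto simp: pred_def\<close>)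
qed

lemma lam0_le: "lam0 y \<le> ennreal C"
  using lam_bounds by (auto simp: lam0_def intro: ennreal_leI)

lemma exit_value_le: "exit_value (frontier D) lam0 w \<le> ennreal C"
  by (simp add: exit_value_def lam0_le)

lemma measurable_tau [measurable]: "\<tau> \<in> borel_measurable M"
  by (rule measurable_hitting_time[OF frontier_closed D_frontier])

lemma measurable_exit_value_Y [measurable]:
  "(\<lambda>\<omega>. exit_value (frontier D) lam0 (\<lambda>u. Y u \<omega>)) \<in> borel_measurable M"
  by (rule measurable_exit_value[OF frontier_closed D_frontier lam0_measurable])

lemma exit_mean_measurable [measurable]: "exit_mean T \<in> borel_measurable borel"
  unfolding exit_mean_def[abs_def] by (rule nn_integral_P_measurable) measurable

lemma exit_mean_le: "exit_mean T x \<le> ennreal C"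
proof -
  interpret prob_space "P x" by (rule prob_P)
  have "exit_mean T x \<le> (\<integral>\<^sup>+\<omega>. ennreal C \<partial>P x)"
    unfolding exit_mean_def
    by (intro nn_integral_mono) (auto simp: exit_value_le indicator_def)
  also have "\<dots> = ennreal C" using emeasure_space_1 by simp
  finally show ?thesis .
qed

text \<open>Trades the image of a restricted measure for a single integral over \<open>P x\<close>,
  in which different time horizons can be compared and the Markov property used.\<close>

lemma nn_integral_exit_law: "(\<integral>\<^sup>+y. ennreal (lam y) \<partial>exit_law D Y P T x) = exit_mean T x"
proof -
  define E where "E = {\<omega>\<in>space (P x). absorption_time D Y \<omega> \<le> T \<and> absorption_time D Y \<omega> < \<infinity>}"
  let ?f = "\<lambda>\<omega>. absorbed D Y (real_of_ereal (absorption_time D Y \<omega>)) \<omega>"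
  have E_eq: "E = {\<omega>\<in>space M. \<tau> \<omega> \<le> T \<and> \<tau> \<omega> < \<infinity>}"
    by (auto simp: E_def absorption_time_eq)
  have E [measurable]: "E \<in> sets M" unfolding E_eq by measurable
  then have E': "E \<inter> space (P x) \<in> sets (P x)" by (simp add: sets_P)
  have sp: "space (restrict_space (P x) E) = E" using sets.sets_into_space[OF E] by (auto simp: space_restrict_space)
  have f_eq: "?f \<omega> = Y (real_of_ereal (\<tau> \<omega>)) \<omega>" if "\<omega> \<in> E" for \<omega>
    using absorbed_at_absorption_time that by (simp add: E_eq)
  have front: "Y (real_of_ereal (\<tau> \<omega>)) \<omega> \<in> frontier D" if "\<omega> \<in> E" for \<omega>
  proof -
    have "\<omega> \<in> space M" "\<tau> \<omega> < \<infinity>" using that by (auto simp: E_eq)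
    then obtain s where "\<tau> \<omega> = ereal s" "Y s \<omega> \<in> frontier D"
      using hitting_time_attained[OF frontier_closed Y_continuous] by metis
    then show ?thesis by simp
  qed
  have f: "?f \<in> restrict_space (P x) E \<rightarrow>\<^sub>M restrict_space borel (frontier D)"
  proof (rule measurable_restrict_space2)
    show "?f \<in> space (restrict_space (P x) E) \<rightarrow> frontier D" using f_eq front sp by auto
    have "(\<lambda>\<omega>. Y (real_of_ereal (\<tau> \<omega>)) \<omega>) \<in> restrict_space (P x) E \<rightarrow>\<^sub>M borel"
      using measurable_at_hitting_time[OF frontier_closed D_frontier]
      by (intro measurable_restrict_space1) (simp add: measurable_cong_sets[OF sets_P refl])
    then show "?f \<in> restrict_space (P x) E \<rightarrow>\<^sub>M borel"
      by (rule measurable_cong[THEN iffD1, rotated]) (use f_eq sp in auto)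
  qed
  have "(\<integral>\<^sup>+y. ennreal (lam y) \<partial>exit_law D Y P T x) = (\<integral>\<^sup>+\<omega>. ennreal (lam (?f \<omega>)) \<partial>restrict_space (P x) E)"
    unfolding exit_law_def E_def[symmetric]
    by (rule nn_integral_distr[OF f]) (use lam_measurable in measurable)
  also have "\<dots> = (\<integral>\<^sup>+\<omega>. ennreal (lam (?f \<omega>)) * indicator E \<omega> \<partial>P x)"
    by (rule nn_integral_restrict_space[OF E'])
  also have "\<dots> = exit_mean T x"
    unfolding exit_mean_def
  proof (rule nn_integral_cong)
    fix \<omega> assume "\<omega> \<in> space (P x)"
    then have "\<omega> \<in> space M" by simp
    then show "ennreal (lam (?f \<omega>)) * indicator E \<omega> =
        exit_value (frontier D) lam0 (\<lambda>u. Y u \<omega>) * indicator {\<omega>. \<tau> \<omega> \<le> T} \<omega>"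
      using f_eq[of \<omega>] front[of \<omega>]
      by (auto simp: exit_value_def lam0_def indicator_def E_eq)
  qed
  finally show ?thesis .
qed

lemma measurable_X [measurable]: "0 \<le> t \<Longrightarrow> X t \<in> M \<rightarrow>\<^sub>M borel"
  by (rule measurable_absorbed[OF D_frontier])

lemma X_mem_D_iff:
  "\<omega> \<in> space M \<Longrightarrow> 0 \<le> t \<Longrightarrow> X t \<omega> \<in> D \<longleftrightarrow> ereal t < \<tau> \<omega> \<and> Y t \<omega> \<in> D"
  using absorbed_mem_iff[OF _ D_open] .

text \<open>The Markov property at time \<open>t\<close>, applied to the exit value of the path after \<open>t\<close>.\<close>

lemma exit_mean_split:
  assumes y: "y \<in> D" and t: "0 \<le> t"
  shows "exit_mean \<infinity> y =
    (\<integral>\<^sup>+\<omega>. exit_mean \<infinity> (X t \<omega>) * indicator D (X t \<omega>) \<partial>P y) + exit_mean (ereal t) y"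
proof -
  let ?G = "exit_value (frontier D) lam0"
  \<comment> \<open>Alive at time \<open>t\<close>. Up to the condition
    \<open>Y t \<omega> \<in> D\<close> this is the complement of a hit by time \<open>t\<close>,
    hence an event of the natural filtration at \<open>t\<close>.\<close>
  define B where "B = {\<omega>\<in>space M. ereal t < \<tau> \<omega> \<and> Y t \<omega> \<in> D}"
  have "{\<omega>\<in>space (natural_filtration M Y t). \<tau> \<omega> \<le> ereal t} \<in> sets (natural_filtration M Y t)"
    using Y_continuous measurable_natural_filtration
    by (intro hitting_time_le_sets[OF frontier_closed D_frontier t]) auto
  moreover have "Y t -` D \<inter> space M \<in> sets (natural_filtration M Y t)"
    using measurable_sets[OF measurable_natural_filtration[OF t order_refl] D_borel] by simp
  moreover have "B = (Y t -` D \<inter> space M) - {\<omega>\<in>space (natural_filtration M Y t). \<tau> \<omega> \<le> ereal t}"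
    by (auto simp: B_def)
  ultimately have B: "B \<in> sets (natural_filtration M Y t)" by auto
  have BM [measurable]: "B \<in> sets M" using B natural_filtration_subset by auto
  note [measurable] = Y_measurable[OF t] measurable_X[OF t]
  have h: "exit_mean \<infinity> z = (\<integral>\<^sup>+\<omega>. ?G (\<lambda>u. Y u \<omega>) \<partial>P z)" for z
    by (simp add: exit_mean_def)
  have "AE \<omega> in P y. ?G (\<lambda>u. Y u \<omega>) = ?G (\<lambda>u. Y (t + u) \<omega>) * indicator B \<omega> +
      ?G (\<lambda>u. Y u \<omega>) * indicator {\<omega>. \<tau> \<omega> \<le> ereal t} \<omega>"
    using start[of y] AE_space
  proof eventually_elim
    case (elim \<omega>)
    then have \<omega>: "\<omega> \<in> space M" by simp
    show ?case
    proof (cases "ereal t < \<tau> \<omega>")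
      case True
      then have "Y t \<omega> \<in> D"
        using before_hitting_frontier[OF Y_continuous[OF \<omega>] _ t] elim(1) y by simp
      then have "\<omega> \<in> B" using True \<omega> by (simp add: B_def)
      then show ?thesis
        using exit_value_shift[OF frontier_closed Y_continuous[OF \<omega>] t True, of lam0] True
        by (simp add: indicator_def not_le[symmetric])
    qed (auto simp: B_def indicator_def)
  qed
  then have "exit_mean \<infinity> y = (\<integral>\<^sup>+\<omega>. ?G (\<lambda>u. Y (t + u) \<omega>) * indicator B \<omega> +
      ?G (\<lambda>u. Y u \<omega>) * indicator {\<omega>. \<tau> \<omega> \<le> ereal t} \<omega> \<partial>P y)"
    unfolding h by (rule nn_integral_cong_AE)
  also have "\<dots> = (\<integral>\<^sup>+\<omega>. ?G (\<lambda>u. Y (t + u) \<omega>) * indicator B \<omega> \<partial>P y) + exit_mean (ereal t) y"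
  proof -
    have [measurable]: "(\<lambda>\<omega>. ?G (\<lambda>u. Y (t + u) \<omega>)) \<in> borel_measurable M"
      by (rule measurable_compose[OF path_measurable[OF t]
            measurable_exit_value_path_space[OF frontier_closed D_frontier lam0_measurable]])
    show ?thesis unfolding exit_mean_def by (subst nn_integral_add) auto
  qed
  also have "(\<integral>\<^sup>+\<omega>. ?G (\<lambda>u. Y (t + u) \<omega>) * indicator B \<omega> \<partial>P y) =
      (\<integral>\<^sup>+\<omega>. exit_mean \<infinity> (Y t \<omega>) * indicator B \<omega> \<partial>P y)"
    unfolding h
    by (rule markov_path[OF measurable_exit_value_path_space[OF frontier_closed D_frontier lam0_measurable] t B])
  also have "\<dots> = (\<integral>\<^sup>+\<omega>. exit_mean \<infinity> (X t \<omega>) * indicator D (X t \<omega>) \<partial>P y)"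
  proof (rule nn_integral_cong)
    fix \<omega> assume "\<omega> \<in> space (P y)"
    then have \<omega>: "\<omega> \<in> space M" by simp
    show "exit_mean \<infinity> (Y t \<omega>) * indicator B \<omega> = exit_mean \<infinity> (X t \<omega>) * indicator D (X t \<omega>)"
    proof (cases "\<omega> \<in> B")
      case True
      then have "X t \<omega> = Y t \<omega>" "Y t \<omega> \<in> D" by (simp_all add: B_def absorbed_def)
      then show ?thesis using True by simp
    next
      case False
      then have "X t \<omega> \<notin> D" using X_mem_D_iff[OF \<omega> t] \<omega> by (simp add: B_def)
      then show ?thesis using False by simp
    qed
  qed
  finally show ?thesis .
qed

section \<open>The killed semigroup and reversibility\<close>

text \<open>Integration of \<^term>\<open>u\<close> against the part of \<open>p\<^sub>t(x, dy)\<close> inside \<^term>\<open>D\<close>.\<close>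

definition killed :: "real \<Rightarrow> ('a \<Rightarrow> ennreal) \<Rightarrow> 'a \<Rightarrow> ennreal" where
  "killed t u x = (\<integral>\<^sup>+\<omega>. u (X t \<omega>) * indicator D (X t \<omega>) \<partial>P x)"

lemma killed_measurable [measurable]:
  assumes t: "0 \<le> t" and u [measurable]: "u \<in> borel_measurable borel"
  shows "killed t u \<in> borel_measurable borel"
proof -
  note [measurable] = measurable_X[OF t]
  show ?thesis unfolding killed_def[abs_def] by (rule nn_integral_P_measurable) measurable
qed

lemma transition_measurable:
  assumes t: "0 \<le> t"
  shows "transition D Y P t \<in> borel \<rightarrow>\<^sub>M subprob_algebra (restrict_space borel (closure D))"
proof -
  have "(\<lambda>x. distr (P x) borel (X t)) \<in> borel \<rightarrow>\<^sub>M subprob_algebra borel"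
    by (rule measurable_compose[OF P_subprob measurable_distr[OF measurable_X[OF t]]])
  then have "(\<lambda>x. restrict_space (distr (P x) borel (X t)) (closure D)) \<in>
      borel \<rightarrow>\<^sub>M subprob_algebra (restrict_space borel (closure D))"
    using D_nonempty by (intro restrict_space_measurable) auto
  then show ?thesis by (simp add: transition_def[abs_def])
qed

lemma nn_integral_transition:
  assumes t: "0 \<le> t" and u: "u \<in> borel_measurable borel" "\<And>y. y \<notin> D \<Longrightarrow> u y = 0"
  shows "(\<integral>\<^sup>+y. u y \<partial>transition D Y P t x) = killed t u x"
proof -
  have X: "X t \<in> P x \<rightarrow>\<^sub>M borel" using measurable_X[OF t] by (simp add: measurable_cong_sets[OF sets_P refl])
  have "(\<integral>\<^sup>+y. u y \<partial>transition D Y P t x) = (\<integral>\<^sup>+y. u y * indicator (closure D) y \<partial>distr (P x) borel (X t))"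
    unfolding transition_def by (subst nn_integral_restrict_space) auto
  also have "\<dots> = (\<integral>\<^sup>+\<omega>. u (X t \<omega>) * indicator (closure D) (X t \<omega>) \<partial>P x)"
    using u(1) by (intro nn_integral_distr[OF X]) (auto intro!: borel_measurable_times_ennreal borel_measurable_indicator)
  also have "\<dots> = killed t u x"
    unfolding killed_def using u(2) closure_subset[of D]
    by (intro nn_integral_cong) (auto simp: indicator_def)
  finally show ?thesis .
qed

lemma emeasure_transition:
  assumes t: "0 \<le> t" and A: "A \<in> sets borel" "A \<subseteq> D"
  shows "emeasure (transition D Y P t x) A = killed t (indicator A) x"
proof -
  have "A \<in> sets (transition D Y P t x)"
    using A closure_subset[of D] by (auto simp: transition_def sets_restrict_space_iff)
  then have "emeasure (transition D Y P t x) A = (\<integral>\<^sup>+y. indicator A y \<partial>transition D Y P t x)" by simp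
  then show ?thesis
    using A by (subst (asm) nn_integral_transition[OF t]) (auto simp: indicator_def)
qed

text \<open>Reversibility on rectangles says that the joint law of start and position at time
  \<open>t\<close>, under \<open>m\<close> and killing, agrees with its reflection on
  \<open>D \<times> D\<close>. Rectangles are stable under intersection and the total mass is
  finite, so the laws coincide, and any product \<open>f(x) u(y)\<close> may be integrated.\<close>

lemma reversible_killed:
  assumes m: "finite_measure m" "sets m = sets (restrict_space borel D)" and rev: "reversible D Y P m"
    and t: "0 \<le> t" and f: "f \<in> borel_measurable borel" and u: "u \<in> borel_measurable borel"
  shows "(\<integral>\<^sup>+x. f x * killed t u x \<partial>m) = (\<integral>\<^sup>+y. u y * killed t f y \<partial>m)"
proof -
  let ?R = "restrict_space borel D"
  interpret m: finite_measure m by fact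
  have space_m: "space m = D" using sets_eq_imp_space_eq[OF m(2)] by (simp add: space_restrict_space)
  note m(2) [measurable_cong]
  have idm: "(\<lambda>x. x) \<in> m \<rightarrow>\<^sub>M borel"
    unfolding measurable_cong_sets[OF m(2) refl] by (intro measurable_restrict_space1) simp
  have Dne: "space m \<noteq> {}" using D_nonempty space_m by simp
  define K where "K x = restrict_space (distr (P x) borel (X t)) D" for x
  have "(\<lambda>x. distr (P x) borel (X t)) \<in> borel \<rightarrow>\<^sub>M subprob_algebra borel"
    by (rule measurable_compose[OF P_subprob measurable_distr[OF measurable_X[OF t]]])
  then have "K \<in> borel \<rightarrow>\<^sub>M subprob_algebra ?R"
    unfolding K_def[abs_def] using D_nonempty by (intro restrict_space_measurable) auto
  then have K [measurable]: "K \<in> m \<rightarrow>\<^sub>M subprob_algebra ?R" by (rule measurable_compose[OF idm])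
  have K_int: "(\<integral>\<^sup>+y. v y \<partial>K x) = killed t v x" if "v \<in> borel_measurable borel" for v x
  proof -
    have X: "X t \<in> P x \<rightarrow>\<^sub>M borel" using measurable_X[OF t] by (simp add: measurable_cong_sets[OF sets_P refl])
    have "(\<integral>\<^sup>+y. v y \<partial>K x) = (\<integral>\<^sup>+y. v y * indicator D y \<partial>distr (P x) borel (X t))"
      unfolding K_def by (subst nn_integral_restrict_space) auto
    also have "\<dots> = killed t v x"
      unfolding killed_def using that
      by (intro nn_integral_distr[OF X]) (auto intro!: borel_measurable_times_ennreal borel_measurable_indicator)
    finally show ?thesis .
  qed
  \<comment> \<open>The starting point is put into the first coordinate by \<open>L\<close> and into
    the second by \<open>L'\<close>; mixing over \<open>m\<close> gives the joint law and its
    reflection.\<close>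
  define L where "L x = distr (K x) (?R \<Otimes>\<^sub>M ?R) (\<lambda>y. (x, y))" for x
  define L' where "L' x = distr (K x) (?R \<Otimes>\<^sub>M ?R) (\<lambda>y. (y, x))" for x
  have L: "L \<in> m \<rightarrow>\<^sub>M subprob_algebra (?R \<Otimes>\<^sub>M ?R)" and L': "L' \<in> m \<rightarrow>\<^sub>M subprob_algebra (?R \<Otimes>\<^sub>M ?R)"
    unfolding L_def L'_def by (rule measurable_distr2[OF _ K]; measurable)+
  have int_L: "(\<integral>\<^sup>+z. v (fst z) * w (snd z) \<partial>L x) = v x * killed t w x"
    and int_L': "(\<integral>\<^sup>+z. v (fst z) * w (snd z) \<partial>L' x) = w x * killed t v x"
    if "x \<in> D" and [measurable]: "v \<in> borel_measurable borel" "w \<in> borel_measurable borel" for v w x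
  proof -
    have sK: "sets (K x) = sets ?R" by (simp add: K_def sets_restrict_space)
    have x: "x \<in> space ?R" using that by (simp add: space_restrict_space)
    have [measurable]: "v \<in> borel_measurable ?R" "w \<in> borel_measurable ?R"
      using that by (auto intro: measurable_restrict_space1)
    then have measK: "v \<in> borel_measurable (K x)" "w \<in> borel_measurable (K x)"
      by (simp_all add: measurable_cong_sets[OF sK refl])
    have meas: "(\<lambda>z. v (fst z) * w (snd z)) \<in> borel_measurable (?R \<Otimes>\<^sub>M ?R)" by measurable
    have "(\<lambda>y. (x, y)) \<in> K x \<rightarrow>\<^sub>M ?R \<Otimes>\<^sub>M ?R"
      by (intro measurable_Pair measurable_const x measurable_ident_sets sK)
    from nn_integral_distr[OF this, of "\<lambda>z. v (fst z) * w (snd z)"]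
    have "(\<integral>\<^sup>+z. v (fst z) * w (snd z) \<partial>L x) = (\<integral>\<^sup>+y. v x * w y \<partial>K x)"
      using meas by (simp add: L_def)
    also have "\<dots> = v x * killed t w x"
      using that(3) K_int measK by (subst nn_integral_cmult) auto
    finally show "(\<integral>\<^sup>+z. v (fst z) * w (snd z) \<partial>L x) = v x * killed t w x" .
    have "(\<lambda>y. (y, x)) \<in> K x \<rightarrow>\<^sub>M ?R \<Otimes>\<^sub>M ?R"
      by (intro measurable_Pair measurable_const x measurable_ident_sets sK)
    from nn_integral_distr[OF this, of "\<lambda>z. v (fst z) * w (snd z)"]
    have "(\<integral>\<^sup>+z. v (fst z) * w (snd z) \<partial>L' x) = (\<integral>\<^sup>+y. v y * w x \<partial>K x)"
      using meas by (simp add: L'_def)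
    also have "\<dots> = w x * killed t v x"
      using that(2) K_int measK by (subst nn_integral_multc) (auto simp: mult.commute)
    finally show "(\<integral>\<^sup>+z. v (fst z) * w (snd z) \<partial>L' x) = w x * killed t v x" .
  qed
  have int_bind: "(\<integral>\<^sup>+z. v (fst z) * w (snd z) \<partial>(m \<bind> L)) = (\<integral>\<^sup>+x. v x * killed t w x \<partial>m)"
    and int_bind': "(\<integral>\<^sup>+z. v (fst z) * w (snd z) \<partial>(m \<bind> L')) = (\<integral>\<^sup>+x. w x * killed t v x \<partial>m)"
    if "v \<in> borel_measurable borel" "w \<in> borel_measurable borel" for v w
  proof -
    have [measurable]: "v \<in> borel_measurable ?R" "w \<in> borel_measurable ?R"
      using that by (auto intro: measurable_restrict_space1)
    show "(\<integral>\<^sup>+z. v (fst z) * w (snd z) \<partial>(m \<bind> L)) = (\<integral>\<^sup>+x. v x * killed t w x \<partial>m)"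
      by (subst nn_integral_bind[OF _ L]) (auto intro!: nn_integral_cong int_L that simp: space_m)
    show "(\<integral>\<^sup>+z. v (fst z) * w (snd z) \<partial>(m \<bind> L')) = (\<integral>\<^sup>+x. w x * killed t v x \<partial>m)"
      by (subst nn_integral_bind[OF _ L']) (auto intro!: nn_integral_cong int_L' that simp: space_m)
  qed
  have sets_L: "sets (m \<bind> L) = sets (?R \<Otimes>\<^sub>M ?R)" and sets_L': "sets (m \<bind> L') = sets (?R \<Otimes>\<^sub>M ?R)"
    by (rule sets_bind[OF _ Dne]; simp add: L_def L'_def)+
  have rect: "emeasure (m \<bind> L) (A \<times> B) = (\<integral>\<^sup>+x. indicator A x * killed t (indicator B) x \<partial>m)"
    "emeasure (m \<bind> L') (A \<times> B) = (\<integral>\<^sup>+x. indicator B x * killed t (indicator A) x \<partial>m)"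
    if "A \<in> sets ?R" "B \<in> sets ?R" for A B
  proof -
    have ind: "(indicator (A \<times> B) z :: ennreal) = indicator A (fst z) * indicator B (snd z)" for z
      by (cases z) (auto simp: indicator_def)
    have AB: "A \<times> B \<in> sets (?R \<Otimes>\<^sub>M ?R)" using that by auto
    have meas: "(indicator A :: _ \<Rightarrow> ennreal) \<in> borel_measurable borel" "(indicator B :: _ \<Rightarrow> ennreal) \<in> borel_measurable borel"
      using that by (auto simp: sets_restrict_space_iff intro!: borel_measurable_indicator)
    show "emeasure (m \<bind> L) (A \<times> B) = (\<integral>\<^sup>+x. indicator A x * killed t (indicator B) x \<partial>m)"
      using nn_integral_indicator[of "A \<times> B" "m \<bind> L"] AB sets_L int_bind[OF meas] by (simp add: ind)
    show "emeasure (m \<bind> L') (A \<times> B) = (\<integral>\<^sup>+x. indicator B x * killed t (indicator A) x \<partial>m)"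
      using nn_integral_indicator[of "A \<times> B" "m \<bind> L'"] AB sets_L' int_bind'[OF meas] by (simp add: ind)
  qed
  have "m \<bind> L = m \<bind> L'"
  proof (rule measure_eqI_generator_eq[where E="{A \<times> B | A B. A \<in> sets ?R \<and> B \<in> sets ?R}"
        and \<Omega>="D \<times> D" and A="\<lambda>_. D \<times> D"])
    show "Int_stable {A \<times> B | A B. A \<in> sets ?R \<and> B \<in> sets ?R}" by (rule Int_stable_pair_measure_generator)
    show "{A \<times> B | A B. A \<in> sets ?R \<and> B \<in> sets ?R} \<subseteq> Pow (D \<times> D)"
      by (auto simp: sets_restrict_space_iff)
    show "sets (m \<bind> L) = sigma_sets (D \<times> D) {A \<times> B | A B. A \<in> sets ?R \<and> B \<in> sets ?R}"
      unfolding sets_L by (simp add: sets_pair_measure space_restrict_space)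
    show "sets (m \<bind> L') = sigma_sets (D \<times> D) {A \<times> B | A B. A \<in> sets ?R \<and> B \<in> sets ?R}"
      unfolding sets_L' by (simp add: sets_pair_measure space_restrict_space)
    have D: "D \<in> sets ?R" by (simp add: sets_restrict_space_iff)
    then show "range (\<lambda>_. D \<times> D) \<subseteq> {A \<times> B | A B. A \<in> sets ?R \<and> B \<in> sets ?R}" by auto
    have "emeasure (m \<bind> L) (D \<times> D) \<le> (\<integral>\<^sup>+x. 1 \<partial>m)"
      unfolding rect(1)[OF D D]
    proof (rule nn_integral_mono)
      fix x
      interpret prob_space "P x" by (rule prob_P)
      have "killed t (indicator D) x \<le> (\<integral>\<^sup>+\<omega>. 1 \<partial>P x)"
        unfolding killed_def by (intro nn_integral_mono) (simp add: indicator_def)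
      then show "indicator D x * killed t (indicator D) x \<le> 1"
        using emeasure_space_1 by (simp add: indicator_def)
    qed
    also have "\<dots> < \<infinity>" by (simp add: less_top[symmetric])
    finally show "emeasure (m \<bind> L) (D \<times> D) \<noteq> \<infinity>" by simp
  next
    fix E assume "E \<in> {A \<times> B | A B. A \<in> sets ?R \<and> B \<in> sets ?R}"
    then obtain A B where AB: "A \<in> sets ?R" "B \<in> sets ?R" and E: "E = A \<times> B" by auto
    have sub: "A \<in> sets borel" "A \<subseteq> D" "B \<in> sets borel" "B \<subseteq> D"
      using AB by (auto simp: sets_restrict_space_iff)
    have "(\<integral>\<^sup>+x\<in>A. emeasure (transition D Y P t x) B \<partial>m) = (\<integral>\<^sup>+y\<in>B. emeasure (transition D Y P t y) A \<partial>m)"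
      using rev t AB by (simp add: reversible_def)
    then show "emeasure (m \<bind> L) E = emeasure (m \<bind> L') E"
      unfolding E rect[OF AB] emeasure_transition[OF t sub(1,2)] emeasure_transition[OF t sub(3,4)]
      by (simp add: mult.commute)
  qed auto
  then show ?thesis using int_bind[OF f u] int_bind'[OF f u] by simp
qed

end

section \<open>The gas\<close>

context absorbed_diffusion
begin

abbreviation R :: "'a measure" where
  "R \<equiv> restrict_space borel D"

definition outer_one :: "('a \<Rightarrow> real) \<Rightarrow> 'a \<Rightarrow> real" where
  "outer_one g x = (if x \<in> D then g x else 1)"

definition semigroup :: "real \<Rightarrow> ('a \<Rightarrow> real) \<Rightarrow> 'a \<Rightarrow> real" where
  "semigroup t f x = (\<integral>\<omega>. f (X t \<omega>) \<partial>P x)"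

lemma space_R [simp]: "space R = D"
  by (simp add: space_restrict_space)

lemma outer_one_measurable:
  "g \<in> borel_measurable R \<Longrightarrow> outer_one g \<in> borel_measurable borel"
  unfolding outer_one_def[abs_def]
  by (subst measurable_If_restrict_space_iff) (auto simp: pred_def)

lemma outer_one_bounds: "(\<And>x. g x \<in> {0..1}) \<Longrightarrow> outer_one g x \<in> {0..1}"
  by (simp add: outer_one_def)

lemma measurable_X_P: "0 \<le> t \<Longrightarrow> X t \<in> P x \<rightarrow>\<^sub>M borel"
  using measurable_X by (simp add: measurable_cong_sets[OF sets_P refl])

lemma integrable_X:
  assumes "0 \<le> t" "f \<in> borel_measurable borel" "\<And>x. f x \<in> {0..1 :: real}"
  shows "integrable (P x) (\<lambda>\<omega>. f (X t \<omega>))"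
proof -
  interpret prob_space "P x" by (rule prob_P)
  show ?thesis
    using assms(3) measurable_compose[OF measurable_X_P[OF assms(1)] assms(2)]
    by (intro integrable_const_bound[of _ 1]) auto
qed

lemma semigroup_measurable:
  assumes "0 \<le> t" "f \<in> borel_measurable borel"
  shows "semigroup t f \<in> borel_measurable borel"
  unfolding semigroup_def[abs_def]
  by (rule measurable_compose[OF P_subprob integral_measurable_subprob_algebra])
     (rule measurable_compose[OF measurable_X[OF assms(1)] assms(2)])

lemma semigroup_bounds:
  assumes "0 \<le> t" "f \<in> borel_measurable borel" "\<And>x. f x \<in> {0..1}"
  shows "semigroup t f x \<in> {0..1}"
proof -
  interpret prob_space "P x" by (rule prob_P)
  show ?thesis
    unfolding semigroup_def using assms integrable_X[OF assms]
    by (auto intro!: integral_nonneg integral_le_const)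
qed

text \<open>\<open>1 - outer_one g\<close> vanishes off \<open>D\<close>, so only surviving
  particles contribute. This links the real-valued generating functionals to the
  \<open>ennreal\<close> calculus of \<open>killed\<close>.\<close>

lemma one_minus_semigroup:
  assumes t: "0 \<le> t" and g: "g \<in> borel_measurable R" "\<And>x. g x \<in> {0..1}"
  shows "ennreal (1 - semigroup t (outer_one g) x) = killed t (\<lambda>y. ennreal (1 - outer_one g y)) x"
proof -
  interpret prob_space "P x" by (rule prob_P)
  note og = outer_one_measurable[OF g(1)] outer_one_bounds[of g, OF g(2)]
  note int = integrable_X[OF t og]
  have "1 - semigroup t (outer_one g) x = (\<integral>\<omega>. 1 - outer_one g (X t \<omega>) \<partial>P x)"
    unfolding semigroup_def using int prob_space by (subst Bochner_Integration.integral_diff) auto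
  then have "ennreal (1 - semigroup t (outer_one g) x) = (\<integral>\<^sup>+\<omega>. ennreal (1 - outer_one g (X t \<omega>)) \<partial>P x)"
    using int og(2) by (subst nn_integral_eq_integral) auto
  also have "\<dots> = killed t (\<lambda>y. ennreal (1 - outer_one g y)) x"
    unfolding killed_def by (intro nn_integral_cong) (auto simp: outer_one_def indicator_def)
  finally show ?thesis .
qed

lemma reservoir_intensity_eq:
  "reservoir_intensity D Y P lam \<mu> t = density \<mu> (exit_mean (ereal t))"
  unfolding reservoir_intensity_def nn_integral_exit_law ..

lemma measurable_restrict_cong:
  assumes "sets \<mu> = sets R" "f \<in> borel_measurable borel"
  shows "f \<in> borel_measurable \<mu>"
  using measurable_restrict_space1[OF assms(2), of D] by (simp add: measurable_cong_sets[OF assms(1) refl])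

lemma finite_density_exit_mean:
  assumes \<mu>: "finite_measure \<mu>" "sets \<mu> = sets R"
  shows "finite_measure (density \<mu> (exit_mean T))"
proof
  interpret \<mu>: finite_measure \<mu> by fact
  have [measurable]: "exit_mean T \<in> borel_measurable \<mu>" by (rule measurable_restrict_cong[OF \<mu>(2)]) measurable
  have "emeasure (density \<mu> (exit_mean T)) (space \<mu>) = (\<integral>\<^sup>+x. exit_mean T x \<partial>\<mu>)"
    by (subst emeasure_density) (auto intro!: nn_integral_cong)
  also have "\<dots> \<le> (\<integral>\<^sup>+x. ennreal C \<partial>\<mu>)" by (intro nn_integral_mono exit_mean_le)
  also have "\<dots> < \<infinity>" by (simp add: ennreal_mult_eq_top_iff less_top[symmetric])
  finally show "emeasure (density \<mu> (exit_mean T)) (space (density \<mu> (exit_mean T))) \<noteq> \<infinity>" by simp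
qed

section \<open>The law of the gas at a fixed time\<close>

context
  fixes \<mu> :: "'a measure" and t :: real
  assumes \<mu>: "finite_measure \<mu>" "sets \<mu> = sets R" and t: "0 \<le> t"
begin

abbreviation reservoir :: "'a measure" where
  "reservoir \<equiv> reservoir_intensity D Y P lam \<mu> t"

abbreviation reservoir_law :: "'a multiset measure" where
  "reservoir_law \<equiv> poisson_law reservoir"

abbreviation kernel :: "'a multiset \<Rightarrow> 'a multiset measure" where
  "kernel \<equiv> gas_kernel D Y P lam \<mu> t"

lemma sets_reservoir: "sets reservoir = sets R"
  by (simp add: reservoir_intensity_eq \<mu>(2))

lemma reservoir_poisson: "poisson_process reservoir reservoir_law"
  unfolding reservoir_intensity_eq by (intro poisson_process_poisson_law finite_density_exit_mean \<mu>)

lemma prob_reservoir_law: "prob_space reservoir_law"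
  and sets_reservoir_law: "sets reservoir_law = sets (conf_on D)"
  using reservoir_poisson conf_space_cong[OF sets_reservoir] by (simp_all add: poisson_process_def)

definition survivors :: "'a list \<Rightarrow> (nat \<Rightarrow> 'w) \<Rightarrow> 'a multiset" where
  "survivors xs \<omega> = filter_mset (\<lambda>x. x \<in> D) (image_mset (\<lambda>i. X t (\<omega> i)) (mset_set {..<length xs}))"

lemma survivors_plus_measurable:
  "(\<lambda>(\<omega>, \<theta>). survivors xs \<omega> + \<theta>) \<in>
    (\<Pi>\<^sub>M i\<in>{..<length xs}. P (xs ! i)) \<Otimes>\<^sub>M reservoir_law \<rightarrow>\<^sub>M conf_on D"
proof (rule measurable_conf_spaceI)
  fix z assume "z \<in> space ((\<Pi>\<^sub>M i\<in>{..<length xs}. P (xs ! i)) \<Otimes>\<^sub>M reservoir_law)"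
  then have "set_mset (snd z) \<subseteq> D"
    using sets_eq_imp_space_eq[OF sets_reservoir_law] by (auto simp: space_pair_measure)
  then show "set_mset (case z of (\<omega>, \<theta>) \<Rightarrow> survivors xs \<omega> + \<theta>) \<subseteq> space R"
    by (auto simp: survivors_def split: prod.splits)
next
  fix A assume A: "A \<in> sets R"
  then have AD [measurable]: "A \<inter> D \<in> sets borel" by (auto simp: sets_restrict_space_iff)
  have [measurable]: "number A \<in> reservoir_law \<rightarrow>\<^sub>M count_space UNIV"
    using measurable_number[OF A] by (simp add: measurable_cong_sets[OF sets_reservoir_law refl])
  have [measurable]: "X t \<in> P x \<rightarrow>\<^sub>M borel" for x by (rule measurable_X_P[OF t])
  have eq: "number A (survivors xs \<omega>) = (\<Sum>i<length xs. if X t (\<omega> i) \<in> A \<inter> D then 1 else 0)" for \<omega>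
    unfolding survivors_def number_filter by (simp add: number_image_mset_set)
  show "(\<lambda>z. number A (case z of (\<omega>, \<theta>) \<Rightarrow> survivors xs \<omega> + \<theta>)) \<in>
      (\<Pi>\<^sub>M i\<in>{..<length xs}. P (xs ! i)) \<Otimes>\<^sub>M reservoir_law \<rightarrow>\<^sub>M count_space UNIV"
    unfolding case_prod_beta number_plus eq by measurable
qed

lemma kernel_eq:
  obtains xs where "mset xs = \<eta>" "kernel \<eta> =
    distr ((\<Pi>\<^sub>M i\<in>{..<length xs}. P (xs ! i)) \<Otimes>\<^sub>M reservoir_law) (conf_on D) (\<lambda>(\<omega>, \<theta>). survivors xs \<omega> + \<theta>)"
proof
  show "mset (SOME xs. mset xs = \<eta>) = \<eta>" using ex_mset[of \<eta>] by (rule someI_ex)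
qed (simp add: gas_kernel_def Let_def survivors_def)

lemma prob_gas_kernel: "prob_space (kernel \<eta>)" and sets_gas_kernel: "sets (kernel \<eta>) = sets (conf_on D)"
proof -
  obtain xs where xs: "kernel \<eta> =
    distr ((\<Pi>\<^sub>M i\<in>{..<length xs}. P (xs ! i)) \<Otimes>\<^sub>M reservoir_law) (conf_on D) (\<lambda>(\<omega>, \<theta>). survivors xs \<omega> + \<theta>)"
    using kernel_eq by metis
  show "prob_space (kernel \<eta>)"
    unfolding xs by (intro prob_space.prob_space_distr survivors_plus_measurable prob_space_pair prob_space_PiM prob_P prob_reservoir_law)
  show "sets (kernel \<eta>) = sets (conf_on D)" unfolding xs by simp
qed

text \<open>Fubini and the independence of the copies. The pair \<open>outer_one g\<close>,
  \<open>point_prod g\<close> gives the generating functional; the indicator of the complement of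
  \<open>D\<close> with arbitrary \<open>F\<close> gives the event that all initial particles are
  gone.\<close>

lemma integral_product_kernel:
  assumes f: "f \<in> borel_measurable borel" "\<And>x. f x \<in> {0..1 :: real}"
    and F: "F \<in> borel_measurable (conf_on D)" "\<And>\<eta>. set_mset \<eta> \<subseteq> D \<Longrightarrow> F \<eta> \<in> {0..1}"
  shows "integrable ((\<Pi>\<^sub>M i\<in>{..<length xs}. P (xs ! i)) \<Otimes>\<^sub>M reservoir_law)
      (\<lambda>(\<omega>, \<theta>). (\<Prod>i<length xs. f (X t (\<omega> i))) * F \<theta>)" (is ?int)
    and "(\<integral>(\<omega>, \<theta>). (\<Prod>i<length xs. f (X t (\<omega> i))) * F \<theta>
        \<partial>((\<Pi>\<^sub>M i\<in>{..<length xs}. P (xs ! i)) \<Otimes>\<^sub>M reservoir_law)) =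
      point_prod (semigroup t f) (mset xs) * (\<integral>\<theta>. F \<theta> \<partial>reservoir_law)" (is ?eq)
proof -
  let ?\<Pi> = "\<Pi>\<^sub>M i\<in>{..<length xs}. P (xs ! i)"
  interpret Q: prob_space reservoir_law by (rule prob_reservoir_law)
  interpret product_prob_space "\<lambda>i. P (xs ! i)" "{..<length xs}"
    by (intro product_prob_spaceI prob_P)
  interpret PP: prob_space ?\<Pi> by (rule prob_space_axioms)
  interpret PQ: pair_prob_space ?\<Pi> reservoir_law ..
  have [measurable]: "X t \<in> P x \<rightarrow>\<^sub>M borel" for x by (rule measurable_X_P[OF t])
  note f(1) [measurable]
  have [measurable]: "F \<in> borel_measurable reservoir_law"
    using F(1) by (simp add: measurable_cong_sets[OF sets_reservoir_law refl])
  have F01: "F \<theta> \<in> {0..1}" if "\<theta> \<in> space reservoir_law" for \<theta>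
    using F(2) that sets_eq_imp_space_eq[OF sets_reservoir_law] by auto
  have p01: "(\<Prod>i<length xs. f (X t (\<omega> i))) \<in> {0..1}" for \<omega> using f(2) by (auto intro: prod_nonneg prod_le_1)
  show int: ?int
  proof (rule PQ.integrable_const_bound[of _ 1])
    show "AE z in ?\<Pi> \<Otimes>\<^sub>M reservoir_law. norm (case z of (\<omega>, \<theta>) \<Rightarrow> (\<Prod>i<length xs. f (X t (\<omega> i))) * F \<theta>) \<le> 1"
    proof (rule AE_I2)
      fix z assume "z \<in> space (?\<Pi> \<Otimes>\<^sub>M reservoir_law)"
      then have "F (snd z) \<in> {0..1}" using F01 by (auto simp: space_pair_measure)
      then show "norm (case z of (\<omega>, \<theta>) \<Rightarrow> (\<Prod>i<length xs. f (X t (\<omega> i))) * F \<theta>) \<le> 1"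
        using p01[of "fst z"] by (auto simp: case_prod_beta abs_mult intro!: mult_le_one)
    qed
  qed measurable
  have "(\<integral>(\<omega>, \<theta>). (\<Prod>i<length xs. f (X t (\<omega> i))) * F \<theta> \<partial>(?\<Pi> \<Otimes>\<^sub>M reservoir_law)) =
      (\<integral>\<omega>. (\<integral>\<theta>. (\<Prod>i<length xs. f (X t (\<omega> i))) * F \<theta> \<partial>reservoir_law) \<partial>?\<Pi>)"
    using PQ.integral_fst'[OF int] by simp
  also have "\<dots> = (\<integral>\<omega>. (\<Prod>i<length xs. f (X t (\<omega> i))) \<partial>?\<Pi>) * (\<integral>\<theta>. F \<theta> \<partial>reservoir_law)" by simp
  also have "(\<integral>\<omega>. (\<Prod>i<length xs. f (X t (\<omega> i))) \<partial>?\<Pi>) = (\<Prod>i<length xs. semigroup t f (xs ! i))"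
    unfolding semigroup_def
    by (rule product_integral_prod[of "{..<length xs}" "\<lambda>_ \<omega>. f (X t \<omega>)"]) (auto intro: integrable_X[OF t f])
  also have "\<dots> = point_prod (semigroup t f) (mset xs)" by (rule point_prod_mset_nth)
  finally show ?eq .
qed

lemma kernel_pgf:
  assumes g: "g \<in> borel_measurable R" "\<And>x. g x \<in> {0..1}"
  shows "(\<integral>\<theta>. point_prod g \<theta> \<partial>kernel \<eta>) =
    point_prod (semigroup t (outer_one g)) \<eta> * (\<integral>\<theta>. point_prod g \<theta> \<partial>reservoir_law)"
proof -
  obtain xs where xs: "mset xs = \<eta>" "kernel \<eta> =
    distr ((\<Pi>\<^sub>M i\<in>{..<length xs}. P (xs ! i)) \<Otimes>\<^sub>M reservoir_law) (conf_on D) (\<lambda>(\<omega>, \<theta>). survivors xs \<omega> + \<theta>)"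
    using kernel_eq by metis
  have "(\<integral>\<theta>. point_prod g \<theta> \<partial>kernel \<eta>) = (\<integral>(\<omega>, \<theta>). (\<Prod>i<length xs. outer_one g (X t (\<omega> i))) * point_prod g \<theta>
      \<partial>((\<Pi>\<^sub>M i\<in>{..<length xs}. P (xs ! i)) \<Otimes>\<^sub>M reservoir_law))"
    unfolding xs(2)
    by (subst integral_distr[OF survivors_plus_measurable measurable_point_prod[OF g]])
       (simp add: case_prod_unfold survivors_def point_prod_filter point_prod_image_mset_set outer_one_def)
  also have "\<dots> = point_prod (semigroup t (outer_one g)) (mset xs) * (\<integral>\<theta>. point_prod g \<theta> \<partial>reservoir_law)"
    using point_prod_bounds[of _ g] g(2)
    by (intro integral_product_kernel outer_one_measurable[OF g(1)] outer_one_bounds measurable_point_prod[OF g]) auto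
  finally show ?thesis using xs(1) by simp
qed

text \<open>With probability at least the first factor all initial particles have been absorbed, and
  then only the particles from the reservoir remain.\<close>

lemma kernel_ge_reservoir:
  assumes F: "F \<in> borel_measurable (conf_on D)" "\<And>\<theta>. set_mset \<theta> \<subseteq> D \<Longrightarrow> F \<theta> \<in> {0..1 :: real}"
  shows "point_prod (semigroup t (indicator (- D))) \<eta> * (\<integral>\<theta>. F \<theta> \<partial>reservoir_law) \<le> (\<integral>\<theta>. F \<theta> \<partial>kernel \<eta>)"
proof -
  obtain xs where xs: "mset xs = \<eta>" "kernel \<eta> =
    distr ((\<Pi>\<^sub>M i\<in>{..<length xs}. P (xs ! i)) \<Otimes>\<^sub>M reservoir_law) (conf_on D) (\<lambda>(\<omega>, \<theta>). survivors xs \<omega> + \<theta>)"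
    using kernel_eq by metis
  let ?Z = "(\<Pi>\<^sub>M i\<in>{..<length xs}. P (xs ! i)) \<Otimes>\<^sub>M reservoir_law"
  interpret Z: prob_space ?Z
    by (intro prob_space_pair prob_space_PiM prob_P prob_reservoir_law)
  have meas: "(\<lambda>z. F (case z of (\<omega>, \<theta>) \<Rightarrow> survivors xs \<omega> + \<theta>)) \<in> borel_measurable ?Z"
    by (rule measurable_compose[OF survivors_plus_measurable F(1)])
  have sub: "set_mset (case z of (\<omega>, \<theta>) \<Rightarrow> survivors xs \<omega> + \<theta>) \<subseteq> D" if "z \<in> space ?Z" for z
    using measurable_space[OF survivors_plus_measurable that] by simp
  have ind: "(indicator (- D) :: 'a \<Rightarrow> real) \<in> borel_measurable borel"
    "\<And>x. indicator (- D) x \<in> {0..1 :: real}"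
    by (auto simp: indicator_def intro!: borel_measurable_indicator)
  note int = integral_product_kernel[OF ind F, of xs]
  have "point_prod (semigroup t (indicator (- D))) \<eta> * (\<integral>\<theta>. F \<theta> \<partial>reservoir_law) =
      (\<integral>(\<omega>, \<theta>). (\<Prod>i<length xs. indicator (- D) (X t (\<omega> i))) * F \<theta> \<partial>?Z)"
    using int(2) xs(1) by simp
  also have "\<dots> \<le> (\<integral>z. F (case z of (\<omega>, \<theta>) \<Rightarrow> survivors xs \<omega> + \<theta>) \<partial>?Z)"
  proof (rule integral_mono[OF int(1)])
    show "integrable ?Z (\<lambda>z. F (case z of (\<omega>, \<theta>) \<Rightarrow> survivors xs \<omega> + \<theta>))"
      using F(2)[OF sub] by (intro Z.integrable_const_bound[of _ 1] meas) auto
    fix z assume z: "z \<in> space ?Z"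
    obtain \<omega> \<theta> where z_eq: "z = (\<omega>, \<theta>)" by force
    show "(case z of (\<omega>, \<theta>) \<Rightarrow> (\<Prod>i<length xs. indicator (- D) (X t (\<omega> i))) * F \<theta>) \<le>
        F (case z of (\<omega>, \<theta>) \<Rightarrow> survivors xs \<omega> + \<theta>)"
    proof (cases "\<forall>i<length xs. X t (\<omega> i) \<notin> D")
      case True
      then have "set_mset (survivors xs \<omega>) = {}" by (auto simp: survivors_def)
      then show ?thesis using True by (simp add: z_eq)
    next
      case False
      then obtain i where "i < length xs" "X t (\<omega> i) \<in> D" by auto
      then have zero: "(\<Prod>i<length xs. indicator (- D) (X t (\<omega> i)) :: real) = 0"
        by (intro prod_zero bexI[of _ i]) auto
      show ?thesis using F(2)[OF sub[OF z]] unfolding z_eq prod.case zero by simp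
    qed
  qed
  also have "\<dots> = (\<integral>\<theta>. F \<theta> \<partial>kernel \<eta>)"
    unfolding xs(2) by (rule integral_distr[OF survivors_plus_measurable F(1), symmetric])
  finally show ?thesis .
qed

lemma gas_kernel_measurable: "kernel \<in> conf_on D \<rightarrow>\<^sub>M prob_algebra (conf_on D)"
proof (rule measurable_conf_kernel[OF prob_gas_kernel sets_gas_kernel])
  fix g :: "'a \<Rightarrow> real" assume g: "simple_function R g" "\<And>x. g x \<in> {0..1}"
  have gR: "g \<in> borel_measurable R" by (rule borel_measurable_simple_function[OF g(1)])
  note og = outer_one_measurable[OF gR] outer_one_bounds[of g, OF g(2)]
  have "point_prod (semigroup t (outer_one g)) \<in> borel_measurable (conf_on D)"
    by (intro measurable_point_prod measurable_restrict_space1 semigroup_measurable[OF t og(1)] semigroup_bounds[OF t og])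
  then show "(\<lambda>\<eta>. \<integral>\<theta>. point_prod g \<theta> \<partial>kernel \<eta>) \<in> borel_measurable (conf_on D)"
    unfolding kernel_pgf[OF gR g(2)] by measurable
qed

lemma
  assumes \<nu>: "configuration_law D \<nu>"
  shows prob_gas_law: "prob_space (gas_law D Y P lam \<mu> \<nu> t)"
    and sets_gas_law: "sets (gas_law D Y P lam \<mu> \<nu> t) = sets (conf_on D)"
proof -
  have "\<nu> \<in> space (prob_algebra (conf_on D))" using \<nu> by (simp add: configuration_law_def space_prob_algebra)
  from prob_space_bind'[OF this gas_kernel_measurable] sets_bind'[OF this gas_kernel_measurable]
  show "prob_space (gas_law D Y P lam \<mu> \<nu> t)" "sets (gas_law D Y P lam \<mu> \<nu> t) = sets (conf_on D)"
    by (simp_all add: gas_law_def)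
qed

lemma integral_gas_law:
  assumes \<nu>: "configuration_law D \<nu>"
    and F: "F \<in> borel_measurable (conf_on D)" "\<And>\<eta>. set_mset \<eta> \<subseteq> D \<Longrightarrow> F \<eta> \<in> {0..1 :: real}"
  shows "(\<integral>\<eta>. F \<eta> \<partial>gas_law D Y P lam \<mu> \<nu> t) = (\<integral>\<eta>. (\<integral>\<theta>. F \<theta> \<partial>kernel \<eta>) \<partial>\<nu>)"
  unfolding gas_law_def
proof (rule integral_bind[where B=1 and B'=1, OF F(1)])
  show "\<bar>F \<eta>\<bar> \<le> 1" if "\<eta> \<in> space (conf_on D)" for \<eta> using F(2)[of \<eta>] that by simp
  have sets_\<nu>: "sets \<nu> = sets (conf_on D)" using \<nu> by (simp add: configuration_law_def)
  show "kernel \<in> \<nu> \<rightarrow>\<^sub>M subprob_algebra (conf_on D)"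
    unfolding measurable_cong_sets[OF sets_\<nu> refl]
    by (rule measurable_prob_algebraD[OF gas_kernel_measurable])
  show "finite_measure \<nu>" using \<nu> by (simp add: configuration_law_def prob_space.finite_measure)
  show "AE \<eta> in \<nu>. emeasure (kernel \<eta>) (space (kernel \<eta>)) \<le> ennreal 1"
    by (simp add: prob_space.emeasure_space_1[OF prob_gas_kernel])
qed

lemma gas_law_pgf:
  assumes \<nu>: "configuration_law D \<nu>" and g: "g \<in> borel_measurable R" "\<And>x. g x \<in> {0..1}"
  shows "(\<integral>\<eta>. point_prod g \<eta> \<partial>gas_law D Y P lam \<mu> \<nu> t) =
    (\<integral>\<eta>. point_prod (semigroup t (outer_one g)) \<eta> \<partial>\<nu>) * (\<integral>\<theta>. point_prod g \<theta> \<partial>reservoir_law)"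
proof -
  have "(\<integral>\<eta>. point_prod g \<eta> \<partial>gas_law D Y P lam \<mu> \<nu> t) = (\<integral>\<eta>. (\<integral>\<theta>. point_prod g \<theta> \<partial>kernel \<eta>) \<partial>\<nu>)"
    using point_prod_bounds[of _ g] g(2) by (intro integral_gas_law[OF \<nu>] measurable_point_prod g) auto
  then show ?thesis unfolding kernel_pgf[OF g] by simp
qed

lemma gas_law_poisson_pgf:
  assumes \<nu>: "poisson_process \<rho> \<nu>" "sets \<rho> = sets R" and g: "g \<in> borel_measurable R" "\<And>x. g x \<in> {0..1}"
  shows "(\<integral>\<eta>. point_prod g \<eta> \<partial>gas_law D Y P lam \<mu> \<nu> t) =
    exp (- enn2real ((\<integral>\<^sup>+x. killed t (\<lambda>y. ennreal (1 - outer_one g y)) x \<partial>\<rho>) +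
      (\<integral>\<^sup>+x. ennreal (1 - outer_one g x) \<partial>reservoir)))"
proof -
  note og = outer_one_measurable[OF g(1)] outer_one_bounds[of g, OF g(2)]
  interpret \<rho>: finite_measure \<rho> using \<nu>(1) by (simp add: poisson_process_def)
  interpret res: finite_measure reservoir using reservoir_poisson by (simp add: poisson_process_def)
  have conf: "configuration_law D \<nu>"
    using \<nu> conf_space_cong[OF \<nu>(2)] by (simp add: poisson_process_def configuration_law_def)
  have "(\<integral>\<eta>. point_prod (semigroup t (outer_one g)) \<eta> \<partial>\<nu>) =
      exp (- enn2real (\<integral>\<^sup>+x. killed t (\<lambda>y. ennreal (1 - outer_one g y)) x \<partial>\<rho>))"
    using poisson_pgf_nn[OF \<nu>(1) measurable_restrict_cong[OF \<nu>(2) semigroup_measurable[OF t og(1)]] semigroup_bounds[OF t og]]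
    by (simp add: one_minus_semigroup[OF t g])
  moreover have "(\<integral>\<theta>. point_prod g \<theta> \<partial>reservoir_law) =
      exp (- enn2real (\<integral>\<^sup>+x. ennreal (1 - outer_one g x) \<partial>reservoir))"
  proof -
    have "(\<integral>\<theta>. point_prod g \<theta> \<partial>reservoir_law) = (\<integral>\<theta>. point_prod (outer_one g) \<theta> \<partial>reservoir_law)"
      using sets_eq_imp_space_eq[OF sets_reservoir_law]
      by (intro Bochner_Integration.integral_cong refl point_prod_cong) (auto simp: outer_one_def)
    then show ?thesis
      using poisson_pgf_nn[OF reservoir_poisson measurable_restrict_cong[OF sets_reservoir og(1)] og(2)] by simp
  qed
  \<comment> \<open>Finiteness of this integral and of the next is what lets \<open>enn2real\<close>
    split over their sum.\<close>
  moreover have "(\<integral>\<^sup>+x. killed t (\<lambda>y. ennreal (1 - outer_one g y)) x \<partial>\<rho>) < top"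
  proof -
    have "(\<integral>\<^sup>+x. killed t (\<lambda>y. ennreal (1 - outer_one g y)) x \<partial>\<rho>) \<le> (\<integral>\<^sup>+x. 1 \<partial>\<rho>)"
    proof (rule nn_integral_mono)
      fix x
      show "killed t (\<lambda>y. ennreal (1 - outer_one g y)) x \<le> 1"
        using one_minus_semigroup[OF t g, of x] semigroup_bounds[OF t og, of x]
        by (metis atLeastAtMost_iff diff_ge_0_iff_ge ennreal_1 ennreal_leI diff_le_eq le_add_same_cancel1)
    qed
    also have "\<dots> < top" by (simp add: less_top[symmetric])
    finally show ?thesis .
  qed
  moreover have "(\<integral>\<^sup>+x. ennreal (1 - outer_one g x) \<partial>reservoir) < top"
  proof -
    have "(\<integral>\<^sup>+x. ennreal (1 - outer_one g x) \<partial>reservoir) \<le> (\<integral>\<^sup>+x. 1 \<partial>reservoir)"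
      using og(2) by (intro nn_integral_mono) (simp flip: ennreal_1 add: ennreal_leI)
    also have "\<dots> < top" by (simp add: less_top[symmetric])
    finally show ?thesis .
  qed
  ultimately show ?thesis
    using gas_law_pgf[OF conf g] by (simp add: enn2real_plus flip: exp_add)
qed

end

end

section \<open>Poisson initial laws\<close>

context absorbed_diffusion
begin

lemma dual_semigroup_facts:
  assumes \<rho>: "finite_measure \<rho>" "sets \<rho> = sets R" and t: "0 \<le> t"
  shows sets_dual_semigroup: "sets (dual_semigroup D Y P t \<rho>) = sets (restrict_space borel (closure D))"
    and finite_measure_dual_semigroup: "finite_measure (dual_semigroup D Y P t \<rho>)"
    and nn_integral_dual_semigroup: "u \<in> borel_measurable borel \<Longrightarrow> (\<And>y. y \<notin> D \<Longrightarrow> u y = 0) \<Longrightarrow>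
      (\<integral>\<^sup>+y. u y \<partial>dual_semigroup D Y P t \<rho>) = (\<integral>\<^sup>+x. killed t u x \<partial>\<rho>)"
proof -
  let ?S = "restrict_space borel (closure D)"
  interpret \<rho>: finite_measure \<rho> by fact
  have ne: "space \<rho> \<noteq> {}" using D_nonempty sets_eq_imp_space_eq[OF \<rho>(2)] by simp
  have K: "transition D Y P t \<in> \<rho> \<rightarrow>\<^sub>M subprob_algebra ?S"
    unfolding measurable_cong_sets[OF \<rho>(2) refl]
    by (intro measurable_restrict_space1 transition_measurable[OF t])
  show sets: "sets (dual_semigroup D Y P t \<rho>) = sets ?S"
    unfolding dual_semigroup_def by (rule sets_bind[OF sets_kernel[OF K] ne])
  show "finite_measure (dual_semigroup D Y P t \<rho>)"
  proof
    have "emeasure (dual_semigroup D Y P t \<rho>) (space ?S) = (\<integral>\<^sup>+x. emeasure (transition D Y P t x) (space ?S) \<partial>\<rho>)"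
      unfolding dual_semigroup_def by (rule emeasure_bind[OF ne K sets.top])
    also have "\<dots> \<le> (\<integral>\<^sup>+x. 1 \<partial>\<rho>)"
    proof (rule nn_integral_mono)
      fix x assume "x \<in> space \<rho>"
      then have "subprob_space (transition D Y P t x)"
        using measurable_space[OF K] by (simp add: space_subprob_algebra)
      then show "emeasure (transition D Y P t x) (space ?S) \<le> 1" by (rule subprob_space.subprob_emeasure_le_1)
    qed
    also have "\<dots> < top" by (simp add: less_top[symmetric])
    finally show "emeasure (dual_semigroup D Y P t \<rho>) (space (dual_semigroup D Y P t \<rho>)) \<noteq> \<infinity>"
      using sets_eq_imp_space_eq[OF sets] by simp
  qed
  show "(\<integral>\<^sup>+y. u y \<partial>dual_semigroup D Y P t \<rho>) = (\<integral>\<^sup>+x. killed t u x \<partial>\<rho>)"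
    if u: "u \<in> borel_measurable borel" "\<And>y. y \<notin> D \<Longrightarrow> u y = 0"
    unfolding dual_semigroup_def using measurable_restrict_space1[OF u(1), of "closure D"]
    by (subst nn_integral_bind[OF _ K]) (auto simp: nn_integral_transition[OF t u])
qed

text \<open>Restriction to \<open>D\<close> replaces \<open>g\<close> by \<open>outer_one g\<close>.
  As \<open>1 - outer_one g\<close> vanishes on the frontier, the absorbed mass drops out of the
  exponent, and both generating functionals reduce to the same killed and reservoir
  integrals.\<close>

theorem poisson_initial_law:
  assumes \<mu>: "finite_measure \<mu>" "sets \<mu> = sets R" and \<rho>: "finite_measure \<rho>" "sets \<rho> = sets R"
    and \<nu>: "poisson_process \<rho> \<nu>" and t: "0 \<le> t"
  shows "\<exists>Q. poisson_process
      (add_measure (dual_semigroup D Y P t \<rho>)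
        (distr (reservoir_intensity D Y P lam \<mu> t) (restrict_space borel (closure D)) (\<lambda>x. x))) Q \<and>
      gas_law D Y P lam \<mu> \<nu> t = distr Q (conf_on D) (filter_mset (\<lambda>x. x \<in> D))"
proof -
  let ?S = "restrict_space borel (closure D)"
  let ?A = "dual_semigroup D Y P t \<rho>"
  let ?res = "reservoir_intensity D Y P lam \<mu> t"
  let ?B = "distr ?res ?S (\<lambda>x. x)"
  let ?\<rho>t = "add_measure ?A ?B"
  note A = dual_semigroup_facts[OF \<rho> t]
  have res_id: "(\<lambda>x. x) \<in> ?res \<rightarrow>\<^sub>M ?S"
    unfolding measurable_cong_sets[OF sets_reservoir[OF \<mu> t] refl]
    using closure_subset[of D]
    by (intro measurable_restrict_space2 measurable_restrict_space1) auto
  interpret A: finite_measure ?A by (rule A(2))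
  interpret res: finite_measure ?res using reservoir_poisson[OF \<mu> t] by (simp add: poisson_process_def)
  interpret B: finite_measure ?B by (rule res.finite_measure_distr[OF res_id])
  have sets_B: "sets ?B = sets ?A" using A(1) by simp
  have sets_\<rho>t: "sets ?\<rho>t = sets ?S" using A(1) by simp
  have "finite_measure ?\<rho>t"
  proof
    show "emeasure ?\<rho>t (space ?\<rho>t) \<noteq> \<infinity>"
      using emeasure_add_measure[OF sets_B sets.top] by simp
  qed
  then have Q: "poisson_process ?\<rho>t (poisson_law ?\<rho>t)" (is "poisson_process _ ?Q")
    by (rule poisson_process_poisson_law)
  interpret Q: prob_space ?Q using Q by (simp add: poisson_process_def)
  have sets_Q: "sets ?Q = sets (conf_space ?S)"
    using Q conf_space_cong[OF sets_\<rho>t] by (simp add: poisson_process_def)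
  have filter: "filter_mset (\<lambda>x. x \<in> D) \<in> ?Q \<rightarrow>\<^sub>M conf_on D"
    unfolding measurable_cong_sets[OF sets_Q refl]
  proof (rule measurable_conf_spaceI)
    fix E assume "E \<in> sets R"
    then have "E \<inter> D \<in> sets ?S"
      using closure_subset[of D] by (auto simp: sets_restrict_space_iff)
    then show "(\<lambda>\<eta>. number E (filter_mset (\<lambda>x. x \<in> D) \<eta>)) \<in> conf_space ?S \<rightarrow>\<^sub>M count_space UNIV"
      unfolding number_filter by (rule measurable_number)
  qed auto
  have conf: "configuration_law D \<nu>"
    using \<nu> conf_space_cong[OF \<rho>(2)] by (simp add: poisson_process_def configuration_law_def)
  have "gas_law D Y P lam \<mu> \<nu> t = distr ?Q (conf_on D) (filter_mset (\<lambda>x. x \<in> D))"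
  proof (rule conf_law_eqI[of _ _ R])
    show "prob_space (gas_law D Y P lam \<mu> \<nu> t)" by (rule prob_gas_law[OF \<mu> t conf])
    show "sets (gas_law D Y P lam \<mu> \<nu> t) = sets (conf_on D)" by (rule sets_gas_law[OF \<mu> t conf])
    show "prob_space (distr ?Q (conf_on D) (filter_mset (\<lambda>x. x \<in> D)))" by (rule Q.prob_space_distr[OF filter])
    fix g :: "'a \<Rightarrow> real" assume g: "simple_function R g" "\<And>x. g x \<in> {0..1}"
    have gR: "g \<in> borel_measurable R" by (rule borel_measurable_simple_function[OF g(1)])
    note og = outer_one_measurable[OF gR] outer_one_bounds[of g, OF g(2)]
    let ?u = "\<lambda>x. ennreal (1 - outer_one g x)"
    have u: "?u \<in> borel_measurable borel" using og(1) by measurable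
    have uS: "?u \<in> borel_measurable ?S" "outer_one g \<in> borel_measurable ?S"
      by (rule measurable_restrict_space1[OF u] measurable_restrict_space1[OF og(1)])+
    have "(\<integral>\<eta>. point_prod g \<eta> \<partial>distr ?Q (conf_on D) (filter_mset (\<lambda>x. x \<in> D))) = (\<integral>\<eta>. point_prod (outer_one g) \<eta> \<partial>?Q)"
      by (subst integral_distr[OF filter measurable_point_prod[OF gR g(2)]])
         (simp add: point_prod_filter outer_one_def[abs_def])
    also have "\<dots> = exp (- enn2real (\<integral>\<^sup>+x. ?u x \<partial>?\<rho>t))"
      using uS(2) by (intro poisson_pgf_nn[OF Q] og(2)) (simp add: measurable_cong_sets[OF sets_\<rho>t refl])
    also have "(\<integral>\<^sup>+x. ?u x \<partial>?\<rho>t) = (\<integral>\<^sup>+x. ?u x \<partial>?A) + (\<integral>\<^sup>+x. ?u x \<partial>?B)"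
      using uS(1) by (intro nn_integral_add_measure[OF sets_B]) (simp add: measurable_cong_sets[OF A(1) refl])
    also have "(\<integral>\<^sup>+x. ?u x \<partial>?A) = (\<integral>\<^sup>+x. killed t ?u x \<partial>\<rho>)"
      by (rule A(3)[OF u]) (simp add: outer_one_def)
    also have "(\<integral>\<^sup>+x. ?u x \<partial>?B) = (\<integral>\<^sup>+x. ?u x \<partial>?res)"
      using uS(1) by (intro nn_integral_distr[OF res_id]) simp
    finally show "(\<integral>\<eta>. point_prod g \<eta> \<partial>gas_law D Y P lam \<mu> \<nu> t) =
        (\<integral>\<eta>. point_prod g \<eta> \<partial>distr ?Q (conf_on D) (filter_mset (\<lambda>x. x \<in> D)))"
      using gas_law_poisson_pgf[OF \<mu> t \<nu> \<rho>(2) gR g(2)] by simp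
  qed simp
  then show ?thesis using Q by blast
qed

section \<open>Loss of memory of the initial law\<close>

lemma tendsto_absorbed:
  assumes x: "x \<in> D"
  shows "((\<lambda>t. semigroup (max 0 t) (indicator (- D)) x) \<longlongrightarrow> 1) at_top"
proof -
  interpret prob_space "P x" by (rule prob_P)
  \<comment> \<open>\<open>X t\<close> is known to be measurable for \<open>t \<ge> 0\<close> only;
    \<open>max 0 t\<close> makes every member of the family measurable without affecting the
    limit.\<close>
  have "((\<lambda>t. \<integral>\<omega>. indicator (- D) (X (max 0 t) \<omega>) \<partial>P x) \<longlongrightarrow> (\<integral>\<omega>. 1 \<partial>P x :: real)) at_top"
  proof (rule integral_dominated_convergence_at_top[where w="\<lambda>_. 1"])
    show "(\<lambda>\<omega>. indicator (- D) (X (max 0 t) \<omega>) :: real) \<in> borel_measurable (P x)" for t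
      by (rule measurable_compose[OF measurable_X_P]) (auto intro!: borel_measurable_indicator)
    show "AE \<omega> in P x. ((\<lambda>t. indicator (- D) (X (max 0 t) \<omega>) :: real) \<longlongrightarrow> 1) at_top"
      using absorption[OF x] AE_space
    proof eventually_elim
      case (elim \<omega>)
      then have \<omega>: "\<omega> \<in> space M" and "\<tau> \<omega> < \<infinity>" using absorption_time_eq by auto
      then obtain r where r: "0 \<le> r" "\<tau> \<omega> = ereal r"
        using hitting_time_attained[OF frontier_closed Y_continuous[OF \<omega>]] by metis
      have "eventually (\<lambda>t. indicator (- D) (X (max 0 t) \<omega>) = (1 :: real)) at_top"
        using eventually_ge_at_top[of r]
      proof eventually_elim
        case (elim t)
        then show ?case using X_mem_D_iff[OF \<omega>, of "max 0 t"] r by simp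
      qed
      then show ?case by (rule tendsto_eventually)
    qed
  qed (auto simp: indicator_def)
  then show ?thesis using prob_space by (simp add: semigroup_def)
qed

lemma indicator_outside:
  shows indicator_outside_measurable: "(indicator (- D) :: 'a \<Rightarrow> real) \<in> borel_measurable borel"
    and indicator_outside_bounds: "indicator (- D) x \<in> {0..1 :: real}"
  by (auto simp: indicator_def intro!: borel_measurable_indicator)

text \<open>The probability, under the initial law \<open>\<nu>\<close>, that no initial particle
  remains in \<open>D\<close> at time \<open>t\<close>: given the configuration, independence yields
  one factor per particle.\<close>

definition absorbed_fraction :: "'a multiset measure \<Rightarrow> real \<Rightarrow> real" where
  "absorbed_fraction \<nu> t = (\<integral>\<eta>. point_prod (semigroup (max 0 t) (indicator (- D))) \<eta> \<partial>\<nu>)"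

lemma absorbed_factor_measurable:
  "configuration_law D \<nu> \<Longrightarrow> point_prod (semigroup (max 0 t) (indicator (- D))) \<in> borel_measurable \<nu>"
proof -
  assume "configuration_law D \<nu>"
  then have "sets \<nu> = sets (conf_on D)" by (simp add: configuration_law_def)
  show ?thesis
    unfolding measurable_cong_sets[OF \<open>sets \<nu> = sets (conf_on D)\<close> refl]
    by (intro measurable_point_prod measurable_restrict_space1 semigroup_measurable[OF _ indicator_outside_measurable]
        semigroup_bounds[OF _ indicator_outside]) simp_all
qed

lemma absorbed_factor_bounds: "point_prod (semigroup (max 0 t) (indicator (- D))) \<eta> \<in> {0..1}"
  by (intro point_prod_bounds semigroup_bounds[OF _ indicator_outside]) simp

text \<open>A configuration has finitely many points, so its product of factors tends to 1; the
  constant bound 1 then allows the limit under any initial law.\<close>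

lemma tendsto_absorbed_fraction:
  assumes \<nu>: "configuration_law D \<nu>"
  shows "(absorbed_fraction \<nu> \<longlongrightarrow> 1) at_top"
proof -
  interpret prob_space \<nu> using \<nu> by (simp add: configuration_law_def)
  have space: "space \<nu> = {\<eta>. set_mset \<eta> \<subseteq> D}"
    using \<nu> sets_eq_imp_space_eq[of \<nu> "conf_on D"] by (simp add: configuration_law_def)
  have "((\<lambda>t. \<integral>\<eta>. point_prod (semigroup (max 0 t) (indicator (- D))) \<eta> \<partial>\<nu>) \<longlongrightarrow> (\<integral>\<eta>. 1 \<partial>\<nu>)) at_top"
  proof (rule integral_dominated_convergence_at_top[where w="\<lambda>_. 1"])
    show "AE \<eta> in \<nu>. ((\<lambda>t. point_prod (semigroup (max 0 t) (indicator (- D))) \<eta>) \<longlongrightarrow> 1) at_top"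
    proof (rule AE_I2)
      fix \<eta> assume "\<eta> \<in> space \<nu>"
      then have "((\<lambda>t. point_prod (semigroup (max 0 t) (indicator (- D))) \<eta>) \<longlongrightarrow> point_prod (\<lambda>_. 1) \<eta>) at_top"
        using space by (intro tendsto_point_prod tendsto_absorbed) auto
      then show "((\<lambda>t. point_prod (semigroup (max 0 t) (indicator (- D))) \<eta>) \<longlongrightarrow> 1) at_top"
        by (simp add: point_prod_def)
    qed
    show "\<forall>\<^sub>F t in at_top. AE \<eta> in \<nu>. norm (point_prod (semigroup (max 0 t) (indicator (- D))) \<eta>) \<le> 1"
      using absorbed_factor_bounds by auto
  qed (use absorbed_factor_measurable[OF \<nu>] in auto)
  then show ?thesis using prob_space by (simp add: absorbed_fraction_def[abs_def])
qed

text \<open>Domination of the reservoir law from below, applied to \<open>F\<close> and to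
  \<open>1 - F\<close>, gives \<open>c * r \<le> s\<close> and
  \<open>c * (1 - r) \<le> 1 - s\<close>, hence both bounds. The right-hand side does not depend on
  \<open>F\<close>: this is an estimate in total variation.\<close>

lemma gas_law_near_reservoir_law:
  assumes \<mu>: "finite_measure \<mu>" "sets \<mu> = sets R" and t: "0 \<le> t" and \<nu>: "configuration_law D \<nu>"
    and F: "F \<in> borel_measurable (conf_on D)" "\<And>\<eta>. set_mset \<eta> \<subseteq> D \<Longrightarrow> F \<eta> \<in> {0..1 :: real}"
  shows "\<bar>(\<integral>\<eta>. F \<eta> \<partial>gas_law D Y P lam \<mu> \<nu> t) - (\<integral>\<eta>. F \<eta> \<partial>poisson_law (reservoir_intensity D Y P lam \<mu> t))\<bar>
    \<le> 1 - absorbed_fraction \<nu> t"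
proof -
  let ?gas = "gas_law D Y P lam \<mu> \<nu> t"
  let ?res = "poisson_law (reservoir_intensity D Y P lam \<mu> t)"
  let ?K = "gas_kernel D Y P lam \<mu> t"
  let ?a = "point_prod (semigroup t (indicator (- D)))"
  interpret \<nu>: prob_space \<nu> using \<nu> by (simp add: configuration_law_def)
  interpret res: prob_space ?res by (rule prob_reservoir_law[OF \<mu> t])
  interpret gas: prob_space ?gas by (rule prob_gas_law[OF \<mu> t \<nu>])
  have unit_int: "integrable L G" "integral\<^sup>L L G \<in> {0..1}"
    if "prob_space L" "sets L = sets (conf_on D)" "G \<in> borel_measurable (conf_on D)"
      "\<And>\<eta>. set_mset \<eta> \<subseteq> D \<Longrightarrow> G \<eta> \<in> {0..1 :: real}" for L G
  proof -
    interpret L: prob_space L by fact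
    have sp: "space L = {\<eta>. set_mset \<eta> \<subseteq> D}" using sets_eq_imp_space_eq[OF that(2)] by simp
    have [measurable]: "G \<in> borel_measurable L" using that(3) by (simp add: measurable_cong_sets[OF that(2) refl])
    show int: "integrable L G"
      using that(4) sp by (intro L.integrable_const_bound[of _ 1] AE_I2) auto
    show "integral\<^sup>L L G \<in> {0..1}"
      using that(4) sp int by (auto intro!: integral_nonneg_AE AE_I2 L.integral_le_const)
  qed
  note gas = gas.prob_space_axioms sets_gas_law[OF \<mu> t \<nu>]
  note res = res.prob_space_axioms sets_reservoir_law[OF \<mu> t]
  have a: "absorbed_fraction \<nu> t = (\<integral>\<eta>. ?a \<eta> \<partial>\<nu>)" using t by (simp add: absorbed_fraction_def max_def)
  have a_int: "integrable \<nu> ?a" and a01: "absorbed_fraction \<nu> t \<in> {0..1}"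
  proof -
    have [measurable]: "?a \<in> borel_measurable \<nu>" using absorbed_factor_measurable[OF \<nu>, of t] t by (simp add: max_def)
    have b: "?a \<eta> \<in> {0..1}" for \<eta> using absorbed_factor_bounds[of t \<eta>] t by (simp add: max_def)
    show int: "integrable \<nu> ?a" using b by (intro \<nu>.integrable_const_bound[of _ 1] AE_I2) auto
    show "absorbed_fraction \<nu> t \<in> {0..1}"
      unfolding a using b int by (auto intro!: integral_nonneg_AE AE_I2 \<nu>.integral_le_const)
  qed
  have ge: "absorbed_fraction \<nu> t * (\<integral>\<eta>. G \<eta> \<partial>?res) \<le> (\<integral>\<eta>. G \<eta> \<partial>?gas)"
    if G: "G \<in> borel_measurable (conf_on D)" "\<And>\<eta>. set_mset \<eta> \<subseteq> D \<Longrightarrow> G \<eta> \<in> {0..1 :: real}" for G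
  proof -
    have "absorbed_fraction \<nu> t * (\<integral>\<eta>. G \<eta> \<partial>?res) = (\<integral>\<eta>. ?a \<eta> * (\<integral>\<theta>. G \<theta> \<partial>?res) \<partial>\<nu>)" by (simp add: a)
    also have "\<dots> \<le> (\<integral>\<eta>. (\<integral>\<theta>. G \<theta> \<partial>?K \<eta>) \<partial>\<nu>)"
    proof (rule integral_mono)
      show "integrable \<nu> (\<lambda>\<eta>. ?a \<eta> * (\<integral>\<theta>. G \<theta> \<partial>?res))" using a_int by simp
      have "(\<lambda>\<eta>. \<integral>\<theta>. G \<theta> \<partial>?K \<eta>) \<in> borel_measurable (conf_on D)"
        by (rule measurable_compose[OF measurable_prob_algebraD[OF gas_kernel_measurable[OF \<mu> t]]
              integral_measurable_subprob_algebra[OF G(1)]])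
      moreover have "sets \<nu> = sets (conf_on D)" using \<nu> by (simp add: configuration_law_def)
      ultimately have [measurable]: "(\<lambda>\<eta>. \<integral>\<theta>. G \<theta> \<partial>?K \<eta>) \<in> borel_measurable \<nu>"
        using measurable_cong_sets[of \<nu> "conf_on D" "borel :: real measure" borel] by blast
      show "integrable \<nu> (\<lambda>\<eta>. \<integral>\<theta>. G \<theta> \<partial>?K \<eta>)"
        using unit_int(2)[OF prob_gas_kernel[OF \<mu> t] sets_gas_kernel[OF \<mu> t] G]
        by (intro \<nu>.integrable_const_bound[of _ 1] AE_I2) auto
      show "?a \<eta> * (\<integral>\<theta>. G \<theta> \<partial>?res) \<le> (\<integral>\<theta>. G \<theta> \<partial>?K \<eta>)" for \<eta> by (rule kernel_ge_reservoir[OF \<mu> t G])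
    qed
    also have "\<dots> = (\<integral>\<eta>. G \<eta> \<partial>?gas)" by (rule integral_gas_law[OF \<mu> t \<nu> G, symmetric])
    finally show ?thesis .
  qed
  define c where "c = absorbed_fraction \<nu> t"
  define r where "r = (\<integral>\<eta>. F \<eta> \<partial>?res)"
  define s where "s = (\<integral>\<eta>. F \<eta> \<partial>?gas)"
  have c: "0 \<le> c" "c \<le> 1" using a01 by (simp_all add: c_def)
  have r: "0 \<le> r" "r \<le> 1" using unit_int(2)[OF res F] by (simp_all add: r_def)
  have lower: "c * r \<le> s" using ge[OF F] by (simp add: c_def r_def s_def)
  have "(\<lambda>\<eta>. 1 - F \<eta>) \<in> borel_measurable (conf_on D)" using F(1) by measurable
  from ge[OF this] have "c * (\<integral>\<eta>. 1 - F \<eta> \<partial>?res) \<le> (\<integral>\<eta>. 1 - F \<eta> \<partial>?gas)" using F(2) by (simp add: c_def)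
  then have upper: "c * (1 - r) \<le> 1 - s"
    using unit_int(1)[OF res F] unit_int(1)[OF gas F] res.prob_space gas.prob_space by (simp add: r_def s_def)
  have "(1 - c) * r \<le> 1 - c" "(1 - c) * (1 - r) \<le> 1 - c"
    using c r by (auto intro!: mult_left_le)
  then show ?thesis
    using lower upper unfolding c_def[symmetric] r_def[symmetric] s_def[symmetric]
    by (simp add: algebra_simps abs_le_iff)
qed

section \<open>Reversible case: invariance, convergence and uniqueness\<close>

context
  fixes m :: "'a measure"
  assumes m: "finite_measure m" "sets m = sets R" and rev: "reversible D Y P m"
begin

abbreviation limit_intensity :: "'a measure" where
  "limit_intensity \<equiv> density m (exit_mean \<infinity>)"

abbreviation limit_law :: "'a multiset measure" where
  "limit_law \<equiv> poisson_law limit_intensity"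

lemma limit_poisson: "poisson_process limit_intensity limit_law"
  by (intro poisson_process_poisson_law finite_density_exit_mean m)

lemma limit_configuration_law: "configuration_law D limit_law"
proof -
  have "conf_space limit_intensity = conf_on D" by (rule conf_space_cong) (simp add: m(2))
  then show ?thesis using limit_poisson by (simp add: poisson_process_def configuration_law_def)
qed

lemma limit_law_invariant:
  assumes t: "0 \<le> t"
  shows "gas_law D Y P lam m limit_law t = limit_law"
proof (rule conf_law_eqI[of _ _ R])
  show "prob_space (gas_law D Y P lam m limit_law t)" by (rule prob_gas_law[OF m t limit_configuration_law])
  show "sets (gas_law D Y P lam m limit_law t) = sets (conf_on D)" by (rule sets_gas_law[OF m t limit_configuration_law])
  show "prob_space limit_law" "sets limit_law = sets (conf_on D)"
    using limit_configuration_law by (simp_all add: configuration_law_def)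
  fix g :: "'a \<Rightarrow> real" assume g: "simple_function R g" "\<And>x. g x \<in> {0..1}"
  have gR: "g \<in> borel_measurable R" by (rule borel_measurable_simple_function[OF g(1)])
  note og = outer_one_measurable[OF gR] outer_one_bounds[of g, OF g(2)]
  let ?u = "\<lambda>x. ennreal (1 - outer_one g x)"
  have u [measurable]: "?u \<in> borel_measurable borel" using og(1) by measurable
  note [measurable] = killed_measurable[OF t u] killed_measurable[OF t exit_mean_measurable]
  have space_m: "space m = D" using sets_eq_imp_space_eq[OF m(2)] by simp
  have borel_m: "f \<in> borel_measurable m" if "f \<in> borel_measurable borel" for f :: "'a \<Rightarrow> ennreal"
    by (rule measurable_restrict_cong[OF m(2) that])
  \<comment> \<open>This sum is the exponent at time \<open>t\<close> for the Poisson start;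
    invariance amounts to its being the exponent of the limit law itself.\<close>
  have "(\<integral>\<^sup>+x. killed t ?u x \<partial>limit_intensity) + (\<integral>\<^sup>+x. ?u x \<partial>reservoir_intensity D Y P lam m t) =
      (\<integral>\<^sup>+x. exit_mean \<infinity> x * killed t ?u x \<partial>m) + (\<integral>\<^sup>+x. exit_mean (ereal t) x * ?u x \<partial>m)"
    unfolding reservoir_intensity_eq
    by (intro arg_cong2[where f="(+)"] nn_integral_density borel_m) measurable
  also have "(\<integral>\<^sup>+x. exit_mean \<infinity> x * killed t ?u x \<partial>m) = (\<integral>\<^sup>+x. ?u x * killed t (exit_mean \<infinity>) x \<partial>m)"
    by (rule reversible_killed[OF m rev t]) measurable
  also have "\<dots> + (\<integral>\<^sup>+x. exit_mean (ereal t) x * ?u x \<partial>m) =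
      (\<integral>\<^sup>+x. ?u x * killed t (exit_mean \<infinity>) x + exit_mean (ereal t) x * ?u x \<partial>m)"
    by (intro nn_integral_add[symmetric] borel_m) measurable
  also have "\<dots> = (\<integral>\<^sup>+x. exit_mean \<infinity> x * ?u x \<partial>m)"
  proof (rule nn_integral_cong)
    fix x assume "x \<in> space m"
    then have "exit_mean \<infinity> x = killed t (exit_mean \<infinity>) x + exit_mean (ereal t) x"
      using exit_mean_split[of x t] t space_m by (simp add: killed_def)
    then show "?u x * killed t (exit_mean \<infinity>) x + exit_mean (ereal t) x * ?u x = exit_mean \<infinity> x * ?u x"
      by (simp add: distrib_left mult.commute)
  qed
  also have "\<dots> = (\<integral>\<^sup>+x. ?u x \<partial>limit_intensity)"
    by (intro nn_integral_density[symmetric] borel_m) measurable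
  finally have eq: "(\<integral>\<^sup>+x. killed t ?u x \<partial>limit_intensity) + (\<integral>\<^sup>+x. ?u x \<partial>reservoir_intensity D Y P lam m t) =
      (\<integral>\<^sup>+x. ?u x \<partial>limit_intensity)" .
  have sets_limit: "sets limit_intensity = sets R" by (simp add: m(2))
  have "(\<integral>\<eta>. point_prod g \<eta> \<partial>limit_law) = exp (- enn2real (\<integral>\<^sup>+x. ennreal (1 - g x) \<partial>limit_intensity))"
    using gR by (intro poisson_pgf_nn[OF limit_poisson] g(2)) (simp add: measurable_cong_sets[OF sets_limit refl])
  also have "(\<integral>\<^sup>+x. ennreal (1 - g x) \<partial>limit_intensity) = (\<integral>\<^sup>+x. ?u x \<partial>limit_intensity)"
    by (intro nn_integral_cong) (simp add: outer_one_def space_m)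
  finally show "(\<integral>\<eta>. point_prod g \<eta> \<partial>gas_law D Y P lam m limit_law t) = (\<integral>\<eta>. point_prod g \<eta> \<partial>limit_law)"
    using gas_law_poisson_pgf[OF m t limit_poisson sets_limit gR g(2)] eq by simp
qed

text \<open>Both laws are close to that of the reservoir particles alone, the limit law because it is
  invariant.\<close>

lemma tendsto_integral_gas_law:
  assumes \<nu>: "configuration_law D \<nu>"
    and F: "F \<in> borel_measurable (conf_on D)" "\<And>\<eta>. set_mset \<eta> \<subseteq> D \<Longrightarrow> F \<eta> \<in> {0..1 :: real}"
  shows "((\<lambda>t. \<integral>\<eta>. F \<eta> \<partial>gas_law D Y P lam m \<nu> t) \<longlongrightarrow> (\<integral>\<eta>. F \<eta> \<partial>limit_law)) at_top"
proof -
  let ?e = "\<lambda>t. (1 - absorbed_fraction \<nu> t) + (1 - absorbed_fraction limit_law t)"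
  have "((\<lambda>t. (\<integral>\<eta>. F \<eta> \<partial>gas_law D Y P lam m \<nu> t) - (\<integral>\<eta>. F \<eta> \<partial>limit_law)) \<longlongrightarrow> 0) at_top"
  proof (rule Lim_null_comparison)
    show "eventually (\<lambda>t. norm ((\<integral>\<eta>. F \<eta> \<partial>gas_law D Y P lam m \<nu> t) - (\<integral>\<eta>. F \<eta> \<partial>limit_law)) \<le> ?e t) at_top"
      using eventually_ge_at_top[of 0]
    proof eventually_elim
      case (elim t)
      show ?case
        using gas_law_near_reservoir_law[OF m elim \<nu> F]
          gas_law_near_reservoir_law[OF m elim limit_configuration_law F] limit_law_invariant[OF elim]
        by simp
    qed
    have "(?e \<longlongrightarrow> (1 - 1) + (1 - 1)) at_top"
      by (intro tendsto_add tendsto_diff tendsto_const tendsto_absorbed_fraction \<nu> limit_configuration_law)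
    then show "(?e \<longlongrightarrow> 0) at_top" by simp
  qed
  then show ?thesis by (simp add: LIM_zero_cancel)
qed

lemma gas_law_weakly_converges:
  assumes \<nu>: "configuration_law D \<nu>"
  shows "weakly_converges D (gas_law D Y P lam m \<nu>) limit_law"
  unfolding weakly_converges_def
proof (intro allI impI, elim conjE)
  fix F :: "'a multiset \<Rightarrow> real"
  assume F: "F \<in> borel_measurable (conf_on D)" and "bounded (F ` {\<eta>. set_mset \<eta> \<subseteq> D})"
  then obtain B where B: "0 < B" "\<And>\<eta>. set_mset \<eta> \<subseteq> D \<Longrightarrow> \<bar>F \<eta>\<bar> \<le> B"
    by (auto simp: bounded_pos)
  \<comment> \<open>The affine change taking [-B,B] onto [0,1], the range in which the merging
    estimate is stated.\<close>
  define G where "G \<eta> = (F \<eta> + B) / (2 * B)" for \<eta>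
  have G: "G \<in> borel_measurable (conf_on D)" using F unfolding G_def by measurable
  have G01: "G \<eta> \<in> {0..1}" if "set_mset \<eta> \<subseteq> D" for \<eta>
    using B(1) B(2)[OF that] by (auto simp: G_def field_simps abs_le_iff)
  have F_G: "(\<integral>\<eta>. F \<eta> \<partial>L) = 2 * B * (\<integral>\<eta>. G \<eta> \<partial>L) - B" if "configuration_law D L" for L
  proof -
    interpret L: prob_space L using that by (simp add: configuration_law_def)
    have sets_L: "sets L = sets (conf_on D)" using that by (simp add: configuration_law_def)
    have sp: "space L = {\<eta>. set_mset \<eta> \<subseteq> D}" using sets_eq_imp_space_eq[OF sets_L] by simp
    have "integrable L F"
      using F B(2) sp by (intro L.integrable_const_bound[of _ B] AE_I2) (auto simp: measurable_cong_sets[OF sets_L refl])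
    then have "(\<integral>\<eta>. G \<eta> \<partial>L) = ((\<integral>\<eta>. F \<eta> \<partial>L) + B) / (2 * B)"
      unfolding G_def by (simp add: L.prob_space)
    then show ?thesis using B(1) by (simp add: field_simps)
  qed
  have "((\<lambda>t. 2 * B * (\<integral>\<eta>. G \<eta> \<partial>gas_law D Y P lam m \<nu> t) - B) \<longlongrightarrow> 2 * B * (\<integral>\<eta>. G \<eta> \<partial>limit_law) - B) at_top"
    by (intro tendsto_intros tendsto_integral_gas_law[OF \<nu> G G01])
  moreover have "eventually (\<lambda>t. 2 * B * (\<integral>\<eta>. G \<eta> \<partial>gas_law D Y P lam m \<nu> t) - B =
      (\<integral>\<eta>. F \<eta> \<partial>gas_law D Y P lam m \<nu> t)) at_top"
    using eventually_ge_at_top[of 0]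
  proof eventually_elim
    case (elim t)
    have "configuration_law D (gas_law D Y P lam m \<nu> t)"
      using prob_gas_law[OF m elim \<nu>] sets_gas_law[OF m elim \<nu>] by (simp add: configuration_law_def)
    then show ?case by (simp add: F_G)
  qed
  ultimately have "((\<lambda>t. \<integral>\<eta>. F \<eta> \<partial>gas_law D Y P lam m \<nu> t) \<longlongrightarrow> 2 * B * (\<integral>\<eta>. G \<eta> \<partial>limit_law) - B) at_top"
    by (rule Lim_transform_eventually)
  then show "((\<lambda>t. \<integral>\<eta>. F \<eta> \<partial>gas_law D Y P lam m \<nu> t) \<longlongrightarrow> (\<integral>\<eta>. F \<eta> \<partial>limit_law)) at_top"
    using F_G[OF limit_configuration_law] by simp
qed

text \<open>A fixed starting configuration is the Dirac initial law. The two laws are identified for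
  \<open>t \<ge> 0\<close>, hence eventually, which suffices for the limit.\<close>

lemma gas_kernel_weakly_converges:
  assumes \<eta>: "set_mset \<eta> \<subseteq> D"
  shows "weakly_converges D (\<lambda>t. gas_kernel D Y P lam m t \<eta>) limit_law"
proof -
  let ?\<nu> = "return (conf_on D) \<eta>"
  have \<eta>': "\<eta> \<in> space (conf_on D)" using \<eta> by simp
  have conf: "configuration_law D ?\<nu>" using prob_space_return[OF \<eta>'] by (simp add: configuration_law_def)
  have kernel: "gas_law D Y P lam m ?\<nu> t = gas_kernel D Y P lam m t \<eta>" if "0 \<le> t" for t
    unfolding gas_law_def by (rule bind_return[OF measurable_prob_algebraD[OF gas_kernel_measurable[OF m that]] \<eta>'])
  have ev: "eventually (\<lambda>t. (\<integral>\<theta>. F \<theta> \<partial>gas_law D Y P lam m ?\<nu> t) = (\<integral>\<theta>. F \<theta> \<partial>gas_kernel D Y P lam m t \<eta>)) at_top"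
    for F :: "'a multiset \<Rightarrow> real"
    using eventually_ge_at_top[of 0] by eventually_elim (simp add: kernel)
  show ?thesis
    using gas_law_weakly_converges[OF conf]
    unfolding weakly_converges_def tendsto_cong[OF ev] .
qed

text \<open>For uniqueness, convergence is applied to indicators of measurable sets of
  configurations: under a stationary law these integrals do not change with time, so they already
  equal their limits.\<close>

lemma stationary_iff: "stationary D Y P lam m \<nu> \<longleftrightarrow> \<nu> = limit_law"
proof
  assume "\<nu> = limit_law"
  then show "stationary D Y P lam m \<nu>"
    using limit_configuration_law limit_law_invariant by (simp add: stationary_def)
next
  assume "stationary D Y P lam m \<nu>"
  then have \<nu>: "configuration_law D \<nu>" and inv: "\<And>t. 0 \<le> t \<Longrightarrow> gas_law D Y P lam m \<nu> t = \<nu>"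
    by (simp_all add: stationary_def)
  interpret \<nu>: prob_space \<nu> using \<nu> by (simp add: configuration_law_def)
  interpret L: prob_space limit_law using limit_configuration_law by (simp add: configuration_law_def)
  have sets_\<nu>: "sets \<nu> = sets (conf_on D)" and sets_L: "sets limit_law = sets (conf_on D)"
    using \<nu> limit_configuration_law by (simp_all add: configuration_law_def)
  show "\<nu> = limit_law"
  proof (rule measure_eqI)
    fix E assume "E \<in> sets \<nu>"
    then have E: "E \<in> sets (conf_on D)" using sets_\<nu> by simp
    have "((\<lambda>t. \<integral>\<eta>. indicator E \<eta> \<partial>gas_law D Y P lam m \<nu> t) \<longlongrightarrow> (\<integral>\<eta>. indicator E \<eta> \<partial>limit_law :: real)) at_top"
      using E by (intro tendsto_integral_gas_law[OF \<nu>]) (auto simp: indicator_def intro!: borel_measurable_indicator)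
    moreover have "eventually (\<lambda>t. (\<integral>\<eta>. indicator E \<eta> \<partial>gas_law D Y P lam m \<nu> t :: real) = (\<integral>\<eta>. indicator E \<eta> \<partial>\<nu>)) at_top"
      using eventually_ge_at_top[of 0] by eventually_elim (simp add: inv)
    ultimately have "((\<lambda>t::real. \<integral>\<eta>. indicator E \<eta> \<partial>\<nu> :: real) \<longlongrightarrow> (\<integral>\<eta>. indicator E \<eta> \<partial>limit_law)) at_top"
      by (rule Lim_transform_eventually)
    then have "(\<integral>\<eta>. indicator E \<eta> \<partial>\<nu> :: real) = (\<integral>\<eta>. indicator E \<eta> \<partial>limit_law)"
      by (simp add: tendsto_const_iff)
    moreover have "E \<inter> space \<nu> = E" "E \<inter> space limit_law = E"
      using sets.sets_into_space[of E \<nu>] sets.sets_into_space[of E limit_law] E sets_\<nu> sets_L by auto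
    ultimately have "measure \<nu> E = measure limit_law E" by simp
    then show "emeasure \<nu> E = emeasure limit_law E"
      by (simp add: \<nu>.emeasure_eq_measure L.emeasure_eq_measure)
  qed (simp add: sets_\<nu> sets_L)
qed

end

end

theorem theorem4p3:
  fixes D :: "(real^'d) set"
    and a :: "real^'d \<Rightarrow> real^'d^'d" and b :: "real^'d \<Rightarrow> real^'d"
    and M :: "'w measure" and Y :: "real \<Rightarrow> 'w \<Rightarrow> real^'d" and P :: "real^'d \<Rightarrow> 'w measure"
    and lam :: "real^'d \<Rightarrow> real"
  assumes "regular_domain D"
    and "diffusion_coefficients D a b"
    and "diffusion a b M Y P"
    and "\<forall>x\<in>D. AE \<omega> in P x. absorption_time D Y \<omega> < \<infinity>"
    and "lam \<in> borel_measurable (restrict_space borel (frontier D))"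
    and "\<forall>y\<in>frontier D. 0 \<le> lam y"
    and "bounded (lam ` frontier D)"
  shows
    "(\<forall>\<mu> \<rho> \<nu>. \<forall>t\<ge>0.
        finite_measure \<mu> \<and> sets \<mu> = sets (restrict_space borel D) \<and>
        finite_measure \<rho> \<and> sets \<rho> = sets (restrict_space borel D) \<and>
        poisson_process \<rho> \<nu> \<longrightarrow>
        (\<exists>Q. poisson_process
               (add_measure (dual_semigroup D Y P t \<rho>)
                 (distr (reservoir_intensity D Y P lam \<mu> t) (restrict_space borel (closure D)) (\<lambda>x. x))) Q \<and>
             gas_law D Y P lam \<mu> \<nu> t = distr Q (conf_on D) (filter_mset (\<lambda>x. x \<in> D)))) \<and>
     (\<forall>m. finite_measure m \<and> sets m = sets (restrict_space borel D) \<and> reversible D Y P m \<longrightarrow>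
        (\<exists>Q. poisson_process (density m (\<lambda>x. \<integral>\<^sup>+u. ennreal (lam u) \<partial>exit_law D Y P \<infinity> x)) Q \<and>
             (\<forall>\<nu>. stationary D Y P lam m \<nu> \<longleftrightarrow> \<nu> = Q) \<and>
             (\<forall>\<eta>. set_mset \<eta> \<subseteq> D \<longrightarrow> weakly_converges D (\<lambda>t. gas_kernel D Y P lam m t \<eta>) Q) \<and>
             (\<forall>\<nu>. configuration_law D \<nu> \<longrightarrow> weakly_converges D (gas_law D Y P lam m \<nu>) Q)))"
proof -
  obtain C where "\<forall>y\<in>frontier D. \<bar>lam y\<bar> \<le> C"
    using assms(7) by (auto simp: bounded_iff)
  then have C: "lam y \<le> C" if "y \<in> frontier D" for y
    using that by (meson abs_le_D1)
  have D: "open D" "D \<noteq> {}" "D \<noteq> UNIV"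
    using assms(1) not_bounded_UNIV by (auto simp: regular_domain_def)
  \<comment> \<open>A bounded set is not the whole space, so the nonempty set \<open>D\<close> has a
    frontier; the description of hitting times by distances relies on this.\<close>
  have frontier: "frontier D \<noteq> {}"
    using D(2,3) by (simp add: frontier_eq_empty)
  interpret absorbed_diffusion M Y P D lam C
    by standard (use assms(3-6) C D frontier in \<open>auto simp: diffusion_def\<close>)
  show ?thesis
  proof (intro conjI allI impI; elim conjE)
    fix \<mu> \<rho> \<nu> and t :: real
    assume "0 \<le> t" "finite_measure \<mu>" "sets \<mu> = sets (restrict_space borel D)"
      "finite_measure \<rho>" "sets \<rho> = sets (restrict_space borel D)" "poisson_process \<rho> \<nu>"
    then show "\<exists>Q. poisson_process
        (add_measure (dual_semigroup D Y P t \<rho>)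
          (distr (reservoir_intensity D Y P lam \<mu> t) (restrict_space borel (closure D)) (\<lambda>x. x))) Q \<and>
        gas_law D Y P lam \<mu> \<nu> t = distr Q (conf_on D) (filter_mset (\<lambda>x. x \<in> D))"
      by (intro poisson_initial_law)
  next
    fix m assume m: "finite_measure m" "sets m = sets (restrict_space borel D)" "reversible D Y P m"
    show "\<exists>Q. poisson_process (density m (\<lambda>x. \<integral>\<^sup>+u. ennreal (lam u) \<partial>exit_law D Y P \<infinity> x)) Q \<and>
        (\<forall>\<nu>. stationary D Y P lam m \<nu> \<longleftrightarrow> \<nu> = Q) \<and>
        (\<forall>\<eta>. set_mset \<eta> \<subseteq> D \<longrightarrow> weakly_converges D (\<lambda>t. gas_kernel D Y P lam m t \<eta>) Q) \<and>
        (\<forall>\<nu>. configuration_law D \<nu> \<longrightarrow> weakly_converges D (gas_law D Y P lam m \<nu>) Q)"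
      unfolding nn_integral_exit_law
    proof (intro exI conjI allI impI)
      show "poisson_process (density m (exit_mean \<infinity>)) (poisson_law (density m (exit_mean \<infinity>)))"
        by (rule limit_poisson[OF m])
    qed (rule stationary_iff[OF m] gas_kernel_weakly_converges[OF m] gas_law_weakly_converges[OF m]; assumption)+
  qed
qed

end
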